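(* Let $d=1$, let the interaction be $W(x,y)=-xy$, and let the confinement potential be of the form $V(x)=\frac{x^4}{4}-\lambda\frac{x^2}{2}$ with $\lambda\in\mathbb R$, or more generally suppose that $V$ is in the GHS class described in the context. Then for any $T>T_c$, the measure $m^N_T$ satisfies a log-Sobolev inequality with a constant independent of $N$. Moreover, the optimal log-Sobolev constant $\gamma^N_{\rm LS}(T)$ of $m^N_T$ vanishes linearly at $T_c$: $$\limsup_{N\to\infty}\gamma^N_{\rm LS}(T)\le c_1(T-T_c),\qquad \gamma^N_{\rm LS}(T)\ge c_2(T-T_c),\quad N\ge1,$$ for some constants $c_1,c_2>0$.
   Context: GHS class: $V\in C^2(\mathbb R,\mathbb R)$ is even, $\lim_{|x|\to\infty}V(x)=+\infty$, the restriction of $V'$ to $[0,\infty)$ is convex, and $V=V_c+\tilde V$ with $V_c\in C^2(\mathbb R,\mathbb R)$, $V_c''\ge1$, and $\tilde V$ Lipschitz or bounded. $\alpha_V(dx)\propto e^{-V(x)}dx$ is a probability measure on $\mathbb R$. For $T>0$, $N\ge1$, the mean-field measure on $\mathbb R^N$ is $$m^N_T(dx)=\frac1{Z^N_T}\exp\Big[-\frac1{2TN}\sum_{i,j=1}^N W(x_i,x_j)\Big]\prod_{i=1}^N\alpha_V(dx_i),$$ and it is assumed throughout that $Z^N_T<\infty$ for all $T>0$. The free energy of a probability measure $\rho$ on $\mathbb R$ is $\mathcal F_T(\rho)=\int\rho\log\rho\,dx+\int V\,d\rho+\frac1{2T}\int\int W(x,y)\rho(dx)\rho(dy)$ if $\rho$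 is absolutely continuous and $+\infty$ otherwise. The critical temperature is $T_c=\inf\{T>0:\mathcal F_{T'}\text{ has a unique global minimiser for each }T'>T\}$. A probability measure $\mu$ on $\mathbb R^n$ satisfies a log-Sobolev inequality with constant $\gamma>0$ if for every smooth compactly supported $F:\mathbb R^n\to\mathbb R_+$, $\mathrm{Ent}_\mu(F):=\mathbb E_\mu[F\log F]-\mathbb E_\mu[F]\log\mathbb E_\mu[F]\le\frac2\gamma\int|\nabla\sqrt F|^2d\mu$; the optimal constant is the largest such $\gamma$.
   Formalization: The lower bound is stated with c_2 uniform in N and in T on each bounded range T_c < T ≤ T_0 (c_2 may depend on T_0); a single c_2 for all T > T_c is impossible, since the optimal log-Sobolev constant for N=1 stays bounded as T tends to infinity. *)

theory Defs
  imports "HOL-Probability.Probability"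
begin

section \<open>The GHS class of confinement potentials\<close>

definition C2 :: "(real \<Rightarrow> real) \<Rightarrow> bool" where
  "C2 f \<longleftrightarrow> (\<forall>x. f differentiable (at x)) \<and> (\<forall>x. deriv f differentiable (at x)) \<and>
     continuous_on UNIV (deriv (deriv f))"

definition ghs_class :: "(real \<Rightarrow> real) \<Rightarrow> bool" where
  "ghs_class V \<longleftrightarrow>
     C2 V \<and> (\<forall>x. V (- x) = V x) \<and> filterlim V at_top at_infinity \<and>
     convex_on {0..} (deriv V) \<and>
     (\<exists>Vc Vt. (\<forall>x. V x = Vc x + Vt x) \<and> C2 Vc \<and> (\<forall>x. deriv (deriv Vc) x \<ge> 1) \<and>
        ((\<exists>L. L-lipschitz_on UNIV Vt) \<or> bounded (range Vt)))"

section \<open>The mean-field measure\<close>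

definition alpha :: "(real \<Rightarrow> real) \<Rightarrow> real measure" where
  "alpha V = density lborel (\<lambda>x. ennreal (exp (- V x) / (LINT y|lborel. exp (- V y))))"

text \<open>Since the number of particles varies inside the statements, a point of \<open>\<real>\<^sup>N\<close> is an
  extensional function on \<open>{..<N}\<close>, as in \<open>PiM {..<N}\<close>.\<close>

definition gibbs_weight ::
  "(real \<Rightarrow> real \<Rightarrow> real) \<Rightarrow> nat \<Rightarrow> real \<Rightarrow> (nat \<Rightarrow> real) \<Rightarrow> real" where
  "gibbs_weight W N T x = exp (- 1 / (2 * T * real N) * (\<Sum>i<N. \<Sum>j<N. W (x i) (x j)))"

definition partition_function ::
  "(real \<Rightarrow> real) \<Rightarrow> (real \<Rightarrow> real \<Rightarrow> real) \<Rightarrow> nat \<Rightarrow> real \<Rightarrow> ennreal" where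
  "partition_function V W N T =
     (\<integral>\<^sup>+x. ennreal (gibbs_weight W N T x) \<partial>PiM {..<N} (\<lambda>_. alpha V))"

definition mean_field_measure ::
  "(real \<Rightarrow> real) \<Rightarrow> (real \<Rightarrow> real \<Rightarrow> real) \<Rightarrow> nat \<Rightarrow> real \<Rightarrow> (nat \<Rightarrow> real) measure" where
  "mean_field_measure V W N T =
     density (PiM {..<N} (\<lambda>_. alpha V))
       (\<lambda>x. ennreal (gibbs_weight W N T x) / partition_function V W N T)"

section \<open>Free energy and critical temperature\<close>

text \<open>The three terms may have infinite values of opposite signs; the free energy is
  \<open>\<infinity>\<close> unless all three integrals converge absolutely. If \<open>V\<close> grows at least
  quadratically, finite relative entropy with respect to \<open>alpha V\<close> forces the absolute
  convergence of all three integrals for the interaction \<open>W x y = - x * y\<close>.\<close>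

definition lebesgue_density :: "real measure \<Rightarrow> real \<Rightarrow> real" where
  "lebesgue_density \<rho> x = enn2real (RN_deriv lborel \<rho> x)"

definition free_energy ::
  "(real \<Rightarrow> real) \<Rightarrow> (real \<Rightarrow> real \<Rightarrow> real) \<Rightarrow> real \<Rightarrow> real measure \<Rightarrow> ereal" where
  "free_energy V W T \<rho> =
     (if absolutely_continuous lborel \<rho> \<and>
         integrable lborel (\<lambda>x. lebesgue_density \<rho> x * ln (lebesgue_density \<rho> x)) \<and>
         integrable \<rho> V \<and>
         integrable (\<rho> \<Otimes>\<^sub>M \<rho>) (\<lambda>(x, y). W x y)
      then ereal ((LINT x|lborel. lebesgue_density \<rho> x * ln (lebesgue_density \<rho> x))
             + (LINT x|\<rho>. V x)
             + 1 / (2 * T) * (LINT (x, y)|(\<rho> \<Otimes>\<^sub>M \<rho>). W x y))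
      else \<infinity>)"

definition unique_minimiser ::
  "(real \<Rightarrow> real) \<Rightarrow> (real \<Rightarrow> real \<Rightarrow> real) \<Rightarrow> real \<Rightarrow> bool" where
  "unique_minimiser V W T \<longleftrightarrow>
     (\<exists>!\<rho>. is_arg_min (free_energy V W T) (\<lambda>\<rho>. \<rho> \<in> space (prob_algebra borel)) \<rho>)"

definition critical_temperature ::
  "(real \<Rightarrow> real) \<Rightarrow> (real \<Rightarrow> real \<Rightarrow> real) \<Rightarrow> real" where
  "critical_temperature V W = Inf {T. T > 0 \<and> (\<forall>T'>T. unique_minimiser V W T')}"

section \<open>Log-Sobolev inequalities on \<open>\<real>\<^sup>n\<close>\<close>

abbreviation Rn :: "nat \<Rightarrow> (nat \<Rightarrow> real) set" where
  "Rn n \<equiv> PiE {..<n} (\<lambda>_. UNIV)"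

definition partially_differentiable :: "nat \<Rightarrow> ((nat \<Rightarrow> real) \<Rightarrow> real) \<Rightarrow> (nat \<Rightarrow> real) \<Rightarrow> bool" where
  "partially_differentiable i F x \<longleftrightarrow> (\<lambda>t. F (x(i := t))) differentiable (at (x i))"

text \<open>A partial derivative is \<open>0\<close> where it does not exist. This matters only for
  \<open>sqrt F\<close> at zeros of a smooth \<open>F \<ge> 0\<close>. There the convention agrees almost everywhere with
  the weak gradient of the locally Lipschitz function \<open>sqrt F\<close>.\<close>

definition partial_deriv :: "nat \<Rightarrow> ((nat \<Rightarrow> real) \<Rightarrow> real) \<Rightarrow> (nat \<Rightarrow> real) \<Rightarrow> real" where
  "partial_deriv i F x =
     (if partially_differentiable i F x then deriv (\<lambda>t. F (x(i := t))) (x i) else 0)"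

definition grad_norm_sq :: "nat \<Rightarrow> ((nat \<Rightarrow> real) \<Rightarrow> real) \<Rightarrow> (nat \<Rightarrow> real) \<Rightarrow> real" where
  "grad_norm_sq n F x = (\<Sum>i<n. (partial_deriv i F x)\<^sup>2)"

text \<open>Continuity on \<open>Rn n\<close> refers to the product topology on functions, which induces the
  Euclidean topology there.\<close>

primrec Ck :: "nat \<Rightarrow> nat \<Rightarrow> ((nat \<Rightarrow> real) \<Rightarrow> real) \<Rightarrow> bool" where
  "Ck n 0 F \<longleftrightarrow> continuous_on (Rn n) F"
| "Ck n (Suc k) F \<longleftrightarrow> continuous_on (Rn n) F \<and>
     (\<forall>i<n. (\<forall>x\<in>Rn n. partially_differentiable i F x) \<and> Ck n k (partial_deriv i F))"

definition smooth :: "nat \<Rightarrow> ((nat \<Rightarrow> real) \<Rightarrow> real) \<Rightarrow> bool" where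
  "smooth n F \<longleftrightarrow> (\<forall>k. Ck n k F)"

definition compactly_supported :: "nat \<Rightarrow> ((nat \<Rightarrow> real) \<Rightarrow> real) \<Rightarrow> bool" where
  "compactly_supported n F \<longleftrightarrow> (\<exists>K. compact K \<and> K \<subseteq> Rn n \<and> (\<forall>x\<in>Rn n - K. F x = 0))"

definition Ent :: "(nat \<Rightarrow> real) measure \<Rightarrow> ((nat \<Rightarrow> real) \<Rightarrow> real) \<Rightarrow> real" where
  "Ent \<mu> F = (LINT x|\<mu>. F x * ln (F x)) - (LINT x|\<mu>. F x) * ln (LINT x|\<mu>. F x)"

definition log_sobolev :: "nat \<Rightarrow> (nat \<Rightarrow> real) measure \<Rightarrow> real \<Rightarrow> bool" where
  "log_sobolev n \<mu> \<gamma> \<longleftrightarrow> \<gamma> > 0 \<and>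
     (\<forall>F. smooth n F \<and> compactly_supported n F \<and> (\<forall>x\<in>Rn n. F x \<ge> 0) \<longrightarrow>
        Ent \<mu> F \<le> 2 / \<gamma> * (LINT x|\<mu>. grad_norm_sq n (\<lambda>y. sqrt (F y)) x))"

text \<open>The supremum is taken in the extended reals: it is \<open>-\<infinity>\<close> if no log-Sobolev
  inequality holds.\<close>

definition log_sobolev_constant :: "nat \<Rightarrow> (nat \<Rightarrow> real) measure \<Rightarrow> ereal" where
  "log_sobolev_constant n \<mu> = Sup {ereal \<gamma> | \<gamma>. log_sobolev n \<mu> \<gamma>}"

end

theory Submission
  imports Defs "HOL-Computational_Algebra.Polynomial"
begin

text \<open>
  Write \<open>p t = ln (\<integral> exp (t x) d\<alpha>)\<close> for the single-particle measure \<open>\<alpha> = alpha V\<close>, \<open>sigma2\<close> for the variance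
  of \<open>\<alpha>\<close> and \<open>S\<close> for the sum of the coordinates. Everything rests on one inequality: among the
  exponential tilts of \<open>\<alpha>\<close> the variance is largest at tilt \<open>0\<close> (\<open>tilted_variance_le\<close>). It says
  \<open>p'' \<le> sigma2\<close>, so that \<open>t\<^sup>2 T / 2 - p t\<close> is strongly convex with constant \<open>T - sigma2\<close>. The proof is
  a rotation of two independent copies of the particle followed by two Chebyshev inequalities,
  and it uses the convexity of \<open>V'\<close>.

  The critical temperature equals \<open>sigma2\<close> (\<open>critical_temperature_eq\<close>). The free energy of \<open>\<rho>\<close> with
  mean \<open>m\<close> is, up to a constant, the relative entropy with respect to \<open>\<alpha>\<close> minus \<open>m\<^sup>2 / (2 T)\<close>, and the
  relative entropy is at least \<open>t m - p t\<close> for every \<open>t\<close>. For \<open>T > sigma2\<close> the choice \<open>t = m / T\<close> and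
  \<open>p t \<le> sigma2 t\<^sup>2 / 2\<close> make \<open>\<alpha>\<close> the unique minimiser. For \<open>T < sigma2\<close> a unique minimiser would be
  symmetric, hence no better than \<open>\<alpha>\<close>, but small tilts of \<open>\<alpha>\<close> are better.

  For the lower bound on the log-Sobolev constant the Hubbard--Stratonovich transformation writes the
  mean-field measure as a mixture, over a real parameter \<open>t\<close>, of products of the tilts of \<open>\<alpha>\<close>. The
  mixing measure has a potential that is strongly convex with constant \<open>N (T - sigma2)\<close>. The entropy
  splits into the mean of the entropies under the products and the entropy of the conditional means
  \<open>G t\<close>. The tilts satisfy a log-Sobolev inequality uniformly in \<open>t\<close> (\<open>log_sobolev_tilt\<close>), which
  tensorises. The mixing measure satisfies one with constant \<open>N (T - sigma2)\<close>, and \<open>G'\<close> is a covariance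
  with \<open>S\<close>, whose square is at most \<open>2 N sigma2\<close> times \<open>G\<close> times the entropy under the product measure
  (\<open>covariance_sq_le_ent\<close>). So the second entropy is at most \<open>sigma2 / (T - sigma2)\<close> times the first.

  Both log-Sobolev inequalities on the line come from \<open>log_sobolev_real\<close>, the inequality for a
  strongly convex potential, proved by monotone transport.

  For the upper bound the log-Sobolev inequality is tested with \<open>exp (S / sqrt N)\<close>, approximated by
  products of smooth functions with compact support. By the same Gaussian mixture and dominated
  convergence the exponential moments of \<open>S / sqrt N\<close> converge to those of a Gaussian of variance
  \<open>v = T sigma2 / (T - sigma2)\<close>, and the inequality gives a constant of at most \<open>1 / v\<close> in the limit.
\<close>

section \<open>Entropy with respect to a probability measure\<close>

definition ent :: "'a measure \<Rightarrow> ('a \<Rightarrow> real) \<Rightarrow> real" where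
  "ent M f = (LINT x|M. f x * ln (f x)) - (LINT x|M. f x) * ln (LINT x|M. f x)"

definition pos_bounded :: "'a measure \<Rightarrow> ('a \<Rightarrow> real) \<Rightarrow> bool" where
  "pos_bounded M f \<longleftrightarrow> f \<in> borel_measurable M \<and>
     (\<exists>e>0. \<exists>B. \<forall>x\<in>space M. e \<le> f x \<and> f x \<le> B)"

lemma pos_boundedI:
  "f \<in> borel_measurable M \<Longrightarrow> 0 < e \<Longrightarrow> (\<And>x. x \<in> space M \<Longrightarrow> e \<le> f x) \<Longrightarrow>
   (\<And>x. x \<in> space M \<Longrightarrow> f x \<le> B) \<Longrightarrow> pos_bounded M f"
  unfolding pos_bounded_def by blast

lemma pos_boundedE:
  assumes "pos_bounded M f"
  obtains e B where "f \<in> borel_measurable M" "0 < e" "0 < B"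
    "\<And>x. x \<in> space M \<Longrightarrow> e \<le> f x" "\<And>x. x \<in> space M \<Longrightarrow> f x \<le> B"
proof -
  from assms obtain e B where "f \<in> borel_measurable M" "0 < e"
    "\<forall>x\<in>space M. e \<le> f x \<and> f x \<le> B"
    unfolding pos_bounded_def by blast
  then show ?thesis using that[of e "max B 1"] by (metis less_max_iff_disj max.coboundedI1 zero_less_one)
qed

lemma pos_bounded_measurable: "pos_bounded M f \<Longrightarrow> f \<in> borel_measurable M"
  by (simp add: pos_bounded_def)

lemma pos_bounded_pos: "pos_bounded M f \<Longrightarrow> x \<in> space M \<Longrightarrow> 0 < f x"
  unfolding pos_bounded_def by force

lemma integrable_bounded:
  fixes f :: "'a \<Rightarrow> real"
  assumes "finite_measure M" "f \<in> borel_measurable M" "\<And>x. x \<in> space M \<Longrightarrow> \<bar>f x\<bar> \<le> B"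
  shows "integrable M f"
  using assms by (intro finite_measure.integrable_const_bound[of M f B]) auto

lemma abs_ln_between:
  fixes e x B :: real
  assumes "0 < e" "e \<le> x" "x \<le> B"
  shows "\<bar>ln x\<bar> \<le> \<bar>ln e\<bar> + \<bar>ln B\<bar>"
proof -
  have "ln e \<le> ln x" "ln x \<le> ln B" using assms by auto
  then show ?thesis by linarith
qed

lemma pos_bounded_integrable:
  assumes "prob_space M" "pos_bounded M f"
  shows "integrable M f" "integrable M (\<lambda>x. f x * ln (f x))" "integrable M (\<lambda>x. ln (f x))"
proof -
  interpret prob_space M by fact
  from assms(2) obtain e B where f[measurable]: "f \<in> borel_measurable M" and e: "0 < e" "0 < B"
    "\<And>x. x \<in> space M \<Longrightarrow> e \<le> f x" "\<And>x. x \<in> space M \<Longrightarrow> f x \<le> B"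
    by (rule pos_boundedE) blast
  have l: "\<bar>ln (f x)\<bar> \<le> \<bar>ln e\<bar> + \<bar>ln B\<bar>" if "x \<in> space M" for x
    by (rule abs_ln_between) (use e that in auto)
  have a: "\<bar>f x\<bar> \<le> B" if "x \<in> space M" for x using e(1) e(3,4)[OF that] by linarith
  show "integrable M f" by (rule integrable_bounded[where B=B]) (use a in \<open>auto intro: finite_measure_axioms\<close>)
  show "integrable M (\<lambda>x. ln (f x))"
    by (rule integrable_bounded[where B="\<bar>ln e\<bar> + \<bar>ln B\<bar>"]) (use l in \<open>auto intro: finite_measure_axioms\<close>)
  show "integrable M (\<lambda>x. f x * ln (f x))"
    by (rule integrable_bounded[where B="B * (\<bar>ln e\<bar> + \<bar>ln B\<bar>)"])
       (use a l e in \<open>auto intro!: finite_measure_axioms mult_mono simp: abs_mult\<close>)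
qed

lemma integral_between:
  fixes f :: "'a \<Rightarrow> real"
  assumes "prob_space M" "integrable M f" "\<And>x. x \<in> space M \<Longrightarrow> e \<le> f x" "\<And>x. x \<in> space M \<Longrightarrow> f x \<le> B"
  shows "e \<le> (LINT x|M. f x)" "(LINT x|M. f x) \<le> B"
proof -
  interpret prob_space M by fact
  show "e \<le> (LINT x|M. f x)" by (rule integral_ge_const) (use assms in auto)
  show "(LINT x|M. f x) \<le> B" by (rule integral_le_const) (use assms in auto)
qed

lemma pos_bounded_integral_pos:
  assumes "prob_space M" "pos_bounded M f"
  shows "0 < (LINT x|M. f x)"
proof -
  from assms(2) obtain e B where e: "0 < e" "\<And>x. x \<in> space M \<Longrightarrow> e \<le> f x"
     "\<And>x. x \<in> space M \<Longrightarrow> f x \<le> B"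
    by (rule pos_boundedE) blast
  from integral_between(1)[OF assms(1) pos_bounded_integrable(1)[OF assms] e(2,3)] e(1)
  show ?thesis by linarith
qed

text \<open>The tangent line of \<open>a ln a\<close> at \<open>c\<close>; the entropy inequalities of this section are integrals of it.\<close>

lemma mult_ln_tangent:
  fixes a c :: real
  assumes "0 < a" "0 < c"
  shows "a * ln c + a - c \<le> a * ln a"
proof -
  have "ln (c / a) \<le> c / a - 1" using assms by (intro ln_le_minus_one) auto
  then have "a * (ln c - ln a) \<le> a * (c / a - 1)" using assms by (simp add: ln_div)
  then show ?thesis using assms by (simp add: algebra_simps)
qed

text \<open>The Gibbs variational inequality, applied with an exponential-moment bound on \<open>g\<close>.\<close>

lemma ent_variational:
  assumes M: "prob_space M" and f: "pos_bounded M f"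
    and g: "integrable M (\<lambda>x. f x * g x)" and eg: "integrable M (\<lambda>x. exp (g x))"
  shows "(LINT x|M. f x * g x) \<le> ent M f + (LINT x|M. f x) * ln (LINT x|M. exp (g x))"
proof -
  interpret prob_space M by fact
  define E where "E = (LINT x|M. exp (g x))"
  have Epos: "0 < E"
    unfolding E_def using integral_less_AE_space[OF _ eg, of "\<lambda>_. 0"] by (simp add: emeasure_space_1)
  have m: "0 < (LINT x|M. f x)" by (rule pos_bounded_integral_pos[OF M f])
  define c where "c = (LINT x|M. f x) / E"
  have c: "0 < c" using m Epos by (simp add: c_def)
  have lnc: "ln c = ln (LINT x|M. f x) - ln E" using m Epos by (simp add: c_def ln_div)
  note i = pos_bounded_integrable[OF M f]
  have "(LINT x|M. f x * ln c + f x * g x + f x - c * exp (g x)) \<le> (LINT x|M. f x * ln (f x))"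
  proof (rule integral_mono)
    fix x assume x: "x \<in> space M"
    from mult_ln_tangent[OF pos_bounded_pos[OF f x], of "c * exp (g x)"] c
    show "f x * ln c + f x * g x + f x - c * exp (g x) \<le> f x * ln (f x)"
      by (simp add: ln_mult algebra_simps)
  qed (use i g eg in auto)
  also have "(LINT x|M. f x * ln c + f x * g x + f x - c * exp (g x))
     = (LINT x|M. f x) * ln c + (LINT x|M. f x * g x) + (LINT x|M. f x) - c * E"
    using i g eg by (simp add: E_def)
  also have "c * E = (LINT x|M. f x)" using Epos by (simp add: c_def)
  finally show ?thesis by (simp add: ent_def lnc E_def[symmetric] algebra_simps)
qed

lemma ent_nonneg:
  assumes M: "prob_space M" and f: "pos_bounded M f"
  shows "0 \<le> ent M f"
proof -
  interpret prob_space M by fact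
  show ?thesis using ent_variational[OF M f, of "\<lambda>_. 0"] by (simp add: prob_space)
qed

text \<open>The tangent of \<open>a ln a\<close> at an arbitrary point gives an upper bound for the entropy, the
  tangent at the mean gives the entropy itself.\<close>

lemma ent_le_tangent_integral:
  assumes M: "prob_space M" and f: "pos_bounded M f" and c: "0 < c"
  shows "ent M f \<le> (LINT x|M. f x * ln (f x) - f x * ln c - f x + c)"
proof -
  interpret prob_space M by fact
  have m: "0 < (LINT x|M. f x)" by (rule pos_bounded_integral_pos[OF M f])
  note i = pos_bounded_integrable[OF M f]
  have "(LINT x|M. f x * ln (f x) - f x * ln c - f x + c) =
     (LINT x|M. f x * ln (f x)) - (LINT x|M. f x) * ln c - (LINT x|M. f x) + c"
    using i by (simp add: prob_space)
  with mult_ln_tangent[OF m c] show ?thesis by (simp add: ent_def)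
qed

lemma ent_eq_tangent_integral:
  assumes M: "prob_space M" and f: "pos_bounded M f"
  shows "ent M f = (LINT x|M. f x * ln (f x) - f x * ln (LINT x|M. f x) - f x + (LINT x|M. f x))"
proof -
  interpret prob_space M by fact
  note i = pos_bounded_integrable[OF M f]
  show ?thesis using i by (simp add: prob_space ent_def)
qed

lemma abs_ent_le:
  assumes M: "prob_space M" and f: "f \<in> borel_measurable M"
    and e: "0 < e" "\<And>x. x \<in> space M \<Longrightarrow> e \<le> f x" "\<And>x. x \<in> space M \<Longrightarrow> f x \<le> B"
  shows "\<bar>ent M f\<bar> \<le> 2 * (\<bar>B\<bar> * (\<bar>ln e\<bar> + \<bar>ln B\<bar>))"
proof -
  have p: "pos_bounded M f" using f e by (rule pos_boundedI)
  have bb: "\<bar>a * ln a\<bar> \<le> \<bar>B\<bar> * (\<bar>ln e\<bar> + \<bar>ln B\<bar>)" if "e \<le> a" "a \<le> B" for a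
    using abs_ln_between[OF e(1) that] that e(1) by (auto simp: abs_mult intro!: mult_mono)
  have 1: "e \<le> (LINT x|M. f x)" "(LINT x|M. f x) \<le> B"
    using integral_between[OF M pos_bounded_integrable(1)[OF M p] e(2,3)] by auto
  have "\<bar>f x * ln (f x)\<bar> \<le> \<bar>B\<bar> * (\<bar>ln e\<bar> + \<bar>ln B\<bar>)" if "x \<in> space M" for x
    using bb e that by blast
  then have "- (\<bar>B\<bar> * (\<bar>ln e\<bar> + \<bar>ln B\<bar>)) \<le> (LINT x|M. f x * ln (f x))"
      "(LINT x|M. f x * ln (f x)) \<le> \<bar>B\<bar> * (\<bar>ln e\<bar> + \<bar>ln B\<bar>)"
    using integral_between[OF M pos_bounded_integrable(2)[OF M p], of "- (\<bar>B\<bar> * (\<bar>ln e\<bar> + \<bar>ln B\<bar>))" "\<bar>B\<bar> * (\<bar>ln e\<bar> + \<bar>ln B\<bar>)"]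
    by (simp_all add: abs_le_iff minus_le_iff)
  then show ?thesis using bb[OF 1] unfolding ent_def by linarith
qed

text \<open>The Holley--Stroock perturbation principle: the entropy is the minimum over \<open>c\<close> of the
  integral of the nonnegative function \<open>f ln f - f ln c - f + c\<close>, so it changes by at most the
  supremum of the density.\<close>

lemma ent_density_le:
  assumes M: "prob_space M" and h[measurable]: "h \<in> borel_measurable M"
    and hb: "\<And>x. x \<in> space M \<Longrightarrow> 0 \<le> h x" "\<And>x. x \<in> space M \<Longrightarrow> h x \<le> b"
    and D: "prob_space (density M (\<lambda>x. ennreal (h x)))" and f: "pos_bounded M f"
  shows "ent (density M (\<lambda>x. ennreal (h x))) f \<le> b * ent M f"
proof -
  interpret prob_space M by fact
  define D where "D = density M (\<lambda>x. ennreal (h x))"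
  have fm[measurable]: "f \<in> borel_measurable M" using f by (rule pos_bounded_measurable)
  define c where "c = (LINT x|M. f x)"
  have c: "0 < c" unfolding c_def by (rule pos_bounded_integral_pos[OF M f])
  let ?g = "\<lambda>x. f x * ln (f x) - f x * ln c - f x + c"
  have f': "pos_bounded D f" using f by (simp add: pos_bounded_def D_def)
  have g0: "0 \<le> ?g x" if "x \<in> space M" for x
    using mult_ln_tangent[OF pos_bounded_pos[OF f that] c] by linarith
  note i = pos_bounded_integrable[OF M f]
  have ig: "integrable M ?g" using i by auto
  have "ent D f \<le> (LINT x|D. ?g x)"
    using D f' c by (intro ent_le_tangent_integral) (auto simp: D_def)
  also have "\<dots> = (LINT x|M. h x * ?g x)"
    unfolding D_def using hb by (subst integral_density) auto
  also have "\<dots> \<le> (LINT x|M. b * ?g x)"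
  proof (rule integral_mono)
    show "integrable M (\<lambda>x. b * ?g x)" using ig by (rule integrable_mult_right)
    show "integrable M (\<lambda>x. h x * ?g x)"
    proof (rule Bochner_Integration.integrable_bound[OF \<open>integrable M (\<lambda>x. b * ?g x)\<close>])
      show "AE x in M. norm (h x * ?g x) \<le> norm (b * ?g x)"
      proof (rule AE_I2)
        fix x assume x: "x \<in> space M"
        have "\<bar>h x\<bar> \<le> \<bar>b\<bar>" using hb[OF x] by linarith
        then show "norm (h x * ?g x) \<le> norm (b * ?g x)"
          by (simp only: real_norm_def abs_mult) (intro mult_right_mono, auto)
      qed
    qed auto
    show "h x * ?g x \<le> b * ?g x" if "x \<in> space M" for x
      using g0[OF that] hb[OF that] by (intro mult_right_mono) auto
  qed
  also have "\<dots> = b * ent M f"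
    using ent_eq_tangent_integral[OF M f] by (simp only: c_def integral_mult_right_zero)
  finally show ?thesis by (simp add: D_def)
qed

text \<open>Jensen's inequality for the jointly convex function \<open>a ln (a / b)\<close>.\<close>

lemma ent_integral_le:
  assumes M: "prob_space M" and N: "prob_space N"
    and F: "pos_bounded (M \<Otimes>\<^sub>M N) (\<lambda>(x, y). F x y)"
  shows "ent N (\<lambda>y. LINT x|M. F x y) \<le> (LINT x|M. ent N (\<lambda>y. F x y))"
proof -
  interpret M: prob_space M by fact
  interpret N: prob_space N by fact
  interpret P: pair_prob_space M N ..
  have P: "prob_space (M \<Otimes>\<^sub>M N)" by (rule P.prob_space_axioms)
  from F obtain e B where Fm[measurable]: "(\<lambda>(x, y). F x y) \<in> borel_measurable (M \<Otimes>\<^sub>M N)"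
    and e: "0 < e" "0 < B" and e': "\<And>x y. x \<in> space M \<Longrightarrow> y \<in> space N \<Longrightarrow> e \<le> F x y"
      "\<And>x y. x \<in> space M \<Longrightarrow> y \<in> space N \<Longrightarrow> F x y \<le> B"
    by (elim pos_boundedE) (fastforce simp: space_pair_measure)
  define G where "G = (\<lambda>y. LINT x|M. F x y)"
  define h where "h = (\<lambda>x. LINT y|N. F x y)"
  have Fx: "pos_bounded N (\<lambda>y. F x y)" if "x \<in> space M" for x
    by (rule pos_boundedI[of _ _ e B]) (use that e e' in auto)
  have Fy: "pos_bounded M (\<lambda>x. F x y)" if "y \<in> space N" for y
    by (rule pos_boundedI[of _ _ e B]) (use that e e' in auto)
  have Gb: "e \<le> G y" "G y \<le> B" if "y \<in> space N" for y
    using integral_between[OF M pos_bounded_integrable(1)[OF M Fy[OF that]], of e B] e' that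
    by (auto simp: G_def)
  have hb: "e \<le> h x" "h x \<le> B" if "x \<in> space M" for x
    using integral_between[OF N pos_bounded_integrable(1)[OF N Fx[OF that]], of e B] e' that
    by (auto simp: h_def)
  have hm[measurable]: "h \<in> borel_measurable M" unfolding h_def by measurable
  have Gm[measurable]: "G \<in> borel_measurable N"
    unfolding G_def by (intro M.borel_measurable_lebesgue_integral) (simp add: split_beta')
  have Gp: "pos_bounded N G" and hp: "pos_bounded M h"
    using Gb hb e(1) by (auto intro!: pos_boundedI[of _ _ e B])
  define H where "H = (LINT y|N. G y)"
  have iF: "integrable (M \<Otimes>\<^sub>M N) (\<lambda>(x, y). F x y)" using pos_bounded_integrable(1)[OF P F] .
  have H': "H = (LINT x|M. h x)"
    unfolding H_def G_def h_def using P.Fubini_integral[OF iF] by simp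
  have Hpos: "0 < H" unfolding H_def by (rule pos_bounded_integral_pos[OF N Gp])
  have FlnF: "integrable (M \<Otimes>\<^sub>M N) (\<lambda>(x, y). F x y * ln (F x y))"
    using pos_bounded_integrable(2)[OF P F] by (simp add: split_beta')
  \<comment> \<open>The tangent of \<open>a ln a\<close> at \<open>h x * G y / H\<close>, evaluated at \<open>a = F x y\<close>.\<close>
  define K where "K x y = F x y * ln (h x) + F x y * ln (G y) - F x y * ln H + F x y - h x * G y / H" for x y
  have abh: "\<bar>ln (h x)\<bar> \<le> \<bar>ln e\<bar> + \<bar>ln B\<bar>" if "x \<in> space M" for x
    by (rule abs_ln_between) (use e hb that in auto)
  have abG: "\<bar>ln (G y)\<bar> \<le> \<bar>ln e\<bar> + \<bar>ln B\<bar>" if "y \<in> space N" for y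
    by (rule abs_ln_between) (use e Gb that in auto)
  have absF: "\<bar>F x y\<bar> \<le> B" if "x \<in> space M" "y \<in> space N" for x y
    using e(1) e'[OF that] by linarith
  have abGB: "\<bar>G y\<bar> \<le> B" if "y \<in> space N" for y using e(1) Gb[OF that] by linarith
  have abhB: "\<bar>h x\<bar> \<le> B" if "x \<in> space M" for x using e(1) hb[OF that] by linarith
  have i1: "integrable (M \<Otimes>\<^sub>M N) (\<lambda>(x, y). F x y * ln (h x))"
    by (rule integrable_bounded[OF P.finite_measure_axioms, of _ "B * (\<bar>ln e\<bar> + \<bar>ln B\<bar>)"])
      (use absF abh e in \<open>auto simp: space_pair_measure abs_mult intro!: mult_mono\<close>)
  have i2: "integrable (M \<Otimes>\<^sub>M N) (\<lambda>(x, y). F x y * ln (G y))"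
    by (rule integrable_bounded[OF P.finite_measure_axioms, of _ "B * (\<bar>ln e\<bar> + \<bar>ln B\<bar>)"])
      (use absF abG e in \<open>auto simp: space_pair_measure abs_mult intro!: mult_mono\<close>)
  have i3: "integrable (M \<Otimes>\<^sub>M N) (\<lambda>(x, y). h x * G y)"
    by (rule integrable_bounded[OF P.finite_measure_axioms, of _ "B * B"])
      (use abGB abhB e in \<open>auto simp: space_pair_measure abs_mult intro!: mult_mono\<close>)
  have iK: "integrable (M \<Otimes>\<^sub>M N) (\<lambda>(x, y). K x y)"
    using i1 i2 i3 iF unfolding K_def split_beta'
    by (intro Bochner_Integration.integrable_add Bochner_Integration.integrable_diff
        integrable_mult_left integrable_divide) auto
  have ilnh: "(LINT x|M. LINT y|N. F x y * ln (h x)) = (LINT x|M. h x * ln (h x))"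
    by (simp add: h_def)
  have ilnG: "(LINT x|M. LINT y|N. F x y * ln (G y)) = (LINT y|N. G y * ln (G y))"
    using P.Fubini_integral[OF i2] by (simp add: G_def)
  have ihG: "(LINT x|M. LINT y|N. h x * G y) = H * H"
    by (simp add: H' [symmetric] H_def[symmetric])
  have iFF: "(LINT x|M. LINT y|N. F x y) = H" using H' h_def by simp
  have e1: "integral\<^sup>L (M \<Otimes>\<^sub>M N) (\<lambda>(x, y). K x y) =
      (LINT x|M. h x * ln (h x)) + (LINT y|N. G y * ln (G y)) - H * ln H"
  proof -
    have "integral\<^sup>L (M \<Otimes>\<^sub>M N) (\<lambda>(x, y). K x y) =
       integral\<^sup>L (M \<Otimes>\<^sub>M N) (\<lambda>(x, y). F x y * ln (h x)) + integral\<^sup>L (M \<Otimes>\<^sub>M N) (\<lambda>(x, y). F x y * ln (G y))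
       - integral\<^sup>L (M \<Otimes>\<^sub>M N) (\<lambda>(x, y). F x y) * ln H + integral\<^sup>L (M \<Otimes>\<^sub>M N) (\<lambda>(x, y). F x y)
       - integral\<^sup>L (M \<Otimes>\<^sub>M N) (\<lambda>(x, y). h x * G y) / H"
      using i1 i2 i3 iF unfolding K_def split_beta' by simp
    also have "integral\<^sup>L (M \<Otimes>\<^sub>M N) (\<lambda>(x, y). F x y * ln (h x)) = (LINT x|M. h x * ln (h x))"
      using P.integral_fst'[OF i1] ilnh by simp
    also have "integral\<^sup>L (M \<Otimes>\<^sub>M N) (\<lambda>(x, y). F x y * ln (G y)) = (LINT y|N. G y * ln (G y))"
      using P.integral_fst'[OF i2] ilnG by simp
    also have "integral\<^sup>L (M \<Otimes>\<^sub>M N) (\<lambda>(x, y). F x y) = H"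
      using P.integral_fst'[OF iF] iFF by simp
    also have "integral\<^sup>L (M \<Otimes>\<^sub>M N) (\<lambda>(x, y). h x * G y) = H * H"
      using P.integral_fst'[OF i3] ihG by simp
    finally show ?thesis using Hpos by simp
  qed
  have e2: "integral\<^sup>L (M \<Otimes>\<^sub>M N) (\<lambda>(x, y). K x y) \<le> integral\<^sup>L (M \<Otimes>\<^sub>M N) (\<lambda>(x, y). F x y * ln (F x y))"
  proof (rule integral_mono[OF iK FlnF])
    fix z assume "z \<in> space (M \<Otimes>\<^sub>M N)"
    then obtain x y where z: "z = (x, y)" "x \<in> space M" "y \<in> space N" by (auto simp: space_pair_measure)
    have p: "0 < F x y" "0 < h x" "0 < G y" using e(1) e'[OF z(2,3)] hb[OF z(2)] Gb[OF z(3)] by linarith+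
    show "(case z of (x, y) \<Rightarrow> K x y) \<le> (case z of (x, y) \<Rightarrow> F x y * ln (F x y))"
      using mult_ln_tangent[OF p(1), of "h x * G y / H"] p Hpos
      by (simp add: z K_def ln_mult ln_div algebra_simps)
  qed
  have "(LINT x|M. ent N (\<lambda>y. F x y)) = (LINT x|M. (LINT y|N. F x y * ln (F x y)) - h x * ln (h x))"
    by (simp add: ent_def h_def)
  also have "\<dots> = (LINT x|M. LINT y|N. F x y * ln (F x y)) - (LINT x|M. h x * ln (h x))"
    using P.integrable_fst[OF FlnF] pos_bounded_integrable(2)[OF M hp]
    by (intro Bochner_Integration.integral_diff) auto
  also have "(LINT x|M. LINT y|N. F x y * ln (F x y)) = integral\<^sup>L (M \<Otimes>\<^sub>M N) (\<lambda>(x, y). F x y * ln (F x y))"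
    using P.integral_fst'[OF FlnF] by simp
  finally show ?thesis using e1 e2 by (simp add: ent_def G_def[symmetric] H_def[symmetric])
qed

text \<open>Tensorisation: the chain rule splits off one coordinate, and the convexity of the entropy
  moves the integration over that coordinate outside the remaining entropies.\<close>

lemma ent_PiM_le:
  assumes I: "finite I" and M: "\<And>i. prob_space (M i)" and F: "pos_bounded (PiM I M) F"
  shows "ent (PiM I M) F \<le> (\<Sum>i\<in>I. LINT x|PiM I M. ent (M i) (\<lambda>t. F (x(i := t))))"
  using I F
proof (induction I arbitrary: F rule: finite_induct)
  case empty
  have "finite_measure (PiM {} M)"
    using M by (intro prob_space.finite_measure prob_space_PiM)
  have c: "(LINT x|PiM {} M. g x) = g (\<lambda>_. undefined)" for g :: "_ \<Rightarrow> real"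
    by (simp add: PiM_empty lebesgue_integral_count_space_finite)
  show ?case by (simp add: ent_def c)
next
  case (insert i I)
  interpret product_prob_space M "insert i I" by (rule product_prob_spaceI) (rule M)
  interpret I: product_prob_space M I by (rule product_prob_spaceI) (rule M)
  note [simp] = insert.hyps
  have PI: "prob_space (PiM I M)" by (rule I.prob_space_axioms)
  have PiI: "prob_space (PiM (insert i I) M)" by (rule prob_space_axioms)
  have Mi: "prob_space (M i)" by (rule M)
  from insert.prems obtain e B where Fm[measurable]: "F \<in> borel_measurable (PiM (insert i I) M)"
    and e: "0 < e" "0 < B" and eF: "\<And>x. x \<in> space (PiM (insert i I) M) \<Longrightarrow> e \<le> F x"
     "\<And>x. x \<in> space (PiM (insert i I) M) \<Longrightarrow> F x \<le> B"
    by (rule pos_boundedE) blast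
  define G where "G x = (LINT y|M i. F (x(i := y)))" for x
  have up: "x(i := y) \<in> space (PiM (insert i I) M)" if "x \<in> space (PiM I M)" "y \<in> space (M i)" for x y
    using that by (auto simp: space_PiM PiE_def Pi_def extensional_def)
  have up2: "x(j := y) \<in> space (PiM J M)" if "x \<in> space (PiM J M)" "j \<in> J" "y \<in> space (M j)" for x y j J
    using that by (auto simp: space_PiM PiE_def Pi_def extensional_def)
  have m1[measurable]: "(\<lambda>(x, y). F (x(i := y))) \<in> borel_measurable (PiM I M \<Otimes>\<^sub>M M i)"
    using measurable_comp[OF measurable_add_dim Fm] by (simp add: comp_def split_beta')
  have m1': "(\<lambda>y. F (x(i := y))) \<in> borel_measurable (M i)" if "x \<in> space (PiM I M)" for x
    using measurable_Pair2[OF m1 that] by simp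
  have F1: "pos_bounded (M i) (\<lambda>y. F (x(i := y)))" if "x \<in> space (PiM I M)" for x
    by (rule pos_boundedI[of _ _ e B]) (use that e eF up m1' in auto)
  have Gb: "e \<le> G x" "G x \<le> B" if "x \<in> space (PiM I M)" for x
    using integral_between[OF Mi pos_bounded_integrable(1)[OF Mi F1[OF that]], of e B] eF up that
    by (auto simp: G_def)
  have Gm[measurable]: "G \<in> borel_measurable (PiM I M)"
  proof -
    interpret Mi: prob_space "M i" by (rule M)
    show ?thesis unfolding G_def by measurable
  qed
  have Gp: "pos_bounded (PiM I M) G" using Gb e(1) by (intro pos_boundedI[of _ _ e B]) auto
  have iF: "integrable (PiM (insert i I) M) F" "integrable (PiM (insert i I) M) (\<lambda>x. F x * ln (F x))"
    using pos_bounded_integrable[OF PiI insert.prems] by auto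
  have IF: "(LINT x|PiM (insert i I) M. F x) = (LINT x|PiM I M. G x)"
    using product_integral_insert[OF insert.hyps iF(1)] by (simp add: G_def)
  have IFF: "(LINT x|PiM (insert i I) M. F x * ln (F x)) = (LINT x|PiM I M. LINT y|M i. F (x(i := y)) * ln (F (x(i := y))))"
    using product_integral_insert[OF insert.hyps iF(2)] by simp
  have entm: "(\<lambda>x. ent (M j) (\<lambda>t. F (x(j := t)))) \<in> borel_measurable (PiM (insert i I) M)"
      if "j \<in> insert i I" for j
  proof -
    interpret Mj: prob_space "M j" by (rule M)
    have [measurable]: "(\<lambda>(x, y). x(j := y)) \<in> measurable (PiM (insert i I) M \<Otimes>\<^sub>M M j) (PiM (insert i I) M)"
    proof -
      have "insert j (insert i I) = insert i I" using that by auto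
      then show ?thesis using measurable_add_dim[of j "insert i I" M] by (simp only:)
    qed
    have [measurable]: "(\<lambda>(x, y). F (x(j := y))) \<in> borel_measurable (PiM (insert i I) M \<Otimes>\<^sub>M M j)"
      by measurable
    show ?thesis unfolding ent_def by measurable
  qed
  have Fj: "pos_bounded (M j) (\<lambda>t. F (x(j := t)))"
    if "x \<in> space (PiM (insert i I) M)" "j \<in> insert i I" for x j
  proof (rule pos_boundedI[of _ _ e B])
    show "(\<lambda>t. F (x(j := t))) \<in> borel_measurable (M j)"
    proof (rule measurable_compose[OF _ Fm])
      show "(\<lambda>t. x(j := t)) \<in> measurable (M j) (PiM (insert i I) M)"
        by (rule measurable_fun_upd[where J="insert i I"]) (use that in auto)
    qed
  qed (use that e eF up2 in auto)
  have entb: "\<bar>ent (M j) (\<lambda>t. F (x(j := t)))\<bar> \<le> 2 * (\<bar>B\<bar> * (\<bar>ln e\<bar> + \<bar>ln B\<bar>))"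
    if x: "x \<in> space (PiM (insert i I) M)" and j: "j \<in> insert i I" for x j
    by (rule abs_ent_le[OF M pos_bounded_measurable[OF Fj[OF x j]] e(1)]) (use eF up2 x j in blast)+
  have enti: "integrable (PiM (insert i I) M) (\<lambda>x. ent (M j) (\<lambda>t. F (x(j := t))))"
    if "j \<in> insert i I" for j
    by (rule integrable_bounded[OF _ entm[OF that] entb[OF _ that]])
       (use PiI in \<open>auto simp: prob_space_def\<close>)
  have "ent (PiM (insert i I) M) F = (LINT x|PiM I M. ent (M i) (\<lambda>y. F (x(i := y)))) + ent (PiM I M) G"
  proof -
    have m2: "(\<lambda>x. LINT y|M i. F (x(i := y)) * ln (F (x(i := y)))) \<in> borel_measurable (PiM I M)"
    proof -
      interpret Mi: prob_space "M i" by (rule M)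
      show ?thesis by measurable
    qed
    have i2: "integrable (PiM I M) (\<lambda>x. LINT y|M i. F (x(i := y)) * ln (F (x(i := y))))"
    proof (rule integrable_bounded[OF I.finite_measure_axioms m2])
      fix x assume x: "x \<in> space (PiM I M)"
      have b: "e \<le> F (x(i := t))" "F (x(i := t)) \<le> B" if "t \<in> space (M i)" for t
        using eF up x that by blast+
      have bb: "\<bar>a * ln a\<bar> \<le> B * (\<bar>ln e\<bar> + \<bar>ln B\<bar>)" if "e \<le> a" "a \<le> B" for a
        using abs_ln_between[OF e(1) that] that e by (auto simp: abs_mult intro!: mult_mono)
      have "\<bar>F (x(i := t)) * ln (F (x(i := t)))\<bar> \<le> B * (\<bar>ln e\<bar> + \<bar>ln B\<bar>)" if "t \<in> space (M i)" for t
        using bb b that by blast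
      then show "\<bar>LINT y|M i. F (x(i := y)) * ln (F (x(i := y)))\<bar> \<le> B * (\<bar>ln e\<bar> + \<bar>ln B\<bar>)"
        using integral_between[OF Mi pos_bounded_integrable(2)[OF Mi F1[OF x]], of "- (B * (\<bar>ln e\<bar> + \<bar>ln B\<bar>))" "B * (\<bar>ln e\<bar> + \<bar>ln B\<bar>)"]
        by (simp_all add: abs_le_iff minus_le_iff)
    qed
    have "(LINT x|PiM I M. ent (M i) (\<lambda>y. F (x(i := y)))) =
        (LINT x|PiM I M. (LINT y|M i. F (x(i := y)) * ln (F (x(i := y)))) - G x * ln (G x))"
      by (simp add: ent_def G_def)
    also have "\<dots> = (LINT x|PiM I M. (LINT y|M i. F (x(i := y)) * ln (F (x(i := y))))) - (LINT x|PiM I M. G x * ln (G x))"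
      by (rule Bochner_Integration.integral_diff[OF i2 pos_bounded_integrable(2)[OF PI Gp]])
    finally show ?thesis by (simp add: ent_def IF IFF)
  qed
  also have "(LINT x|PiM I M. ent (M i) (\<lambda>y. F (x(i := y)))) =
      (LINT x|PiM (insert i I) M. ent (M i) (\<lambda>y. F (x(i := y))))"
    using product_integral_insert[OF insert.hyps enti[of i]] prob_space.prob_space[OF Mi] by simp
  also have "ent (PiM I M) G \<le> (\<Sum>j\<in>I. LINT x|PiM I M. ent (M j) (\<lambda>t. G (x(j := t))))"
    by (rule insert.IH[OF Gp])
  also have "\<dots> \<le> (\<Sum>j\<in>I. LINT x|PiM (insert i I) M. ent (M j) (\<lambda>t. F (x(j := t))))"
  proof (rule sum_mono)
    fix j assume j: "j \<in> I"
    have ij: "i \<noteq> j" using j insert.hyps(2) by metis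
    have Mj: "prob_space (M j)" by (rule M)
    interpret Mj: prob_space "M j" by (rule M)
    interpret Mi: prob_space "M i" by (rule M)
    interpret ij: pair_prob_space "M i" "M j" ..
    have Gj: "pos_bounded (M j) (\<lambda>t. G (x(j := t)))" if "x \<in> space (PiM I M)" for x
    proof (rule pos_boundedI[of _ _ e B])
      show "(\<lambda>t. G (x(j := t))) \<in> borel_measurable (M j)"
      proof (rule measurable_compose[OF _ Gm])
        show "(\<lambda>t. x(j := t)) \<in> measurable (M j) (PiM I M)"
          by (rule measurable_fun_upd[where J="I"]) (use that j in auto)
      qed
    qed (use that e Gb up2 j in auto)
    have le: "ent (M j) (\<lambda>t. G (x(j := t))) \<le> (LINT y|M i. ent (M j) (\<lambda>t. F ((x(i := y))(j := t))))"
      if x: "x \<in> space (PiM I M)" for x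
    proof -
      have m: "(\<lambda>p. x(j := snd p)) \<in> measurable (M i \<Otimes>\<^sub>M M j) (PiM I M)"
        by (rule measurable_fun_upd[where J="I"]) (use x j in auto)
      have m': "(\<lambda>p. (x(j := snd p))(i := fst p)) \<in> measurable (M i \<Otimes>\<^sub>M M j) (PiM (insert i I) M)"
        by (rule measurable_fun_upd[where J="I"]) (use m in auto)
      have "pos_bounded (M i \<Otimes>\<^sub>M M j) (\<lambda>(y, t). F ((x(j := t))(i := y)))"
      proof (rule pos_boundedI[of _ _ e B])
        show "(\<lambda>(y, t). F ((x(j := t))(i := y))) \<in> borel_measurable (M i \<Otimes>\<^sub>M M j)"
          using measurable_compose[OF m' Fm] by (simp add: split_beta')
      qed (use e eF up up2 x j in \<open>auto simp: space_pair_measure\<close>)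
      from ent_integral_le[OF Mi Mj this]
      show ?thesis using ij by (simp add: G_def fun_upd_twist)
    qed
    have entj: "integrable (PiM (insert i I) M) (\<lambda>x. ent (M j) (\<lambda>t. F (x(j := t))))"
      using enti j by blast
    interpret q: pair_prob_space "PiM I M" "M i" ..
    have "(LINT x|PiM I M. ent (M j) (\<lambda>t. G (x(j := t)))) \<le>
        (LINT x|PiM I M. LINT y|M i. ent (M j) (\<lambda>t. F ((x(i := y))(j := t))))"
    proof (rule integral_mono')
      have "integrable (PiM I M \<Otimes>\<^sub>M M i) (\<lambda>(x, y). ent (M j) (\<lambda>t. F ((x(i := y))(j := t))))"
      proof (rule integrable_bounded)
        show "finite_measure (PiM I M \<Otimes>\<^sub>M M i)" by (rule q.finite_measure_axioms)
        show "(\<lambda>(x, y). ent (M j) (\<lambda>t. F ((x(i := y))(j := t)))) \<in> borel_measurable (PiM I M \<Otimes>\<^sub>M M i)"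
          using measurable_comp[OF measurable_add_dim entm[of j]] j by (simp add: comp_def split_beta')
        show "\<bar>case z of (x, y) \<Rightarrow> ent (M j) (\<lambda>t. F ((x(i := y))(j := t)))\<bar> \<le> 2 * (\<bar>B\<bar> * (\<bar>ln e\<bar> + \<bar>ln B\<bar>))"
          if "z \<in> space (PiM I M \<Otimes>\<^sub>M M i)" for z
          using that entb up j by (auto simp: space_pair_measure)
      qed
      from q.integrable_fst'[OF this]
      show "integrable (PiM I M) (\<lambda>x. LINT y|M i. ent (M j) (\<lambda>t. F ((x(i := y))(j := t))))" by simp
      show "0 \<le> (LINT y|M i. ent (M j) (\<lambda>t. F ((x(i := y))(j := t))))" if "x \<in> space (PiM I M)" for x
        using le[OF that] ent_nonneg[OF Mj Gj[OF that]] by linarith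
    qed (use le in auto)
    also have "\<dots> = (LINT x|PiM (insert i I) M. ent (M j) (\<lambda>t. F (x(j := t))))"
      using product_integral_insert[OF insert.hyps entj] by simp
    finally show "(LINT x|PiM I M. ent (M j) (\<lambda>t. G (x(j := t)))) \<le> (LINT x|PiM (insert i I) M. ent (M j) (\<lambda>t. F (x(j := t))))" .
  qed
  finally show ?case by (simp only: sum.insert[OF insert.hyps])
qed

section \<open>The log-Sobolev inequality for strongly log-concave measures on the line\<close>

text \<open>Transport of \<open>f exp (- U)\<close> to \<open>exp (- U)\<close> (with equal masses) by the monotone map \<open>T\<close>.
  Take logarithms in the change of variables formula, use \<open>ln t \<le> t - 1\<close> for \<open>t = T' x\<close> and the
  strong convexity of \<open>U\<close> between \<open>x\<close> and \<open>T x\<close>. Up to the derivative of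
  \<open>f x * exp (- U x) * (T x - x)\<close>, which integrates to \<open>0\<close> because \<open>T\<close> fixes both endpoints, the
  remainder is a quadratic polynomial in \<open>T x - x\<close>.\<close>

lemma log_sobolev_Icc:
  fixes U U' f f' :: "real \<Rightarrow> real"
  assumes ab: "a < b" and c: "0 < c"
    and U': "\<And>x. (U has_real_derivative U' x) (at x)"
    and conv: "\<And>x y. U x + U' x * (y - x) + c / 2 * (y - x)\<^sup>2 \<le> U y"
    and f': "\<And>x. (f has_real_derivative f' x) (at x)"
    and f'c: "continuous_on UNIV f'" and fpos: "\<And>x. 0 < f x"
  shows "integral {a..b} (\<lambda>x. f x * ln (f x) * exp (- U x))
     - integral {a..b} (\<lambda>x. f x * exp (- U x)) *
         ln (integral {a..b} (\<lambda>x. f x * exp (- U x)) / integral {a..b} (\<lambda>x. exp (- U x)))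
     \<le> 1 / (2 * c) * integral {a..b} (\<lambda>x. (f' x)\<^sup>2 / f x * exp (- U x))"
proof -
  have Uc: "continuous_on X U" for X
    using U' DERIV_isCont continuous_at_imp_continuous_on by blast
  have fc: "continuous_on X f" for X
    using f' DERIV_isCont continuous_at_imp_continuous_on by blast
  have f'c: "continuous_on X f'" for X using f'c continuous_on_subset by blast
  have fn: "f x \<noteq> 0" for x using fpos[of x] by simp
  define r0 where "r0 x = exp (- U x)" for x
  have r0pos: "0 < r0 x" for x by (simp add: r0_def)
  have r0c: "continuous_on X r0" for X unfolding r0_def by (intro continuous_intros Uc)
  have intpos: "0 < integral {a..b} g" if "continuous_on {a..b} g" "\<And>x. 0 < g x" for g :: "real \<Rightarrow> real"
  proof -
    have "integral {a..b} (\<lambda>_. 0) < integral {a..b} g"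
      by (rule integral_less_real) (use that ab in auto)
    then show ?thesis by simp
  qed
  define A where "A = integral {a..b} r0"
  define B where "B = integral {a..b} (\<lambda>x. f x * r0 x)"
  have A: "0 < A" unfolding A_def by (rule intpos) (use r0c r0pos in auto)
  have B: "0 < B" unfolding B_def by (rule intpos) (use r0c r0pos fpos fc in \<open>auto intro!: continuous_intros\<close>)
  \<comment> \<open>The factor that gives \<open>f exp (- U)\<close> and \<open>exp (- U)\<close> the same mass on the interval.\<close>
  define k where "k = A / B"
  have k: "0 < k" using A B by (simp add: k_def)
  define r1 where "r1 x = k * f x * r0 x" for x
  have r1pos: "0 < r1 x" for x using k fpos r0pos by (simp add: r1_def)
  have r1c: "continuous_on X r1" for X unfolding r1_def by (intro continuous_intros r0c fc)
  define G0 where "G0 x = integral {a..x} r0" for x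
  define G1 where "G1 x = integral {a..x} r1" for x
  have prim: "continuous_on {a..b} (\<lambda>x. integral {a..x} r)"
     "\<And>x. x \<in> {a<..<b} \<Longrightarrow> ((\<lambda>x. integral {a..x} r) has_real_derivative r x) (at x)"
     "\<And>x y. a \<le> x \<Longrightarrow> x < y \<Longrightarrow> y \<le> b \<Longrightarrow> integral {a..x} r < integral {a..y} r"
    if rc: "\<And>X. continuous_on X r" and rp: "\<And>x. 0 < r x" for r :: "real \<Rightarrow> real"
  proof -
    have d: "((\<lambda>x. integral {a..x} r) has_real_derivative r x) (at x within {a..b})" if "x \<in> {a..b}" for x
      by (rule integral_has_real_derivative[OF rc that])
    show cG: "continuous_on {a..b} (\<lambda>x. integral {a..x} r)"
      using d DERIV_continuous_on by blast
    show d': "((\<lambda>x. integral {a..x} r) has_real_derivative r x) (at x)" if "x \<in> {a<..<b}" for x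
      using d[of x] that by (simp add: at_within_Icc_at)
    show "integral {a..x} r < integral {a..y} r" if "a \<le> x" "x < y" "y \<le> b" for x y
    proof (rule DERIV_pos_imp_increasing_open[OF that(2)])
      show "continuous_on {x..y} (\<lambda>x. integral {a..x} r)"
        using cG by (rule continuous_on_subset) (use that in auto)
    qed (use d' rp that in \<open>force\<close>)
  qed
  note G0 = prim[OF r0c r0pos, folded G0_def]
  note G1 = prim[OF r1c r1pos, folded G1_def]
  have ends: "G0 a = 0" "G1 a = 0" "G0 b = A" "G1 b = A"
  proof -
    have "integral {a..b} r1 = k * B"
      by (simp add: r1_def[abs_def] B_def mult.assoc)
    then show "G1 b = A" using B by (simp add: G1_def k_def)
  qed (simp_all add: G0_def G1_def A_def)
  have injG0: "inj_on G0 {a..b}"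
    by (rule inj_onI) (metis G0(3) atLeastAtMost_iff less_irrefl linorder_neqE_linordered_idom)
  have rng: "G x \<in> {0..A}" if "x \<in> {a..b}" "G a = 0" "G b = A"
    "\<And>x y. a \<le> x \<Longrightarrow> x < y \<Longrightarrow> y \<le> b \<Longrightarrow> G x < G y" for G x
    using that(4)[of a x] that(4)[of x b] that(1-3) by (cases "x = a"; cases "x = b"; force)
  have img: "G0 ` {a..b} = {0..A}"
  proof
    show "G0 ` {a..b} \<subseteq> {0..A}" using rng ends G0(3) by blast
    show "{0..A} \<subseteq> G0 ` {a..b}"
    proof
      fix y assume "y \<in> {0..A}"
      then have "\<exists>x\<ge>a. x \<le> b \<and> G0 x = y"
        using IVT'[of G0 a y b] ends G0(1) ab by auto
      then show "y \<in> G0 ` {a..b}" by auto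
    qed
  qed
  define S where "S = the_inv_into {a..b} G0"
  have Sc: "continuous_on {0..A} S"
    using continuous_on_inv_into[OF G0(1) compact_Icc injG0] by (simp add: S_def img)
  have SG: "G0 (S y) = y" "S y \<in> {a..b}" if "y \<in> {0..A}" for y
    using f_the_inv_into_f[OF injG0, of y] the_inv_into_into[OF injG0, of y "{a..b}"] that
    by (auto simp: S_def img)
  have Sends: "S 0 = a" "S A = b"
    using the_inv_into_f_f[OF injG0, of a] the_inv_into_f_f[OF injG0, of b] ab ends by (auto simp: S_def)
  define T where "T x = S (G1 x)" for x
  have G1r: "G1 x \<in> {0..A}" if "x \<in> {a..b}" for x using rng[OF that] ends G1(3) by blast
  have Tc: "continuous_on {a..b} T"
    unfolding T_def by (rule continuous_on_compose2[OF Sc G1(1)]) (use G1r in auto)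
  have Tends: "T a = a" "T b = b" using Sends ends by (auto simp: T_def)
  define T1 where "T1 x = r1 x / r0 (T x)" for x
  have T': "(T has_real_derivative T1 x) (at x)" if x: "x \<in> {a<..<b}" for x
  proof -
    have gx: "0 < G1 x" "G1 x < A" using G1(3)[of a x] G1(3)[of x b] x ends by auto
    have sx: "S (G1 x) \<in> {a<..<b}"
    proof -
      have "S (G1 x) \<noteq> a" "S (G1 x) \<noteq> b" using SG(1)[of "G1 x"] gx ends by auto
      then show ?thesis using SG(2)[of "G1 x"] gx by auto
    qed
    have "isCont S (G1 x)"
      using continuous_on_interior[OF Sc] gx by (simp add: interior_atLeastAtMost_real)
    then have "(S has_real_derivative inverse (r0 (S (G1 x)))) (at (G1 x))"
      using SG gx r0pos[of "S (G1 x)"]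
      by (intro DERIV_inverse_function[where f=G0 and a=0 and b=A] G0(2) sx) auto
    from DERIV_chain2[OF this G1(2)[OF x]]
    show ?thesis by (simp add: T_def[abs_def] T1_def field_simps)
  qed
  define P where "P x = k * f x * r0 x * (T x - x)" for x
  define P' where "P' x = k * r0 x * (f' x * (T x - x) - f x * U' x * (T x - x) + f x * (T1 x - 1))" for x
  have "(P' has_integral (P b - P a)) {a..b}"
  proof (rule fundamental_theorem_of_calculus_interior)
    show "continuous_on {a..b} P" unfolding P_def by (intro continuous_intros fc r0c Tc)
    fix x assume x: "x \<in> {a<..<b}"
    have "(P has_real_derivative P' x) (at x)"
      unfolding P_def P'_def r0_def
      by (auto intro!: derivative_eq_intros f' U' T'[OF x] simp: algebra_simps)
    then show "(P has_vector_derivative P' x) (at x)"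
      by (simp add: has_real_derivative_iff_has_vector_derivative)
  qed (use ab in auto)
  then have P'i: "(P' has_integral 0) {a..b}" by (simp add: P_def Tends)
  have pw: "k * f x * r0 x * ln (k * f x) \<le> P' x + k / (2 * c) * ((f' x)\<^sup>2 / f x * r0 x)" for x
  proof -
    define d where "d = T x - x"
    have T1p: "0 < T1 x" using r1pos r0pos by (simp add: T1_def)
    have "k * f x = T1 x * (r0 (T x) / r0 x)"
      using r0pos[of x] r0pos[of "T x"] by (simp add: T1_def r1_def)
    also have "r0 (T x) / r0 x = exp (U x - U (T x))" by (simp add: r0_def exp_diff exp_minus field_simps)
    finally have "ln (k * f x) = ln (T1 x) + (U x - U (T x))" using T1p by (simp add: ln_mult)
    also have "\<dots> \<le> T1 x - 1 - U' x * d - c / 2 * d\<^sup>2"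
      using ln_le_minus_one[OF T1p] conv[of x "T x"] by (simp add: d_def)
    finally have "f x * ln (k * f x) \<le> f x * (T1 x - 1 - U' x * d - c / 2 * d\<^sup>2)"
      using fpos[of x] by (intro mult_left_mono) auto
    also have "\<dots> \<le> (f' x * d - f x * U' x * d + f x * (T1 x - 1)) + (f' x)\<^sup>2 / (2 * c * f x)"
    proof -
      have "0 \<le> (f' x + c * f x * d)\<^sup>2 / (2 * c * f x)" using c fpos[of x] by simp
      also have "\<dots> = (f' x)\<^sup>2 / (2 * c * f x) + f' x * d + c / 2 * f x * d\<^sup>2"
        using c fn[of x] by (simp add: power2_eq_square field_simps)
      finally show ?thesis by (simp add: algebra_simps)
    qed
    finally have "(k * r0 x) * (f x * ln (k * f x)) \<le>
       (k * r0 x) * ((f' x * d - f x * U' x * d + f x * (T1 x - 1)) + (f' x)\<^sup>2 / (2 * c * f x))"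
      using k r0pos[of x] by (intro mult_left_mono) auto
    then show ?thesis by (simp add: P'_def d_def algebra_simps)
  qed
  have i0: "(\<lambda>x. f x * r0 x) integrable_on {a..b}" "(\<lambda>x. f x * ln (f x) * r0 x) integrable_on {a..b}"
    "(\<lambda>x. (f' x)\<^sup>2 / f x * r0 x) integrable_on {a..b}"
    by (intro integrable_continuous_real continuous_intros fc r0c f'c; simp add: fn)+
  have eq: "k * f x * r0 x * ln (k * f x) = k * (f x * ln (f x) * r0 x) + k * ln k * (f x * r0 x)" for x
    using k fpos[of x] by (simp add: ln_mult algebra_simps)
  let ?I1 = "integral {a..b} (\<lambda>x. f x * ln (f x) * r0 x)"
  let ?I2 = "integral {a..b} (\<lambda>x. (f' x)\<^sup>2 / f x * r0 x)"
  have "((\<lambda>x. k * f x * r0 x * ln (k * f x)) has_integral (k * ?I1 + k * ln k * B)) {a..b}"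
    unfolding eq B_def using i0 by (intro has_integral_add has_integral_mult_right integrable_integral) auto
  moreover have "((\<lambda>x. P' x + k / (2 * c) * ((f' x)\<^sup>2 / f x * r0 x)) has_integral (0 + k / (2 * c) * ?I2)) {a..b}"
    using i0 by (intro has_integral_add P'i has_integral_mult_right integrable_integral) auto
  ultimately have "k * ?I1 + k * ln k * B \<le> 0 + k / (2 * c) * ?I2"
    by (rule has_integral_le) (use pw in auto)
  then have "k * (?I1 + ln k * B) \<le> k * (1 / (2 * c) * ?I2)" by (simp add: algebra_simps)
  then have "?I1 + ln k * B \<le> 1 / (2 * c) * ?I2" using k by (rule mult_left_le_imp_le)
  moreover have "ln (B / A) = - ln k" using A B by (simp add: k_def ln_div)
  ultimately show ?thesis
    unfolding A_def[symmetric, unfolded r0_def] B_def[symmetric, unfolded r0_def] r0_def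
    by (simp add: algebra_simps A_def B_def r0_def)
qed

lemma integral_Icc_tendsto_lborel:
  fixes g :: "real \<Rightarrow> real"
  assumes "integrable lborel g"
  shows "(\<lambda>n. integral {- real n..real n} g) \<longlonglongrightarrow> (LINT x|lborel. g x)"
proof -
  have [measurable]: "g \<in> borel_measurable lborel" using assms by auto
  have "set_integrable lborel {- real n..real n} g" for n
    unfolding set_integrable_def by (rule integrable_mult_indicator) (use assms in auto)
  from set_borel_integral_eq_integral(2)[OF this]
  have eq: "integral {- real n..real n} g = (LINT x|lborel. indicator {- real n..real n} x *\<^sub>R g x)" for n
    by (simp add: set_lebesgue_integral_def)
  show ?thesis unfolding eq
  proof (rule integral_dominated_convergence[where w="\<lambda>x. norm (g x)"])
    show "AE x in lborel. (\<lambda>n. indicator {- real n..real n} x *\<^sub>R g x) \<longlonglongrightarrow> g x"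
    proof (rule AE_I2)
      fix x :: real
      obtain n0 :: nat where n0: "\<bar>x\<bar> \<le> real n0" using real_arch_simple by blast
      have "eventually (\<lambda>n. indicator {- real n..real n} x *\<^sub>R g x = g x) sequentially"
        using eventually_ge_at_top[of n0]
      proof eventually_elim
        case (elim n)
        then have "\<bar>x\<bar> \<le> real n" using n0 by linarith
        then show ?case by (auto simp: indicator_def)
      qed
      then show "(\<lambda>n. indicator {- real n..real n} x *\<^sub>R g x) \<longlonglongrightarrow> g x"
        by (rule tendsto_eventually)
    qed
  qed (use assms in \<open>auto simp: indicator_def\<close>)
qed

text \<open>Exhausting the line by symmetric intervals makes a discussion of the behaviour of the transport
  map at infinity superfluous.\<close>

lemma log_sobolev_real:
  fixes U U' f f' :: "real \<Rightarrow> real"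
  defines "M \<equiv> density lborel (\<lambda>x. ennreal (exp (- U x)))"
  assumes M: "prob_space M" and c: "0 < c"
    and U': "\<And>x. (U has_real_derivative U' x) (at x)"
    and conv: "\<And>x y. U x + U' x * (y - x) + c / 2 * (y - x)\<^sup>2 \<le> U y"
    and f': "\<And>x. (f has_real_derivative f' x) (at x)"
    and f'c: "continuous_on UNIV f'" and f: "pos_bounded M f"
    and fi: "integrable M (\<lambda>x. (f' x)\<^sup>2 / f x)"
  shows "ent M f \<le> 1 / (2 * c) * (LINT x|M. (f' x)\<^sup>2 / f x)"
proof -
  interpret prob_space M by fact
  have Uc: "continuous_on UNIV U" using U' DERIV_isCont continuous_at_imp_continuous_on by blast
  have fc: "continuous_on UNIV f" using f' DERIV_isCont continuous_at_imp_continuous_on by blast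
  have [measurable]: "U \<in> borel_measurable borel" "f \<in> borel_measurable borel" "f' \<in> borel_measurable borel"
    using Uc fc f'c by (auto intro: borel_measurable_continuous_onI)
  have fpos: "0 < f x" for x using pos_bounded_pos[OF f, of x] by (simp add: M_def)
  have toL: "integrable lborel (\<lambda>x. g x * exp (- U x))"
     "(LINT x|M. g x) = (LINT x|lborel. g x * exp (- U x))"
    if "integrable M g" and [measurable]: "g \<in> borel_measurable borel" for g :: "real \<Rightarrow> real"
    using that unfolding M_def by (simp_all add: integrable_density integral_density mult.commute)
  note i = pos_bounded_integrable[OF M f]
  have lim: "(\<lambda>n. integral {- real n..real n} (\<lambda>x. g x * exp (- U x))) \<longlonglongrightarrow> (LINT x|M. g x)"
    if "integrable M g" "g \<in> borel_measurable borel" for g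
    using integral_Icc_tendsto_lborel[OF toL(1)[OF that]] toL(2)[OF that] by simp
  have l1: "(\<lambda>n. integral {- real n..real n} (\<lambda>x. exp (- U x))) \<longlonglongrightarrow> 1"
    using lim[of "\<lambda>_. 1"] by (simp add: prob_space)
  have l2: "(\<lambda>n. integral {- real n..real n} (\<lambda>x. f x * exp (- U x))) \<longlonglongrightarrow> (LINT x|M. f x)"
    by (rule lim) (use i in auto)
  have l3: "(\<lambda>n. integral {- real n..real n} (\<lambda>x. f x * ln (f x) * exp (- U x))) \<longlonglongrightarrow> (LINT x|M. f x * ln (f x))"
    by (rule lim) (use i in auto)
  have l4: "(\<lambda>n. integral {- real n..real n} (\<lambda>x. (f' x)\<^sup>2 / f x * exp (- U x))) \<longlonglongrightarrow> (LINT x|M. (f' x)\<^sup>2 / f x)"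
    by (rule lim) (use fi in auto)
  have "0 < (LINT x|M. f x)" by (rule pos_bounded_integral_pos[OF M f])
  then have l5: "(\<lambda>n. ln (integral {- real n..real n} (\<lambda>x. f x * exp (- U x)) / integral {- real n..real n} (\<lambda>x. exp (- U x))))
     \<longlonglongrightarrow> ln ((LINT x|M. f x) / 1)"
    by (intro tendsto_ln tendsto_divide l1 l2) auto
  have "(LINT x|M. f x * ln (f x)) - (LINT x|M. f x) * ln ((LINT x|M. f x) / 1)
     \<le> 1 / (2 * c) * (LINT x|M. (f' x)\<^sup>2 / f x)"
  proof (rule LIMSEQ_le[OF tendsto_diff[OF l3 tendsto_mult[OF l2 l5]] tendsto_mult_left[OF l4]])
    show "\<exists>N. \<forall>n\<ge>N. integral {- real n..real n} (\<lambda>x. f x * ln (f x) * exp (- U x))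
     - integral {- real n..real n} (\<lambda>x. f x * exp (- U x)) *
         ln (integral {- real n..real n} (\<lambda>x. f x * exp (- U x)) / integral {- real n..real n} (\<lambda>x. exp (- U x)))
     \<le> 1 / (2 * c) * integral {- real n..real n} (\<lambda>x. (f' x)\<^sup>2 / f x * exp (- U x))"
      by (intro exI[of _ 1] allI impI log_sobolev_Icc[OF _ c U' conv f' f'c fpos]) auto
  qed
  then show ?thesis by (simp add: ent_def)
qed

section \<open>Exponential integrals, Gaussian integrals and a Chebyshev inequality\<close>

lemma abs_le_exp_add_exp_minus: "\<bar>x\<bar> \<le> exp x + exp (- x)" for x :: real
  using exp_ge_add_one_self[of x] exp_ge_add_one_self[of "- x"] exp_gt_zero[of x] exp_gt_zero[of "- x"]
  by linarith

lemma abs_exp_minus_one_le: "\<bar>exp y - 1\<bar> \<le> \<bar>y\<bar> * exp \<bar>y\<bar>" for y :: real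
proof (cases "0 \<le> y")
  case True
  have "1 - y \<le> exp (- y)" using exp_ge_add_one_self[of "- y"] by simp
  then have "(1 - y) * exp y \<le> exp (- y) * exp y" by (intro mult_right_mono) auto
  then have "exp y - 1 \<le> y * exp y" by (simp add: exp_minus algebra_simps)
  then show ?thesis using True by simp
next
  case False
  have "1 - exp y \<le> - y" using exp_ge_add_one_self[of y] by linarith
  also have "\<dots> \<le> \<bar>y\<bar> * exp \<bar>y\<bar>" using False by (simp add: mult_le_cancel_left1)
  finally show ?thesis using False by simp
qed

text \<open>Differentiation under the integral sign; the difference quotients are dominated by
  exponentials with slightly larger parameters.\<close>

lemma
  fixes X g :: "'a \<Rightarrow> real"
  assumes X[measurable]: "X \<in> borel_measurable M" and g[measurable]: "g \<in> borel_measurable M"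
    and int: "\<And>t. integrable M (\<lambda>x. g x * exp (t * X x))"
  shows integrable_times_exp: "integrable M (\<lambda>x. g x * X x * exp (t * X x))"
    and has_real_derivative_exp_integral:
      "((\<lambda>t. LINT x|M. g x * exp (t * X x)) has_real_derivative (LINT x|M. g x * X x * exp (t * X x))) (at t)"
proof -
  show I: "integrable M (\<lambda>x. g x * X x * exp (t * X x))"
  proof (rule Bochner_Integration.integrable_bound)
    show "integrable M (\<lambda>x. \<bar>g x * exp ((t + 1) * X x)\<bar> + \<bar>g x * exp ((t - 1) * X x)\<bar>)"
      using int by (intro Bochner_Integration.integrable_add integrable_abs) auto
    have "\<bar>g x * X x * exp (t * X x)\<bar> \<le> \<bar>g x * exp ((t + 1) * X x)\<bar> + \<bar>g x * exp ((t - 1) * X x)\<bar>" for x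
    proof -
      have "\<bar>g x * X x * exp (t * X x)\<bar> = \<bar>g x\<bar> * exp (t * X x) * \<bar>X x\<bar>" by (simp add: abs_mult)
      also have "\<dots> \<le> \<bar>g x\<bar> * exp (t * X x) * (exp (X x) + exp (- X x))"
        by (intro mult_left_mono abs_le_exp_add_exp_minus) auto
      also have "\<dots> = \<bar>g x * exp ((t + 1) * X x)\<bar> + \<bar>g x * exp ((t - 1) * X x)\<bar>"
        by (simp add: abs_mult distrib_left distrib_right exp_add left_diff_distrib exp_diff exp_minus divide_inverse)
      finally show ?thesis .
    qed
    then show "AE x in M. norm (g x * X x * exp (t * X x)) \<le> norm (\<bar>g x * exp ((t + 1) * X x)\<bar> + \<bar>g x * exp ((t - 1) * X x)\<bar>)"
      by (auto intro!: AE_I2 order_trans[OF _ abs_ge_self])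
  qed auto
  define F where "F t = (LINT x|M. g x * exp (t * X x))" for t
  have "((\<lambda>h. (F (t + h) - F t) / h) \<longlongrightarrow> (LINT x|M. g x * X x * exp (t * X x))) (at 0)"
    unfolding tendsto_at_iff_sequentially
  proof (intro allI impI)
    fix h :: "nat \<Rightarrow> real" assume h: "\<forall>i. h i \<in> UNIV - {0}" "h \<longlonglongrightarrow> 0"
    then have h0: "h i \<noteq> 0" for i by auto
    obtain H where H: "\<And>i. \<bar>h i\<bar> \<le> H"
      using convergent_imp_Bseq[OF convergentI[OF h(2)]] by (auto simp: Bseq_def)
    have eq: "(F (t + h n) - F t) / h n = (LINT x|M. g x * exp (t * X x) * ((exp (h n * X x) - 1) / h n))" for n
    proof -
      have "(F (t + h n) - F t) = (LINT x|M. g x * exp ((t + h n) * X x) - g x * exp (t * X x))"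
        unfolding F_def by (intro Bochner_Integration.integral_diff[symmetric] int)
      also have "\<dots> / h n = (LINT x|M. (g x * exp ((t + h n) * X x) - g x * exp (t * X x)) / h n)"
        by simp
      also have "\<dots> = (LINT x|M. g x * exp (t * X x) * ((exp (h n * X x) - 1) / h n))"
        by (intro Bochner_Integration.integral_cong refl) (simp add: distrib_right exp_add field_simps)
      finally show ?thesis .
    qed
    show "((\<lambda>h. (F (t + h) - F t) / h) \<circ> h) \<longlonglongrightarrow> (LINT x|M. g x * X x * exp (t * X x))"
      unfolding comp_def eq
    proof (rule integral_dominated_convergence)
      show "integrable M (\<lambda>x. \<bar>g x * exp ((t + (H + 1)) * X x)\<bar> + \<bar>g x * exp ((t - (H + 1)) * X x)\<bar>
          + (\<bar>g x * exp ((t + (H + 1)) * X x)\<bar> + \<bar>g x * exp ((t - (H + 1)) * X x)\<bar>))"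
        using int by (intro Bochner_Integration.integrable_add integrable_abs) auto
      show "AE x in M. norm (g x * exp (t * X x) * ((exp (h n * X x) - 1) / h n)) \<le>
         \<bar>g x * exp ((t + (H + 1)) * X x)\<bar> + \<bar>g x * exp ((t - (H + 1)) * X x)\<bar>
          + (\<bar>g x * exp ((t + (H + 1)) * X x)\<bar> + \<bar>g x * exp ((t - (H + 1)) * X x)\<bar>)" for n
      proof (rule AE_I2)
        fix x
        have H0: "0 \<le> H" using H[of 0] by linarith
        have "\<bar>(exp (h n * X x) - 1) / h n\<bar> \<le> \<bar>h n * X x\<bar> * exp \<bar>h n * X x\<bar> / \<bar>h n\<bar>"
          unfolding abs_divide by (intro divide_right_mono abs_exp_minus_one_le) auto
        also have "\<dots> = \<bar>X x\<bar> * exp \<bar>h n * X x\<bar>" using h0[of n] by (simp add: abs_mult)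
        also have "\<dots> \<le> exp \<bar>X x\<bar> * exp (H * \<bar>X x\<bar>)"
        proof (intro mult_mono)
          show "\<bar>X x\<bar> \<le> exp \<bar>X x\<bar>" using exp_ge_add_one_self[of "\<bar>X x\<bar>"] by linarith
          show "exp \<bar>h n * X x\<bar> \<le> exp (H * \<bar>X x\<bar>)" using H[of n] by (simp add: abs_mult mult_right_mono)
        qed auto
        also have "\<dots> = exp ((H + 1) * \<bar>X x\<bar>)" by (simp add: exp_add[symmetric] algebra_simps)
        also have "\<dots> \<le> exp ((H + 1) * X x) + exp (- (H + 1) * X x)"
        proof -
          have "(H + 1) * \<bar>X x\<bar> = (H + 1) * X x \<or> (H + 1) * \<bar>X x\<bar> = - (H + 1) * X x"
            by (cases "0 \<le> X x") (auto simp: algebra_simps)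
          then show ?thesis
            using exp_gt_zero[of "(H + 1) * X x"] exp_gt_zero[of "- (H + 1) * X x"] by (elim disjE; simp only:; linarith)
        qed
        finally have *: "\<bar>(exp (h n * X x) - 1) / h n\<bar> \<le> exp ((H + 1) * X x) + exp (- (H + 1) * X x)" .
        have "norm (g x * exp (t * X x) * ((exp (h n * X x) - 1) / h n))
          \<le> \<bar>g x\<bar> * exp (t * X x) * (exp ((H + 1) * X x) + exp (- (H + 1) * X x))"
          unfolding real_norm_def abs_mult[of _ "(exp (h n * X x) - 1) / h n"]
          using * by (intro mult_mono) (auto simp: abs_mult)
        also have "\<dots> = \<bar>g x * exp ((t + (H + 1)) * X x)\<bar> + \<bar>g x * exp ((t - (H + 1)) * X x)\<bar>"
        proof -
          have "exp (t * X x) * exp ((H + 1) * X x) = exp ((t + (H + 1)) * X x)"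
            by (simp add: exp_add[symmetric] algebra_simps)
          moreover have "exp (t * X x) * exp (- (H + 1) * X x) = exp ((t - (H + 1)) * X x)"
            by (simp add: exp_add[symmetric] algebra_simps)
          ultimately show ?thesis by (simp only: abs_mult abs_exp_cancel distrib_left mult.assoc)
        qed
        finally show "norm (g x * exp (t * X x) * ((exp (h n * X x) - 1) / h n)) \<le>
         \<bar>g x * exp ((t + (H + 1)) * X x)\<bar> + \<bar>g x * exp ((t - (H + 1)) * X x)\<bar>
          + (\<bar>g x * exp ((t + (H + 1)) * X x)\<bar> + \<bar>g x * exp ((t - (H + 1)) * X x)\<bar>)"
          by linarith
      qed
      show "AE x in M. (\<lambda>n. g x * exp (t * X x) * ((exp (h n * X x) - 1) / h n)) \<longlonglongrightarrow> g x * X x * exp (t * X x)"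
      proof (rule AE_I2)
        fix x
        have "((\<lambda>s. exp (s * X x)) has_real_derivative X x) (at 0)"
          by (auto intro!: derivative_eq_intros)
        then have "((\<lambda>s. (exp (s * X x) - 1) / s) \<longlongrightarrow> X x) (at 0)"
          by (simp add: has_field_derivative_iff)
        then have "(\<lambda>n. (exp (h n * X x) - 1) / h n) \<longlonglongrightarrow> X x"
          unfolding tendsto_at_iff_sequentially comp_def using h by blast
        then have "(\<lambda>n. g x * exp (t * X x) * ((exp (h n * X x) - 1) / h n)) \<longlonglongrightarrow> g x * exp (t * X x) * X x"
          by (intro tendsto_intros)
        then show "(\<lambda>n. g x * exp (t * X x) * ((exp (h n * X x) - 1) / h n)) \<longlonglongrightarrow> g x * X x * exp (t * X x)"
          by (simp add: mult_ac)
      qed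
    qed auto
  qed
  then show "((\<lambda>t. LINT x|M. g x * exp (t * X x)) has_real_derivative (LINT x|M. g x * X x * exp (t * X x))) (at t)"
    by (simp add: DERIV_def F_def)
qed

lemma has_bochner_integral_gaussian:
  fixes t c :: real
  assumes c: "0 < c"
  shows "has_bochner_integral lborel (\<lambda>x. exp (t * x - c * x\<^sup>2 / 2)) (sqrt (2 * pi / c) * exp (t\<^sup>2 / (2 * c)))"
proof -
  define K where "K = sqrt (2 * pi / c) * exp (t\<^sup>2 / (2 * c))"
  have "has_bochner_integral lborel (\<lambda>x. K * normal_density (t / c) (1 / sqrt c) x) (K * 1)"
    using c by (intro has_bochner_integral_mult_right) (auto simp: has_bochner_integral_iff)
  moreover have "K * normal_density (t / c) (1 / sqrt c) x = exp (t * x - c * x\<^sup>2 / 2)" for x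
  proof -
    have "t\<^sup>2 / (2 * c) + - (x - t / c)\<^sup>2 / (2 * (1 / sqrt c)\<^sup>2) = t * x - c * x\<^sup>2 / 2"
      using c by (simp add: power_divide power2_diff field_simps power2_eq_square)
    moreover have "sqrt (2 * pi / c) * (1 / sqrt (2 * pi * (1 / sqrt c)\<^sup>2)) = 1"
      using c by (simp add: power_divide)
    moreover have "K * normal_density (t / c) (1 / sqrt c) x =
      (sqrt (2 * pi / c) * (1 / sqrt (2 * pi * (1 / sqrt c)\<^sup>2))) *
       exp (t\<^sup>2 / (2 * c) + - (x - t / c)\<^sup>2 / (2 * (1 / sqrt c)\<^sup>2))"
      unfolding K_def normal_density_def exp_add by simp
    ultimately show ?thesis by simp
  qed
  ultimately show ?thesis by (simp add: K_def)
qed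

text \<open>Differentiate the Gaussian integral with respect to \<open>t\<close>.\<close>

lemma gaussian_first_moment:
  fixes t c :: real
  assumes c: "0 < c"
  shows "integrable lborel (\<lambda>x. x * exp (t * x - c * x\<^sup>2 / 2))"
    "(LINT x|lborel. x * exp (t * x - c * x\<^sup>2 / 2)) = t / c * (sqrt (2 * pi / c) * exp (t\<^sup>2 / (2 * c)))"
proof -
  define g where "g x = exp (- (c * x\<^sup>2 / 2))" for x :: real
  have eq: "g x * exp (s * x) = exp (s * x - c * x\<^sup>2 / 2)" for s x
    by (simp add: g_def exp_add[symmetric])
  have eq': "g x * x * exp (s * x) = x * exp (s * x - c * x\<^sup>2 / 2)" for s x
    using eq[of x s] by (simp add: mult_ac)
  note G = has_bochner_integral_gaussian[OF c]
  have int: "integrable lborel (\<lambda>x. g x * exp (s * x))" for s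
    using G[of s] by (simp add: eq has_bochner_integral_iff)
  have gm: "g \<in> borel_measurable lborel" by (simp add: g_def[abs_def])
  have m: "(\<lambda>x. x) \<in> borel_measurable lborel" by simp
  show "integrable lborel (\<lambda>x. x * exp (t * x - c * x\<^sup>2 / 2))"
    using integrable_times_exp[OF m gm int, of t] by (simp add: eq')
  have "((\<lambda>s. sqrt (2 * pi / c) * exp (s\<^sup>2 / (2 * c))) has_real_derivative
      (LINT x|lborel. x * exp (t * x - c * x\<^sup>2 / 2))) (at t)"
    using has_real_derivative_exp_integral[OF m gm int, of t] G
    by (simp add: eq eq' has_bochner_integral_iff)
  moreover have "((\<lambda>s. sqrt (2 * pi / c) * exp (s\<^sup>2 / (2 * c))) has_real_derivative
      t / c * (sqrt (2 * pi / c) * exp (t\<^sup>2 / (2 * c)))) (at t)"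
    using c by (auto intro!: derivative_eq_intros simp: field_simps)
  ultimately show "(LINT x|lborel. x * exp (t * x - c * x\<^sup>2 / 2)) = t / c * (sqrt (2 * pi / c) * exp (t\<^sup>2 / (2 * c)))"
    by (rule DERIV_unique)
qed

lemma integrable_pair_mult:
  fixes f g :: "'a \<Rightarrow> real"
  assumes M: "sigma_finite_measure M" and N: "sigma_finite_measure N"
    and f: "integrable M f" and g: "integrable N g"
  shows "integrable (M \<Otimes>\<^sub>M N) (\<lambda>(x, y). f x * g y)"
    "integral\<^sup>L (M \<Otimes>\<^sub>M N) (\<lambda>(x, y). f x * g y) = (LINT x|M. f x) * (LINT y|N. g y)"
proof -
  interpret M: sigma_finite_measure M by fact
  interpret N: sigma_finite_measure N by fact
  interpret P: pair_sigma_finite M N ..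
  have [measurable]: "f \<in> borel_measurable M" "g \<in> borel_measurable N" using f g by auto
  show i: "integrable (M \<Otimes>\<^sub>M N) (\<lambda>(x, y). f x * g y)"
  proof (rule P.Fubini_integrable)
    show "integrable M (\<lambda>x. LINT y|N. norm (case (x, y) of (x, y) \<Rightarrow> f x * g y))"
      using f by (simp add: abs_mult)
    show "AE x in M. integrable N (\<lambda>y. case (x, y) of (x, y) \<Rightarrow> f x * g y)"
      using g by simp
  qed auto
  show "integral\<^sup>L (M \<Otimes>\<^sub>M N) (\<lambda>(x, y). f x * g y) = (LINT x|M. f x) * (LINT y|N. g y)"
    using P.integral_fst'[OF i] by simp
qed

text \<open>Andreief's identity writes the difference of the two sides as one half of the integral
  of the product of determinants.\<close>

lemma andreief_le:
  fixes f1 f2 g1 g2 :: "'a \<Rightarrow> real"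
  assumes M: "sigma_finite_measure M"
    and i: "integrable M (\<lambda>x. f1 x * g1 x)" "integrable M (\<lambda>x. f2 x * g2 x)"
      "integrable M (\<lambda>x. f1 x * g2 x)" "integrable M (\<lambda>x. f2 x * g1 x)"
    and le: "\<And>x y. (f1 x * f2 y - f1 y * f2 x) * (g1 x * g2 y - g1 y * g2 x) \<le> 0"
  shows "(LINT x|M. f1 x * g1 x) * (LINT x|M. f2 x * g2 x) \<le> (LINT x|M. f1 x * g2 x) * (LINT x|M. f2 x * g1 x)"
proof -
  let ?P = "M \<Otimes>\<^sub>M M"
  let ?a = "\<lambda>(x, y). (f1 x * g1 x) * (f2 y * g2 y)" and ?b = "\<lambda>(x, y). (f2 x * g2 x) * (f1 y * g1 y)"
    and ?c = "\<lambda>(x, y). (f1 x * g2 x) * (f2 y * g1 y)" and ?d = "\<lambda>(x, y). (f2 x * g1 x) * (f1 y * g2 y)"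
  note I = integrable_pair_mult[OF M M]
  have "(LINT z|?P. ?a z + ?b z - ?c z - ?d z) \<le> (LINT z|?P. 0)"
  proof (rule integral_mono)
    show "integrable ?P (\<lambda>z. ?a z + ?b z - ?c z - ?d z)"
      by (intro Bochner_Integration.integrable_add Bochner_Integration.integrable_diff I(1) i)
    show "?a z + ?b z - ?c z - ?d z \<le> 0" for z
    proof -
      obtain x y where z: "z = (x, y)" by force
      have "?a z + ?b z - ?c z - ?d z = (f1 x * f2 y - f1 y * f2 x) * (g1 x * g2 y - g1 y * g2 x)"
        by (simp add: z algebra_simps)
      then show ?thesis using le[of x y] by simp
    qed
  qed simp
  also have "(LINT z|?P. ?a z + ?b z - ?c z - ?d z) =
      (LINT z|?P. ?a z) + (LINT z|?P. ?b z) - (LINT z|?P. ?c z) - (LINT z|?P. ?d z)"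
    using I(1)[OF i(1,2)] I(1)[OF i(2,1)] I(1)[OF i(3,4)] I(1)[OF i(4,3)] by simp
  also have "(LINT z|?P. ?a z) = (LINT x|M. f1 x * g1 x) * (LINT x|M. f2 x * g2 x)" by (rule I(2)[OF i(1,2)])
  also have "(LINT z|?P. ?b z) = (LINT x|M. f2 x * g2 x) * (LINT x|M. f1 x * g1 x)" by (rule I(2)[OF i(2,1)])
  also have "(LINT z|?P. ?c z) = (LINT x|M. f1 x * g2 x) * (LINT x|M. f2 x * g1 x)" by (rule I(2)[OF i(3,4)])
  also have "(LINT z|?P. ?d z) = (LINT x|M. f2 x * g1 x) * (LINT x|M. f1 x * g2 x)" by (rule I(2)[OF i(4,3)])
  finally show ?thesis by (simp add: mult.commute)
qed

text \<open>Two substitutions in one variable at a time: first \<open>x = u - y\<close>, then \<open>y = (u - w) / 2\<close>.\<close>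

lemma nn_integral_lborel_rotate:
  fixes f :: "real \<Rightarrow> real \<Rightarrow> ennreal"
  assumes [measurable]: "(\<lambda>(x, y). f x y) \<in> borel_measurable (borel \<Otimes>\<^sub>M borel)"
  shows "(\<integral>\<^sup>+x. \<integral>\<^sup>+y. f x y \<partial>lborel \<partial>lborel) =
    ennreal (1 / 2) * (\<integral>\<^sup>+u. \<integral>\<^sup>+w. f ((u + w) / 2) ((u - w) / 2) \<partial>lborel \<partial>lborel)"
proof -
  have "(\<integral>\<^sup>+x. \<integral>\<^sup>+y. f x y \<partial>lborel \<partial>lborel) = (\<integral>\<^sup>+y. \<integral>\<^sup>+x. f x y \<partial>lborel \<partial>lborel)"
    by (rule lborel_pair.Fubini'[symmetric]) simp
  also have "\<dots> = (\<integral>\<^sup>+y. \<integral>\<^sup>+u. f (u - y) y \<partial>lborel \<partial>lborel)"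
  proof (rule nn_integral_cong)
    fix y :: real
    have "(\<integral>\<^sup>+x. f x y \<partial>lborel) = ennreal \<bar>1\<bar> * (\<integral>\<^sup>+u. f (- y + 1 * u) y \<partial>lborel)"
      by (rule nn_integral_real_affine) auto
    then show "(\<integral>\<^sup>+x. f x y \<partial>lborel) = (\<integral>\<^sup>+u. f (u - y) y \<partial>lborel)" by simp
  qed
  also have "\<dots> = (\<integral>\<^sup>+u. \<integral>\<^sup>+y. f (u - y) y \<partial>lborel \<partial>lborel)"
    by (rule lborel_pair.Fubini') simp
  also have "\<dots> = (\<integral>\<^sup>+u. ennreal (1 / 2) * (\<integral>\<^sup>+w. f ((u + w) / 2) ((u - w) / 2) \<partial>lborel) \<partial>lborel)"
  proof (rule nn_integral_cong)
    fix u :: real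
    have "(\<integral>\<^sup>+y. f (u - y) y \<partial>lborel) =
        ennreal \<bar>- (1 / 2)\<bar> * (\<integral>\<^sup>+w. f (u - (u / 2 + - (1 / 2) * w)) (u / 2 + - (1 / 2) * w) \<partial>lborel)"
      by (rule nn_integral_real_affine) auto
    also have "(\<lambda>w. f (u - (u / 2 + - (1 / 2) * w)) (u / 2 + - (1 / 2) * w)) = (\<lambda>w. f ((u + w) / 2) ((u - w) / 2))"
      by (intro ext arg_cong2[where f=f]) (auto simp: field_simps)
    finally show "(\<integral>\<^sup>+y. f (u - y) y \<partial>lborel) = ennreal (1 / 2) * (\<integral>\<^sup>+w. f ((u + w) / 2) ((u - w) / 2) \<partial>lborel)"
      by simp
  qed
  also have "\<dots> = ennreal (1 / 2) * (\<integral>\<^sup>+u. \<integral>\<^sup>+w. f ((u + w) / 2) ((u - w) / 2) \<partial>lborel \<partial>lborel)"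
    by (rule nn_integral_cmult) simp
  finally show ?thesis .
qed

lemma lborel_rotate:
  fixes f :: "real \<Rightarrow> real \<Rightarrow> real"
  assumes [measurable]: "(\<lambda>(x, y). f x y) \<in> borel_measurable (borel \<Otimes>\<^sub>M borel)"
    and pos: "\<And>x y. 0 \<le> f x y"
  shows "integral\<^sup>L (lborel \<Otimes>\<^sub>M lborel) (\<lambda>(x, y). f x y) =
     1 / 2 * integral\<^sup>L (lborel \<Otimes>\<^sub>M lborel) (\<lambda>(u, w). f ((u + w) / 2) ((u - w) / 2))"
proof -
  have [measurable]: "(\<lambda>(x, y). f x y) \<in> borel_measurable (lborel \<Otimes>\<^sub>M lborel)"
    by (simp cong: measurable_cong_sets)
  have e: "integral\<^sup>L (lborel \<Otimes>\<^sub>M lborel) (\<lambda>(x, y). g x y) =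
     enn2real (\<integral>\<^sup>+x. \<integral>\<^sup>+y. ennreal (g x y) \<partial>lborel \<partial>lborel)"
    if [measurable]: "(\<lambda>(x, y). g x y) \<in> borel_measurable (lborel \<Otimes>\<^sub>M lborel)" and "\<And>x y. 0 \<le> g x y"
    for g :: "real \<Rightarrow> real \<Rightarrow> real"
    using that by (subst integral_eq_nn_integral) (auto simp: lborel.nn_integral_fst[symmetric])
  have [measurable]: "(\<lambda>(u, w). f ((u + w) / 2) ((u - w) / 2)) \<in> borel_measurable (lborel \<Otimes>\<^sub>M lborel)"
  proof -
    have "(\<lambda>z. (\<lambda>(x, y). f x y) ((fst z + snd z) / 2, (fst z - snd z) / 2)) \<in> borel_measurable (borel \<Otimes>\<^sub>M borel)"
      by measurable
    then show ?thesis by (simp add: split_beta' cong: measurable_cong_sets)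
  qed
  show ?thesis
  proof -
    have "(\<integral>\<^sup>+x. \<integral>\<^sup>+y. ennreal (f x y) \<partial>lborel \<partial>lborel) =
      ennreal (1 / 2) * (\<integral>\<^sup>+u. \<integral>\<^sup>+w. ennreal (f ((u + w) / 2) ((u - w) / 2)) \<partial>lborel \<partial>lborel)"
      by (rule nn_integral_lborel_rotate) measurable
    moreover have "integral\<^sup>L (lborel \<Otimes>\<^sub>M lborel) (\<lambda>(x, y). f x y) =
        enn2real (\<integral>\<^sup>+x. \<integral>\<^sup>+y. ennreal (f x y) \<partial>lborel \<partial>lborel)"
      by (rule e) (use pos in auto)
    moreover have "integral\<^sup>L (lborel \<Otimes>\<^sub>M lborel) (\<lambda>(u, w). f ((u + w) / 2) ((u - w) / 2)) =
        enn2real (\<integral>\<^sup>+u. \<integral>\<^sup>+w. ennreal (f ((u + w) / 2) ((u - w) / 2)) \<partial>lborel \<partial>lborel)"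
      by (rule e) (use pos in auto)
    moreover have "enn2real (ennreal (1 / 2)) = 1 / 2" by (rule enn2real_ennreal) simp
    ultimately show ?thesis by (simp only: enn2real_mult)
  qed
qed

section \<open>Even confinement potentials and the variance inequality for tilted measures\<close>

text \<open>The common features of the quartic potentials and the GHS class.\<close>

locale even_potential =
  fixes V V' :: "real \<Rightarrow> real"
  assumes V': "\<And>x. (V has_real_derivative V' x) (at x)"
    and V_even: "\<And>x. V (- x) = V x"
    and V'_convex: "convex_on {0..} V'"
begin

lemma V_cont: "continuous_on X V"
  using V' DERIV_isCont continuous_at_imp_continuous_on by blast

lemma V_measurable[measurable]: "V \<in> borel_measurable borel"
  using V_cont by (rule borel_measurable_continuous_onI)

lemma V_abs: "V \<bar>x\<bar> = V x"
  by (cases "0 \<le> x") (auto simp: V_even)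

lemma V'_odd: "V' (- x) = - V' x"
proof -
  have "((\<lambda>x. V (- x)) has_real_derivative V' (- x) * (- 1)) (at x)"
    by (rule DERIV_chain2[OF V']) (auto intro!: derivative_eq_intros)
  then have "(V has_real_derivative V' (- x) * (- 1)) (at x)" by (simp add: V_even)
  from DERIV_unique[OF this V'] show ?thesis by simp
qed

lemma V'_0: "V' 0 = 0"
  using V'_odd[of 0] by simp

text \<open>Both middle points are convex combinations, with complementary weights, of the two outer ones.\<close>

lemma V'_increment_mono:
  assumes "0 \<le> p" "p \<le> q" "0 \<le> d"
  shows "V' (p + d) + V' q \<le> V' p + V' (q + d)"
proof (cases "q + d = p")
  case True then have "d = 0" "q = p" using assms by auto
  then show ?thesis by simp
next
  case False
  then have pos: "0 < q + d - p" using assms by linarith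
  \<comment> \<open>\<open>s\<close> and \<open>1 - s\<close> are the weights of \<open>q + d\<close> in the convex combinations \<open>p + d\<close> and \<open>q\<close>.\<close>
  define s where "s = d / (q + d - p)"
  have s: "0 \<le> s" "s \<le> 1" using assms pos by (auto simp: s_def)
  have sd: "s * (q + d - p) = d" using pos by (simp add: s_def)
  have cv: "V' ((1 - t) * p + t * (q + d)) \<le> (1 - t) * V' p + t * V' (q + d)" if "0 \<le> t" "t \<le> 1" for t
    using convex_onD[OF V'_convex that, of p "q + d"] assms by simp
  have "(1 - s) * p + s * (q + d) = p + d" using sd by (simp add: algebra_simps)
  moreover have "(1 - (1 - s)) * p + (1 - s) * (q + d) = q" using sd by (simp add: algebra_simps)
  ultimately show ?thesis using cv[of s] cv[of "1 - s"] s by (simp add: algebra_simps)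
qed

lemma V'_linear_growth:
  assumes "0 < R" "R \<le> x"
  shows "V' R / R * x \<le> V' x"
proof -
  have "V' ((1 - R / x) * 0 + R / x * x) \<le> (1 - R / x) * V' 0 + R / x * V' x"
    using convex_onD[OF V'_convex, of "R / x" 0 x] assms by simp
  then have "V' R \<le> R / x * V' x" using assms by (simp add: V'_0)
  then show ?thesis using assms by (simp add: field_simps)
qed

lemma V_lower_bound_if:
  assumes R: "0 < R" "2 * a * R \<le> V' R"
  shows "\<exists>b. \<forall>x. a * x\<^sup>2 - b \<le> V x"
proof -
  have d: "((\<lambda>x. V x - a * x\<^sup>2) has_real_derivative (V' x - 2 * a * x)) (at x)" for x
    by (auto intro!: derivative_eq_intros V')
  have far: "V R - a * R\<^sup>2 \<le> V x - a * x\<^sup>2" if "R \<le> x" for x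
  proof (rule DERIV_nonneg_imp_nondecreasing[OF that])
    fix y assume y: "R \<le> y" "y \<le> x"
    have "2 * a * y \<le> V' R / R * y" using R y by (intro mult_right_mono) (auto simp: field_simps)
    also have "\<dots> \<le> V' y" by (rule V'_linear_growth) (use R y in auto)
    finally show "\<exists>D. DERIV (\<lambda>x. V x - a * x\<^sup>2) y :> D \<and> 0 \<le> D" using d by force
  qed
  have "compact ((\<lambda>x. V x - a * x\<^sup>2) ` {0..R})"
    by (intro compact_continuous_image continuous_intros V_cont) auto
  then obtain B where B: "\<And>x. x \<in> {0..R} \<Longrightarrow> \<bar>V x - a * x\<^sup>2\<bar> \<le> B"
    using compact_imp_bounded bounded_real by (metis (no_types, lifting) imageI)
  have "a * x\<^sup>2 - B \<le> V x" for x
  proof -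
    have "- B \<le> V \<bar>x\<bar> - a * \<bar>x\<bar>\<^sup>2"
      using B[of "\<bar>x\<bar>"] B[of R] far[of "\<bar>x\<bar>"] R by (cases "\<bar>x\<bar> \<le> R") auto
    then show ?thesis by (simp add: V_abs)
  qed
  then show ?thesis by blast
qed

end

text \<open>Superlinear growth of \<open>V'\<close> is what the finiteness of the partition functions at all
  temperatures contributes; it makes all Gaussian moments of the single-particle measure finite.\<close>

locale confinement = even_potential +
  assumes superlinear: "\<And>a. \<exists>R>0. a * R \<le> V' R"
begin

lemma V_lower_bound: "\<exists>b. \<forall>x. a * x\<^sup>2 - b \<le> V x"
  using superlinear V_lower_bound_if by blast

lemma integrable_exp_V: "integrable lborel (\<lambda>x. exp (a * x\<^sup>2 + t * x - V x))"
proof -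
  obtain b where b: "\<And>x. (a + 1) * x\<^sup>2 - b \<le> V x" using V_lower_bound by blast
  show ?thesis
  proof (rule Bochner_Integration.integrable_bound)
    show "integrable lborel (\<lambda>x. exp b * exp (t * x - 2 * x\<^sup>2 / 2))"
      using has_bochner_integral_gaussian[of 2 t] by (auto simp: has_bochner_integral_iff)
    show "AE x in lborel. norm (exp (a * x\<^sup>2 + t * x - V x)) \<le> norm (exp b * exp (t * x - 2 * x\<^sup>2 / 2))"
    proof (rule AE_I2)
      fix x :: real
      have "a * x\<^sup>2 + t * x - V x \<le> b + (t * x - 2 * x\<^sup>2 / 2)" using b[of x] by (simp add: algebra_simps)
      then show "norm (exp (a * x\<^sup>2 + t * x - V x)) \<le> norm (exp b * exp (t * x - 2 * x\<^sup>2 / 2))"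
        by (simp add: exp_add[symmetric])
    qed
  qed simp
qed

definition rho :: "real \<Rightarrow> real" where
  "rho x = exp (- V x) / (LINT y|lborel. exp (- V y))"

lemma Z_pos: "0 < (LINT y|lborel. exp (- V y))"
proof -
  have "integrable lborel (\<lambda>x. exp (- V x))" using integrable_exp_V[of 0 0] by simp
  then have "(LINT y|lborel. exp (- V y)) = 0 \<longleftrightarrow> (AE y in lborel. exp (- V y) = 0)"
    by (intro integral_nonneg_eq_0_iff_AE) auto
  moreover have "\<not> (AE y in lborel. exp (- V y) = 0)" by (simp add: AE_iff_measurable[OF _ refl])
  moreover have "0 \<le> (LINT y|lborel. exp (- V y))" by simp
  ultimately show ?thesis by linarith
qed

lemma rho_pos: "0 < rho x"
  using Z_pos by (simp add: rho_def)

lemma rho_measurable[measurable]: "rho \<in> borel_measurable borel"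
  unfolding rho_def by measurable

lemma rho_even: "rho (- x) = rho x"
  by (simp add: rho_def V_even)

lemma integrable_rho: "integrable lborel (\<lambda>x. rho x * exp (a * x\<^sup>2 + t * x))"
proof -
  have "rho x * exp (a * x\<^sup>2 + t * x) = exp (a * x\<^sup>2 + t * x - V x) / (LINT y|lborel. exp (- V y))" for x
    by (simp add: rho_def exp_diff exp_minus divide_inverse)
  then show ?thesis using integrable_exp_V[of a t] by simp
qed

lemma integral_rho: "(LINT x|lborel. rho x) = 1"
  using Z_pos by (simp add: rho_def)

lemma alpha_eq: "alpha V = density lborel (\<lambda>x. ennreal (rho x))"
  by (simp add: alpha_def rho_def)

lemma space_alpha[simp]: "space (alpha V) = UNIV" and sets_alpha[simp, measurable_cong]: "sets (alpha V) = sets borel"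
  by (simp_all add: alpha_eq)

lemma integrable_alpha_iff:
  "g \<in> borel_measurable borel \<Longrightarrow> integrable (alpha V) g \<longleftrightarrow> integrable lborel (\<lambda>x. rho x * g x)"
  for g :: "real \<Rightarrow> real"
  unfolding alpha_eq using rho_pos by (subst integrable_density) (auto simp: less_imp_le)

lemma integral_alpha:
  "g \<in> borel_measurable borel \<Longrightarrow> (LINT x|alpha V. g x) = (LINT x|lborel. rho x * g x)"
  for g :: "real \<Rightarrow> real"
  unfolding alpha_eq using rho_pos by (subst integral_density) (auto simp: less_imp_le)

lemma prob_space_alpha: "prob_space (alpha V)"
proof
  have "emeasure (alpha V) UNIV = (\<integral>\<^sup>+x. ennreal (rho x) \<partial>lborel)"
    by (simp add: alpha_eq emeasure_density)
  also have "\<dots> = ennreal (LINT x|lborel. rho x)"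
    using integrable_rho[of 0 0] rho_pos by (intro nn_integral_eq_integral) (auto simp: less_imp_le)
  finally show "emeasure (alpha V) (space (alpha V)) = 1" by (simp add: integral_rho)
qed

sublocale alpha: prob_space "alpha V" by (rule prob_space_alpha)

lemma integrable_alpha_gauss: "integrable (alpha V) (\<lambda>x. exp (a * x\<^sup>2 + t * x))"
  using integrable_rho by (subst integrable_alpha_iff) auto

lemma integrable_alpha_exp: "integrable (alpha V) (\<lambda>x. exp (t * x))"
  using integrable_alpha_gauss[of 0 t] by simp

text \<open>The moment generating function of the single-particle measure and its first two derivatives.\<close>

definition L :: "real \<Rightarrow> real" where "L t = (LINT x|alpha V. exp (t * x))"
definition L1 :: "real \<Rightarrow> real" where "L1 t = (LINT x|alpha V. x * exp (t * x))"
definition L2 :: "real \<Rightarrow> real" where "L2 t = (LINT x|alpha V. x\<^sup>2 * exp (t * x))"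
definition sigma2 :: real where "sigma2 = (LINT x|alpha V. x\<^sup>2)"

lemma integrable_alpha_x_exp: "integrable (alpha V) (\<lambda>x. x * exp (t * x))"
  using integrable_times_exp[of "\<lambda>x. x" "alpha V" "\<lambda>_. 1" t] integrable_alpha_exp by simp

lemma integrable_alpha_x2_exp: "integrable (alpha V) (\<lambda>x. x\<^sup>2 * exp (t * x))"
  using integrable_times_exp[of "\<lambda>x. x" "alpha V" "\<lambda>x. x" t] integrable_alpha_x_exp
  by (simp add: power2_eq_square)

lemma L_deriv: "(L has_real_derivative L1 t) (at t)"
  using has_real_derivative_exp_integral[of "\<lambda>x. x" "alpha V" "\<lambda>_. 1" t] integrable_alpha_exp
  by (simp add: L_def[abs_def] L1_def)

lemma L_measurable[measurable]: "L \<in> borel_measurable borel"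
  by (rule borel_measurable_continuous_onI, rule DERIV_continuous_on, rule L_deriv)

lemma L1_deriv: "(L1 has_real_derivative L2 t) (at t)"
  using has_real_derivative_exp_integral[of "\<lambda>x. x" "alpha V" "\<lambda>x. x" t] integrable_alpha_x_exp
  by (simp add: L1_def[abs_def] L2_def power2_eq_square)

lemma L_pos: "0 < L t"
  unfolding L_def using alpha.integral_less_AE_space[OF _ integrable_alpha_exp[of t], of "\<lambda>_. 0"]
  by (simp add: alpha.emeasure_space_1[simplified])

lemma L_0: "L 0 = 1"
  using alpha.prob_space by (simp add: L_def)

lemma L2_0: "L2 0 = sigma2"
  by (simp add: L2_def sigma2_def)

lemma integral_alpha_reflect:
  fixes g :: "real \<Rightarrow> real"
  assumes [measurable]: "g \<in> borel_measurable borel"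
  shows "(LINT x|alpha V. g (- x)) = (LINT x|alpha V. g x)"
proof -
  have "(LINT x|lborel. rho x * g x) = \<bar>- 1\<bar> * (LINT x|lborel. rho (0 + (- 1) * x) * g (0 + (- 1) * x))"
    using lborel_integral_real_affine[of "- 1" "\<lambda>x. rho x * g x" 0] by simp
  then show ?thesis by (simp add: integral_alpha rho_even)
qed

lemma L_even: "L (- t) = L t"
  using integral_alpha_reflect[of "\<lambda>x. exp (t * x)"] by (simp add: L_def)

lemma L1_0: "L1 0 = 0"
  using integral_alpha_reflect[of "\<lambda>x. x"] by (simp add: L1_def)

lemma sigma2_pos: "0 < sigma2"
proof -
  have i: "integrable (alpha V) (\<lambda>x. x\<^sup>2)" using integrable_alpha_x2_exp[of 0] by simp
  have "AE x in lborel. x \<noteq> (0::real)" by (rule AE_lborel_singleton)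
  then have "AE x in alpha V. x \<noteq> 0"
    unfolding alpha_eq by (subst AE_density) (auto elim: eventually_mono)
  then have "AE x in alpha V. 0 < x\<^sup>2" by eventually_elim simp
  from alpha.integral_less_AE_space[OF _ i this] show ?thesis
    by (simp add: alpha.emeasure_space_1[simplified] sigma2_def)
qed

text \<open>In the variables \<open>u = x + y\<close>, \<open>w = x - y\<close> the energy \<open>V x + V y\<close> of two particles has
  increasing differences on the positive quadrant: its mixed second difference is an integral of
  increments of the convex and odd function \<open>V'\<close>.\<close>

lemma V_sum_supermodular_nonneg:
  assumes "0 \<le> v" "v \<le> u" "0 \<le> z" "z \<le> w"
  shows "V ((u + z) / 2) + V ((u - z) / 2) + V ((v + w) / 2) + V ((v - w) / 2)
    \<le> V ((u + w) / 2) + V ((u - w) / 2) + V ((v + z) / 2) + V ((v - z) / 2)"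
proof -
  define D where "D s = V ((u + s) / 2) + V ((u - s) / 2) - V ((v + s) / 2) - V ((v - s) / 2)" for s
  define D' where "D' s = (V' ((u + s) / 2) - V' ((u - s) / 2) - V' ((v + s) / 2) + V' ((v - s) / 2)) / 2" for s
  have d: "(D has_real_derivative D' s) (at s)" for s
    unfolding D_def D'_def
    by (auto intro!: derivative_eq_intros DERIV_chain2[OF V'] simp: field_simps)
  have key: "V' ((s + a) / 2) + V' ((s - a) / 2) \<le> V' ((s + b) / 2) + V' ((s - b) / 2)"
    if ab: "0 \<le> a" "a \<le> b" and s: "0 \<le> s" for a b s
  proof -
    have inside: "V' ((s + a) / 2) + V' ((s - a) / 2) \<le> V' ((s + b) / 2) + V' ((s - b) / 2)"
      if "0 \<le> a" "a \<le> b" "b \<le> s" for a b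
    proof -
      have e: "(s - b) / 2 + (b - a) / 2 = (s - a) / 2" "(s + a) / 2 + (b - a) / 2 = (s + b) / 2"
        by (simp_all add: field_simps)
      show ?thesis
        using V'_increment_mono[of "(s - b) / 2" "(s + a) / 2" "(b - a) / 2", unfolded e] that by simp
    qed
    have outside: "V' ((s + a) / 2) + V' ((s - a) / 2) \<le> V' ((s + b) / 2) + V' ((s - b) / 2)"
      if "s \<le> a" "a \<le> b" for a b
    proof -
      have "V' ((s - a) / 2) = - V' ((a - s) / 2)" "V' ((s - b) / 2) = - V' ((b - s) / 2)"
        using V'_odd[of "(a - s) / 2"] V'_odd[of "(b - s) / 2"] by (simp_all add: minus_divide_left)
      moreover have e: "(a - s) / 2 + s = (s + a) / 2" "(b - s) / 2 + s = (s + b) / 2" by (simp_all add: field_simps)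
      ultimately show ?thesis
        using V'_increment_mono[of "(a - s) / 2" "(b - s) / 2" s, unfolded e] that s by simp
    qed
    show ?thesis
      using inside[of a b] outside[of a b] order_trans[OF inside[of a s] outside[of s b]] ab s
      by (cases "b \<le> s"; cases "s \<le> a") auto
  qed
  have "D z \<le> D w"
  proof (rule DERIV_nonneg_imp_nondecreasing[OF assms(4)])
    fix s assume "z \<le> s" "s \<le> w"
    then have s: "0 \<le> s" using assms by linarith
    have "V' ((u - s) / 2) = - V' ((s - u) / 2)" "V' ((v - s) / 2) = - V' ((s - v) / 2)"
      using V'_odd[of "(s - u) / 2"] V'_odd[of "(s - v) / 2"] by (simp_all add: minus_divide_left)
    then have "0 \<le> D' s" using key[OF assms(1,2) s] by (simp add: D'_def add.commute)
    then show "\<exists>E. DERIV D s :> E \<and> 0 \<le> E" using d by blast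
  qed
  then show ?thesis by (simp add: D_def)
qed

text \<open>The joint density, up to the Jacobian, of the sum \<open>u\<close> and the difference \<open>w\<close> of two independent
  particles.\<close>

definition rotated_density :: "real \<Rightarrow> real \<Rightarrow> real" where
  "rotated_density u w = rho ((u + w) / 2) * rho ((u - w) / 2)"

lemma rotated_density_pos: "0 < rotated_density u w"
  using rho_pos by (simp add: rotated_density_def)

lemma rotated_density_even: "rotated_density (- u) w = rotated_density u w" "rotated_density u (- w) = rotated_density u w"
proof -
  have "(- u + w) / 2 = - ((u - w) / 2)" "(- u - w) / 2 = - ((u + w) / 2)" by (simp_all add: field_simps)
  then show "rotated_density (- u) w = rotated_density u w" by (simp only: rotated_density_def rho_even mult.commute)
  show "rotated_density u (- w) = rotated_density u w" by (simp add: rotated_density_def mult.commute)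
qed

lemma rotated_density_abs: "rotated_density \<bar>u\<bar> \<bar>w\<bar> = rotated_density u w"
  by (cases "0 \<le> u"; cases "0 \<le> w") (auto simp: rotated_density_even)

lemma rotated_density_measurable[measurable]:
  assumes [measurable]: "f \<in> borel_measurable M" "g \<in> borel_measurable M"
  shows "(\<lambda>x. rotated_density (f x) (g x)) \<in> borel_measurable M"
  unfolding rotated_density_def by measurable

lemma rotated_density_submodular:
  assumes "\<bar>v\<bar> \<le> \<bar>u\<bar>" "\<bar>z\<bar> \<le> \<bar>w\<bar>"
  shows "rotated_density u w * rotated_density v z \<le> rotated_density u z * rotated_density v w"
proof -
  let ?Z = "LINT y|lborel. exp (- V y)"
  have e: "rotated_density a b = exp (- (V ((a + b) / 2) + V ((a - b) / 2))) / ?Z\<^sup>2" for a b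
    by (simp add: rotated_density_def rho_def power2_eq_square mult_exp_exp)
  have "rotated_density \<bar>u\<bar> \<bar>w\<bar> * rotated_density \<bar>v\<bar> \<bar>z\<bar> \<le> rotated_density \<bar>u\<bar> \<bar>z\<bar> * rotated_density \<bar>v\<bar> \<bar>w\<bar>"
    unfolding e times_divide_times_eq mult_exp_exp
    using V_sum_supermodular_nonneg[of "\<bar>v\<bar>" "\<bar>u\<bar>" "\<bar>z\<bar>" "\<bar>w\<bar>"] assms
    by (intro divide_right_mono) simp_all
  then show ?thesis by (simp add: rotated_density_abs)
qed

lemma rotated_density_bound: "\<exists>C>0. \<forall>u w. rotated_density u w \<le> C * exp (- u\<^sup>2) * exp (- w\<^sup>2)"
proof -
  let ?Z = "LINT y|lborel. exp (- V y)"
  obtain b where b: "\<And>x. 2 * x\<^sup>2 - b \<le> V x" using V_lower_bound by blast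
  have "rotated_density u w \<le> exp (2 * b) / ?Z\<^sup>2 * exp (- u\<^sup>2) * exp (- w\<^sup>2)" for u w
  proof -
    have "rotated_density u w = exp (- V ((u + w) / 2) - V ((u - w) / 2)) / ?Z\<^sup>2"
      by (simp add: rotated_density_def rho_def power2_eq_square mult_exp_exp)
    also have "\<dots> \<le> exp (2 * b + - u\<^sup>2 + - w\<^sup>2) / ?Z\<^sup>2"
    proof (intro divide_right_mono)
      have "2 * ((u + w) / 2)\<^sup>2 + 2 * ((u - w) / 2)\<^sup>2 = u\<^sup>2 + w\<^sup>2"
        by (simp add: power2_eq_square field_simps)
      then show "exp (- V ((u + w) / 2) - V ((u - w) / 2)) \<le> exp (2 * b + - u\<^sup>2 + - w\<^sup>2)"
        using b[of "(u + w) / 2"] b[of "(u - w) / 2"] by simp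
    qed auto
    finally show ?thesis by (simp only: exp_add times_divide_eq_left)
  qed
  then show ?thesis using Z_pos by (intro exI[of _ "exp (2 * b) / ?Z\<^sup>2"]) auto
qed

lemma integrable_sq_gauss: "integrable lborel (\<lambda>w::real. w\<^sup>2 * exp (- w\<^sup>2))"
proof (rule Bochner_Integration.integrable_bound)
  show "integrable lborel (\<lambda>w::real. 2 * exp (0 * w - 1 * w\<^sup>2 / 2))"
    using has_bochner_integral_gaussian[of 1 0] by (auto simp: has_bochner_integral_iff)
  show "AE w::real in lborel. norm (w\<^sup>2 * exp (- w\<^sup>2)) \<le> norm (2 * exp (0 * w - 1 * w\<^sup>2 / 2))"
  proof (rule AE_I2)
    fix w :: real
    have "w\<^sup>2 / 2 \<le> exp (w\<^sup>2 / 2)" using exp_ge_add_one_self[of "w\<^sup>2 / 2"] by linarith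
    then have "w\<^sup>2 * exp (- w\<^sup>2) \<le> 2 * exp (w\<^sup>2 / 2) * exp (- w\<^sup>2)" by (intro mult_right_mono) auto
    also have "\<dots> = 2 * exp (- (w\<^sup>2 / 2))" by (simp add: exp_add[symmetric] mult.assoc)
    finally show "norm (w\<^sup>2 * exp (- w\<^sup>2)) \<le> norm (2 * exp (0 * w - 1 * w\<^sup>2 / 2))" by simp
  qed
qed simp

lemma integrable_exp_gauss: "integrable lborel (\<lambda>u. exp (t * u) * exp (- u\<^sup>2))" for t :: real
  using has_bochner_integral_gaussian[of 2 t] by (simp add: has_bochner_integral_iff exp_add[symmetric])

lemma integrable_rotated_density:
  fixes h g :: "real \<Rightarrow> real"
  assumes [measurable]: "h \<in> borel_measurable borel" "g \<in> borel_measurable borel"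
    and pos: "\<And>x. 0 \<le> h x" "\<And>x. 0 \<le> g x"
    and h: "integrable lborel (\<lambda>u. h u * exp (- u\<^sup>2))" and g: "integrable lborel (\<lambda>u. g u * exp (- u\<^sup>2))"
  shows "integrable (lborel \<Otimes>\<^sub>M lborel) (\<lambda>(u, w). h u * (g w * rotated_density u w))"
    "integrable lborel (\<lambda>w. g w * rotated_density u w)"
proof -
  obtain C where C: "0 < C" "\<And>u w. rotated_density u w \<le> C * exp (- u\<^sup>2) * exp (- w\<^sup>2)" using rotated_density_bound by blast
  have b: "g w * rotated_density u w \<le> C * exp (- u\<^sup>2) * (g w * exp (- w\<^sup>2))" for u w
    using mult_left_mono[OF C(2)[of u w] pos(2)[of w]] by (simp add: mult_ac)
  show "integrable lborel (\<lambda>w. g w * rotated_density u w)"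
  proof (rule Bochner_Integration.integrable_bound)
    show "integrable lborel (\<lambda>w. C * exp (- u\<^sup>2) * (g w * exp (- w\<^sup>2)))"
      using g by (intro integrable_mult_right)
    show "AE w in lborel. norm (g w * rotated_density u w) \<le> norm (C * exp (- u\<^sup>2) * (g w * exp (- w\<^sup>2)))"
      using b pos rotated_density_pos C(1) by (auto intro!: AE_I2 simp: abs_mult abs_of_pos abs_of_nonneg)
  qed simp
  show "integrable (lborel \<Otimes>\<^sub>M lborel) (\<lambda>(u, w). h u * (g w * rotated_density u w))"
  proof (rule Bochner_Integration.integrable_bound)
    show "integrable (lborel \<Otimes>\<^sub>M lborel) (\<lambda>z. C * (case z of (u, w) \<Rightarrow> (h u * exp (- u\<^sup>2)) * (g w * exp (- w\<^sup>2))))"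
      by (intro integrable_mult_right integrable_pair_mult(1) lborel.sigma_finite_measure_axioms h g)
    have "h u * (g w * rotated_density u w) \<le> C * ((h u * exp (- u\<^sup>2)) * (g w * exp (- w\<^sup>2)))" for u w
      using mult_left_mono[OF b[of w u] pos(1)[of u]] by (simp add: mult_ac)
    then show "AE z in lborel \<Otimes>\<^sub>M lborel. norm (case z of (u, w) \<Rightarrow> h u * (g w * rotated_density u w)) \<le>
       norm (C * (case z of (u, w) \<Rightarrow> (h u * exp (- u\<^sup>2)) * (g w * exp (- w\<^sup>2))))"
      using pos rotated_density_pos C(1) by (auto intro!: AE_I2 simp: abs_mult abs_of_pos abs_of_nonneg)
  qed simp
qed

text \<open>Under the rotation a tilt of both particles acts on \<open>u\<close> alone, while the variance is half the
  mean square of \<open>w\<close>.\<close>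

lemma integral_tilt_rotated_density:
  "(LINT u|lborel. exp (t * u) * (LINT w|lborel. rotated_density u w)) = 2 * (L t)\<^sup>2"
  "(LINT u|lborel. exp (t * u) * (LINT w|lborel. w\<^sup>2 * rotated_density u w)) = 4 * (L2 t * L t - (L1 t)\<^sup>2)"
proof -
  note sf = lborel.sigma_finite_measure_axioms
  have i0: "integrable lborel (\<lambda>x. rho x * exp (t * x))" "integrable lborel (\<lambda>x. rho x * (x * exp (t * x)))"
    "integrable lborel (\<lambda>x. rho x * (x\<^sup>2 * exp (t * x)))"
    using integrable_alpha_exp[of t] integrable_alpha_x_exp[of t] integrable_alpha_x2_exp[of t]
    by (simp_all add: integrable_alpha_iff)
  have e0: "(LINT x|lborel. rho x * exp (t * x)) = L t" "(LINT x|lborel. rho x * (x * exp (t * x))) = L1 t"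
    "(LINT x|lborel. rho x * (x\<^sup>2 * exp (t * x))) = L2 t"
    by (simp_all add: L_def L1_def L2_def integral_alpha)
  have rot: "integral\<^sup>L (lborel \<Otimes>\<^sub>M lborel) (\<lambda>(x, y). g (x - y) * exp (t * (x + y)) * (rho x * rho y)) =
      1 / 2 * (LINT u|lborel. exp (t * u) * (LINT w|lborel. g w * rotated_density u w))"
    if [measurable]: "g \<in> borel_measurable borel" and g: "\<And>x. 0 \<le> g x" "integrable lborel (\<lambda>u. g u * exp (- u\<^sup>2))"
    for g :: "real \<Rightarrow> real"
  proof -
    have a: "(u + w) / 2 - (u - w) / 2 = w" "(u + w) / 2 + (u - w) / 2 = u" for u w :: real
      by (simp_all add: field_simps)
    have i: "integrable (lborel \<Otimes>\<^sub>M lborel) (\<lambda>(u, w). exp (t * u) * (g w * rotated_density u w))"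
      by (rule integrable_rotated_density(1)) (use g integrable_exp_gauss in auto)
    have "integral\<^sup>L (lborel \<Otimes>\<^sub>M lborel) (\<lambda>(x, y). g (x - y) * exp (t * (x + y)) * (rho x * rho y)) =
       1 / 2 * integral\<^sup>L (lborel \<Otimes>\<^sub>M lborel) (\<lambda>(u, w). g ((u + w) / 2 - (u - w) / 2) *
          exp (t * ((u + w) / 2 + (u - w) / 2)) * (rho ((u + w) / 2) * rho ((u - w) / 2)))"
      by (rule lborel_rotate) (use g rho_pos in \<open>auto simp: less_imp_le\<close>)
    also have "\<dots> = 1 / 2 * integral\<^sup>L (lborel \<Otimes>\<^sub>M lborel) (\<lambda>(u, w). exp (t * u) * (g w * rotated_density u w))"
      by (simp only: a rotated_density_def mult_ac)
    also have "integral\<^sup>L (lborel \<Otimes>\<^sub>M lborel) (\<lambda>(u, w). exp (t * u) * (g w * rotated_density u w)) =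
       (LINT u|lborel. exp (t * u) * (LINT w|lborel. g w * rotated_density u w))"
      using lborel_pair.integral_fst'[OF i] by simp
    finally show ?thesis .
  qed
  have "integral\<^sup>L (lborel \<Otimes>\<^sub>M lborel) (\<lambda>(x, y). 1 * exp (t * (x + y)) * (rho x * rho y)) =
      integral\<^sup>L (lborel \<Otimes>\<^sub>M lborel) (\<lambda>(x, y). (rho x * exp (t * x)) * (rho y * exp (t * y)))"
    by (intro Bochner_Integration.integral_cong refl) (auto simp: exp_add distrib_left)
  also have "\<dots> = L t * L t" using integrable_pair_mult(2)[OF sf sf i0(1,1)] by (simp add: e0)
  finally show "(LINT u|lborel. exp (t * u) * (LINT w|lborel. rotated_density u w)) = 2 * (L t)\<^sup>2"
    using rot[of "\<lambda>_. 1"] integrable_exp_gauss[of 0] by (simp add: power2_eq_square)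
  let ?a = "\<lambda>(x, y). (rho x * (x\<^sup>2 * exp (t * x))) * (rho y * exp (t * y))"
  let ?b = "\<lambda>(x, y). (rho x * (x * exp (t * x))) * (rho y * (y * exp (t * y)))"
  let ?c = "\<lambda>(x, y). (rho x * exp (t * x)) * (rho y * (y\<^sup>2 * exp (t * y)))"
  have "integral\<^sup>L (lborel \<Otimes>\<^sub>M lborel) (\<lambda>(x, y). (x - y)\<^sup>2 * exp (t * (x + y)) * (rho x * rho y)) =
      integral\<^sup>L (lborel \<Otimes>\<^sub>M lborel) (\<lambda>z. ?a z - 2 * ?b z + ?c z)"
    by (intro Bochner_Integration.integral_cong refl)
      (auto simp: exp_add distrib_left power2_diff algebra_simps)
  also have "\<dots> = L2 t * L t - 2 * (L1 t * L1 t) + L t * L2 t"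
    using integrable_pair_mult[OF sf sf i0(3,1)] integrable_pair_mult[OF sf sf i0(2,2)]
      integrable_pair_mult[OF sf sf i0(1,3)] by (simp add: e0)
  also have "\<dots> = 2 * (L2 t * L t - (L1 t)\<^sup>2)" by (simp add: power2_eq_square algebra_simps)
  also have "integral\<^sup>L (lborel \<Otimes>\<^sub>M lborel) (\<lambda>(x, y). (x - y)\<^sup>2 * exp (t * (x + y)) * (rho x * rho y)) =
      1 / 2 * (LINT u|lborel. exp (t * u) * (LINT w|lborel. w\<^sup>2 * rotated_density u w))"
    by (rule rot) (use integrable_sq_gauss in auto)
  finally show "(LINT u|lborel. exp (t * u) * (LINT w|lborel. w\<^sup>2 * rotated_density u w)) = 4 * (L2 t * L t - (L1 t)\<^sup>2)"
    by simp
qed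

text \<open>The variance of the tilted measure is largest without tilt. The variance is half the mean
  of \<open>w\<^sup>2\<close>, the tilt multiplies the law of \<open>u\<close> by an increasing function of \<open>\<bar>u\<bar>\<close>, and by
  submodularity the conditional mean of \<open>w\<^sup>2\<close> given \<open>u\<close> decreases in \<open>\<bar>u\<bar>\<close>; both facts are
  Chebyshev inequalities.\<close>

lemma tilted_variance_le: "L2 t * L t - (L1 t)\<^sup>2 \<le> sigma2 * (L t)\<^sup>2"
proof -
  note sf = lborel.sigma_finite_measure_axioms
  define A where "A u = (LINT w|lborel. w\<^sup>2 * rotated_density u w)" for u
  define K where "K u = (LINT w|lborel. rotated_density u w)" for u
  define c where "c u = exp (t * u) + exp (- t * u)" for u
  have g1: "integrable lborel (\<lambda>u::real. 1 * exp (- u\<^sup>2))" using integrable_exp_gauss[of 0] by simp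
  have A_i: "integrable lborel (\<lambda>w. w\<^sup>2 * rotated_density u w)" and K_i: "integrable lborel (\<lambda>w. 1 * rotated_density u w)" for u
    by (rule integrable_rotated_density(2)[where h="\<lambda>_. 1"]; use g1 integrable_sq_gauss in simp)+
  have eA: "integrable lborel (\<lambda>u. exp (s * u) * A u)" for s
    using lborel_pair.integrable_fst'[OF integrable_rotated_density(1)[of "\<lambda>u. exp (s * u)" "\<lambda>w. w\<^sup>2"]]
      integrable_exp_gauss integrable_sq_gauss by (simp add: A_def)
  have eK: "integrable lborel (\<lambda>u. exp (s * u) * K u)" for s
    using lborel_pair.integrable_fst'[OF integrable_rotated_density(1)[of "\<lambda>u. exp (s * u)" "\<lambda>_. 1"]]
      integrable_exp_gauss[of s] integrable_exp_gauss[of 0] by (simp add: K_def)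
  have step1: "A u * K v \<le> A v * K u" if "\<bar>v\<bar> \<le> \<bar>u\<bar>" for u v
  proof -
    have "(LINT w|lborel. w\<^sup>2 * rotated_density u w) * (LINT w|lborel. 1 * rotated_density v w) \<le>
          (LINT w|lborel. w\<^sup>2 * rotated_density v w) * (LINT w|lborel. 1 * rotated_density u w)"
    proof (rule andreief_le[OF sf A_i K_i A_i K_i])
      show "(w\<^sup>2 * 1 - z\<^sup>2 * 1) * (rotated_density u w * rotated_density v z - rotated_density u z * rotated_density v w) \<le> 0" for w z
      proof (cases "\<bar>z\<bar> \<le> \<bar>w\<bar>")
        case True
        then have "z\<^sup>2 \<le> w\<^sup>2" by (simp add: abs_le_square_iff)
        then show ?thesis using rotated_density_submodular[OF that True] by (simp add: mult_nonneg_nonpos)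
      next
        case False
        then have "w\<^sup>2 \<le> z\<^sup>2" by (simp add: abs_le_square_iff[symmetric])
        then show ?thesis using rotated_density_submodular[OF that, of w z] False by (simp add: mult_nonpos_nonneg mult.commute)
      qed
    qed
    then show ?thesis by (simp add: A_def K_def)
  qed
  have cmono: "c v \<le> c u" if "\<bar>v\<bar> \<le> \<bar>u\<bar>" for u v
  proof -
    have "c x = 2 * cosh (\<bar>t\<bar> * \<bar>x\<bar>)" for x
      by (cases "0 \<le> t"; cases "0 \<le> x") (simp_all add: c_def cosh_def)
    moreover have "\<bar>t\<bar> * \<bar>v\<bar> \<le> \<bar>t\<bar> * \<bar>u\<bar>" using that by (intro mult_left_mono) auto
    ultimately show ?thesis by (simp add: cosh_real_nonneg_le_iff)
  qed
  have "(LINT u|lborel. c u * A u) * (LINT u|lborel. 1 * K u) \<le> (LINT u|lborel. c u * K u) * (LINT u|lborel. 1 * A u)"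
  proof (rule andreief_le[OF sf])
    show "integrable lborel (\<lambda>u. c u * A u)" "integrable lborel (\<lambda>u. c u * K u)"
      using eA[of t] eA[of "- t"] eK[of t] eK[of "- t"] by (simp_all add: c_def distrib_right)
    show "integrable lborel (\<lambda>u. 1 * K u)" "integrable lborel (\<lambda>u. 1 * A u)"
      using eA[of 0] eK[of 0] by simp_all
    show "(c u * 1 - c v * 1) * (A u * K v - A v * K u) \<le> 0" for u v
    proof (cases "\<bar>v\<bar> \<le> \<bar>u\<bar>")
      case True
      then show ?thesis using cmono[OF True] step1[OF True] by (simp add: mult_nonneg_nonpos)
    next
      case False
      then have "\<bar>u\<bar> \<le> \<bar>v\<bar>" by simp
      then show ?thesis using cmono[of u v] step1[of u v] by (simp add: mult_nonpos_nonneg)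
    qed
  qed
  moreover have "(LINT u|lborel. c u * A u) = (LINT u|lborel. exp (t * u) * A u) + (LINT u|lborel. exp (- t * u) * A u)"
    using eA[of t] eA[of "- t"] by (simp add: c_def distrib_right)
  moreover have "(LINT u|lborel. c u * K u) = (LINT u|lborel. exp (t * u) * K u) + (LINT u|lborel. exp (- t * u) * K u)"
    using eK[of t] eK[of "- t"] by (simp add: c_def distrib_right)
  moreover have "L1 (- t) = - L1 t"
  proof -
    have "(LINT x|alpha V. - x * exp (t * - x)) = L1 t" unfolding L1_def by (rule integral_alpha_reflect) simp
    then show ?thesis by (simp add: L1_def)
  qed
  moreover have "L2 (- t) = L2 t"
    using integral_alpha_reflect[of "\<lambda>x. x\<^sup>2 * exp (t * x)"] by (simp add: L2_def)
  ultimately have "16 * (L t * L2 t) - 16 * (L1 t)\<^sup>2 \<le> 16 * ((L t)\<^sup>2 * sigma2)"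
    using integral_tilt_rotated_density[of t] integral_tilt_rotated_density[of "- t"] integral_tilt_rotated_density[of 0]
    by (simp add: A_def[symmetric] K_def[symmetric] L_even L_0 L1_0 L2_0)
  then show ?thesis by (simp add: mult.commute)
qed

definition p :: "real \<Rightarrow> real" where "p t = ln (L t)"
definition p' :: "real \<Rightarrow> real" where "p' t = L1 t / L t"

lemma p_deriv: "(p has_real_derivative p' t) (at t)"
  unfolding p_def p'_def using L_pos[of t]
  by (auto intro!: derivative_eq_intros L_deriv)

lemma p'_deriv: "(p' has_real_derivative (L2 t * L t - (L1 t)\<^sup>2) / (L t)\<^sup>2) (at t)"
  unfolding p'_def using L_pos[of t]
  by (auto intro!: derivative_eq_intros L_deriv L1_deriv simp: power2_eq_square)

lemma p'_cont: "continuous_on X p'"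
  using p'_deriv DERIV_isCont continuous_at_imp_continuous_on by blast

lemma p_0: "p 0 = 0"
  by (simp add: p_def L_0)

lemma p'_0: "p' 0 = 0"
  by (simp add: p'_def L1_0)

lemma exp_p: "exp (p t) = L t"
  using L_pos by (simp add: p_def)

text \<open>Integrate the bound \<open>p'' \<le> sigma2\<close> twice. This is both the strong convexity of the mixing
  potential and the sub-Gaussian bound for the tilted particles.\<close>

lemma subgaussian: "p s \<le> p t + p' t * (s - t) + sigma2 / 2 * (s - t)\<^sup>2"
proof -
  define q where "q s = sigma2 / 2 * s\<^sup>2 - p s" for s
  define q' where "q' s = sigma2 * s - p' s" for s
  have "q' t * (s - t) \<le> q s - q t"
  proof (rule f''_imp_f'[where C=UNIV])
    show "(q has_real_derivative q' s) (at s)" for s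
      unfolding q_def q'_def by (auto intro!: derivative_eq_intros p_deriv)
    show "(q' has_real_derivative sigma2 - (L2 s * L s - (L1 s)\<^sup>2) / (L s)\<^sup>2) (at s)" for s
      unfolding q'_def by (auto intro!: derivative_eq_intros p'_deriv)
    show "0 \<le> sigma2 - (L2 s * L s - (L1 s)\<^sup>2) / (L s)\<^sup>2" for s
      using tilted_variance_le[of s] L_pos[of s] by (simp add: divide_le_eq)
  qed auto
  then show ?thesis by (simp add: q_def q'_def power2_eq_square algebra_simps)
qed

lemma p_le: "p s \<le> sigma2 / 2 * s\<^sup>2"
  using subgaussian[of s 0] by (simp add: p_0 p'_0)

lemma L_le: "L s \<le> exp (sigma2 / 2 * s\<^sup>2)"
  using p_le[of s] exp_p[of s] by (metis exp_le_cancel_iff)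

text \<open>The two exponentials \<open>exp (s x)\<close> and \<open>exp (- s x)\<close> have the same mean, and
  \<open>cosh y \<ge> 1 + y\<^sup>2 / 2\<close>.\<close>

lemma L_ge: "1 + sigma2 / 2 * s\<^sup>2 \<le> L s"
proof -
  have i: "integrable (alpha V) (\<lambda>x. x\<^sup>2)" using integrable_alpha_x2_exp[of 0] by simp
  have "(LINT x|alpha V. 1 + s\<^sup>2 / 2 * x\<^sup>2) \<le> (LINT x|alpha V. 1 / 2 * (exp (s * x) + exp (- s * x)))"
  proof (rule integral_mono)
    show "integrable (alpha V) (\<lambda>x. 1 + s\<^sup>2 / 2 * x\<^sup>2)" using i by (intro Bochner_Integration.integrable_add integrable_mult_right) auto
    show "integrable (alpha V) (\<lambda>x. 1 / 2 * (exp (s * x) + exp (- s * x)))"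
      by (intro integrable_mult_right Bochner_Integration.integrable_add integrable_alpha_exp)
    fix x :: real
    have "1 + y\<^sup>2 / 2 \<le> cosh y" for y :: real
    proof -
      have "1 + z\<^sup>2 / 2 \<le> cosh z" if "0 \<le> z" for z :: real
      proof -
        have "cosh 0 - 0\<^sup>2 / 2 \<le> cosh z - z\<^sup>2 / 2"
        proof (rule DERIV_nonneg_imp_nondecreasing[OF that])
          fix y :: real assume y: "0 \<le> y"
          have "sinh 0 - 0 \<le> sinh y - y"
          proof (rule DERIV_nonneg_imp_nondecreasing[OF y])
            fix w :: real
            show "\<exists>D. DERIV (\<lambda>y. sinh y - y) w :> D \<and> 0 \<le> D"
              by (intro exI[of _ "cosh w - 1"]) (auto intro!: derivative_eq_intros simp: cosh_real_ge_1)
          qed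
          then show "\<exists>D. DERIV (\<lambda>y. cosh y - y\<^sup>2 / 2) y :> D \<and> 0 \<le> D"
            by (intro exI[of _ "sinh y - y"]) (auto intro!: derivative_eq_intros)
        qed
        then show ?thesis by simp
      qed
      from this[of "\<bar>y\<bar>"] show ?thesis by simp
    qed
    from this[of "s * x"] show "1 + s\<^sup>2 / 2 * x\<^sup>2 \<le> 1 / 2 * (exp (s * x) + exp (- s * x))"
      by (simp add: cosh_def power_mult_distrib field_simps)
  qed
  also have "(LINT x|alpha V. 1 / 2 * (exp (s * x) + exp (- s * x))) = L s"
    using integrable_alpha_exp[of s] integrable_alpha_exp[of "- s"] L_even[of s] by (simp add: L_def)
  also have "(LINT x|alpha V. 1 + s\<^sup>2 / 2 * x\<^sup>2) = 1 + s\<^sup>2 / 2 * sigma2"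
    using i alpha.prob_space by (simp add: sigma2_def)
  finally show ?thesis by (simp add: mult_ac)
qed

end

section \<open>Tilted measures: uniform log-Sobolev inequality and products\<close>

lemma mono_deriv_above_tangent:
  fixes q q' :: "real \<Rightarrow> real"
  assumes d: "\<And>x. (q has_real_derivative q' x) (at x)" and m: "\<And>x y. x \<le> y \<Longrightarrow> q' x \<le> q' y"
  shows "q x + q' x * (y - x) \<le> q y"
proof (cases x y rule: linorder_cases)
  case less
  from MVT2[OF this, of q q'] d obtain z where z: "x < z" "q y - q x = (y - x) * q' z" by blast
  have "(y - x) * q' x \<le> (y - x) * q' z" using less z by (intro mult_left_mono m) auto
  then show ?thesis using z by (simp add: mult.commute)
next
  case greater
  from MVT2[OF this, of q q'] d obtain z where z: "z < x" "q x - q y = (x - y) * q' z" by blast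
  have "(x - y) * q' z \<le> (x - y) * q' x" using greater z by (intro mult_left_mono m) auto
  then show ?thesis using z by (simp add: algebra_simps)
qed simp

lemma PiM_density:
  assumes I: "finite I" and M: "\<And>i. prob_space (M i)" and f: "\<And>i. f i \<in> borel_measurable (M i)"
    and D: "\<And>i. prob_space (density (M i) (f i))"
  shows "PiM I (\<lambda>i. density (M i) (f i)) = density (PiM I M) (\<lambda>x. \<Prod>i\<in>I. f i (x i))"
proof -
  interpret M: product_prob_space M I by (rule product_prob_spaceI) (rule M)
  interpret D: product_prob_space "\<lambda>i. density (M i) (f i)" I by (rule product_prob_spaceI) (rule D)
  note f[measurable]
  have s: "sets (PiM I (\<lambda>i. density (M i) (f i))) = sets (PiM I M)" by (rule sets_PiM_cong) auto
  show ?thesis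
  proof (rule D.PiM_eqI[OF I, symmetric])
    show "sets (density (PiM I M) (\<lambda>x. \<Prod>i\<in>I. f i (x i))) = sets (PiM I (\<lambda>i. density (M i) (f i)))"
      using s by simp
    fix A assume A: "\<And>i. i \<in> I \<Longrightarrow> A i \<in> sets (density (M i) (f i))"
    then have A': "\<And>i. i \<in> I \<Longrightarrow> A i \<in> sets (M i)" by simp
    have "emeasure (density (PiM I M) (\<lambda>x. \<Prod>i\<in>I. f i (x i))) (Pi\<^sub>E I A) =
       (\<integral>\<^sup>+x. (\<Prod>i\<in>I. f i (x i)) * indicator (Pi\<^sub>E I A) x \<partial>PiM I M)"
      using A' I by (subst emeasure_density) (auto intro!: sets_PiM_I_finite)
    also have "\<dots> = (\<integral>\<^sup>+x. (\<Prod>i\<in>I. f i (x i) * indicator (A i) (x i)) \<partial>PiM I M)"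
    proof (rule nn_integral_cong)
      fix x assume x: "x \<in> space (PiM I M)"
      have "indicator (Pi\<^sub>E I A) x = (\<Prod>i\<in>I. indicator (A i) (x i) :: ennreal)"
      proof (cases "x \<in> Pi\<^sub>E I A")
        case True then show ?thesis by (auto simp: PiE_iff)
      next
        case False
        then obtain i where "i \<in> I" "x i \<notin> A i" using x by (auto simp: space_PiM PiE_iff)
        then have "(\<Prod>i\<in>I. indicator (A i) (x i) :: ennreal) = 0" using I by (intro prod_zero bexI[of _ i]) auto
        then show ?thesis using False by simp
      qed
      then show "(\<Prod>i\<in>I. f i (x i)) * indicator (Pi\<^sub>E I A) x = (\<Prod>i\<in>I. f i (x i) * indicator (A i) (x i))"
        by (simp add: prod.distrib)
    qed
    also have "\<dots> = (\<Prod>i\<in>I. \<integral>\<^sup>+y. f i y * indicator (A i) y \<partial>M i)"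
      using A' by (intro M.product_nn_integral_prod[OF I]) auto
    also have "\<dots> = (\<Prod>i\<in>I. emeasure (density (M i) (f i)) (A i))"
      using A' by (intro prod.cong refl) (simp add: emeasure_density)
    finally show "emeasure (density (PiM I M) (\<lambda>x. \<Prod>i\<in>I. f i (x i))) (Pi\<^sub>E I A) =
      (\<Prod>i\<in>I. emeasure (density (M i) (f i)) (A i))" .
  qed
qed

text \<open>Resampling one coordinate does not change a product measure.\<close>

lemma integral_PiM_update:
  fixes g :: "_ \<Rightarrow> real"
  assumes I: "finite I" "i \<in> I" and M: "\<And>i. prob_space (M i)"
    and g[measurable]: "g \<in> borel_measurable (PiM I M)" and B: "\<And>x. x \<in> space (PiM I M) \<Longrightarrow> \<bar>g x\<bar> \<le> B"
  shows "(LINT x|PiM I M. LINT y|M i. g (x(i := y))) = (LINT x|PiM I M. g x)"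
    and "integrable (PiM I M) (\<lambda>x. LINT y|M i. g (x(i := y)))"
proof -
  interpret P: product_prob_space M I by (rule product_prob_spaceI) (rule M)
  interpret Mi: prob_space "M i" by (rule M)
  define J where "J = I - {i}"
  have J: "finite J" "i \<notin> J" "insert i J = I" using I by (auto simp: J_def)
  have [measurable]: "(\<lambda>(x, y). x(i := y)) \<in> measurable (PiM I M \<Otimes>\<^sub>M M i) (PiM I M)"
    using measurable_add_dim[of i I M] I by (simp add: insert_absorb)
  have [measurable]: "(\<lambda>(x, y). g (x(i := y))) \<in> borel_measurable (PiM I M \<Otimes>\<^sub>M M i)" by measurable
  define h where "h x = (LINT y|M i. g (x(i := y)))" for x
  have hm: "h \<in> borel_measurable (PiM I M)" unfolding h_def by measurable
  have up: "x(i := y) \<in> space (PiM I M)" if "x \<in> space (PiM I M)" "y \<in> space (M i)" for x y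
    using that I by (auto simp: space_PiM PiE_def Pi_def extensional_def)
  have hb: "\<bar>h x\<bar> \<le> B" if x: "x \<in> space (PiM I M)" for x
  proof -
    have m: "(\<lambda>y. g (x(i := y))) \<in> borel_measurable (M i)"
      using measurable_Pair2[of "\<lambda>(x, y). g (x(i := y))", OF _ x] by simp
    have b: "\<bar>g (x(i := y))\<bar> \<le> B" if "y \<in> space (M i)" for y using B up x that by blast
    have int: "integrable (M i) (\<lambda>y. g (x(i := y)))"
      by (rule integrable_bounded[OF prob_space.finite_measure[OF M] m b])
    show ?thesis unfolding h_def
      using integral_between[OF M int, of "- B" B] b by (auto simp: abs_le_iff minus_le_iff)
  qed
  have hi: "integrable (PiM I M) h"
    by (rule integrable_bounded[OF P.finite_measure_axioms hm hb])
  have gi: "integrable (PiM I M) g"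
    by (rule integrable_bounded[OF P.finite_measure_axioms g B])
  have "(LINT x|PiM I M. h x) = (LINT x|PiM J M. LINT z|M i. h (x(i := z)))"
    using P.product_integral_insert[OF J(1,2)] hi by (simp add: J(3))
  also have "\<dots> = (LINT x|PiM J M. h x)" by (simp add: h_def prob_space.prob_space[OF M])
  also have "\<dots> = (LINT x|PiM I M. g x)"
    unfolding h_def by (rule P.product_integral_insert[OF J(1,2), unfolded J(3), OF gi, symmetric])
  finally show "(LINT x|PiM I M. LINT y|M i. g (x(i := y))) = (LINT x|PiM I M. g x)" by (simp add: h_def)
  show "integrable (PiM I M) (\<lambda>x. LINT y|M i. g (x(i := y)))" using hi unfolding h_def[abs_def] .
qed

context confinement
begin

definition tilt :: "real \<Rightarrow> real measure" where
  "tilt t = density (alpha V) (\<lambda>x. ennreal (exp (t * x) / L t))"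

lemma space_tilt[simp]: "space (tilt t) = UNIV" and sets_tilt[simp, measurable_cong]: "sets (tilt t) = sets borel"
  by (simp_all add: tilt_def)

lemma tilt_eq: "tilt t = density lborel (\<lambda>x. ennreal (rho x * (exp (t * x) / L t)))"
  unfolding tilt_def alpha_eq
  by (subst density_density_eq) (use rho_pos L_pos in \<open>auto simp: ennreal_mult[symmetric] less_imp_le\<close>)

lemma prob_space_tilt: "prob_space (tilt t)"
proof
  have "emeasure (tilt t) UNIV = (\<integral>\<^sup>+x. ennreal (exp (t * x) / L t) \<partial>alpha V)"
    by (simp add: tilt_def emeasure_density)
  also have "\<dots> = ennreal (LINT x|alpha V. exp (t * x) / L t)"
    using integrable_alpha_exp[of t] L_pos[of t] by (intro nn_integral_eq_integral) (auto simp: less_imp_le)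
  also have "(LINT x|alpha V. exp (t * x) / L t) = 1" using L_pos[of t] by (simp add: L_def)
  finally show "emeasure (tilt t) (space (tilt t)) = 1" by simp
qed

text \<open>Outside a large interval \<open>{-R..R}\<close> the potential is strongly convex; replacing it inside
  by the parabola with the same slope at \<open>R\<close> changes it by a bounded amount. Since \<open>V'\<close> is
  convex with \<open>V' 0 = 0\<close>, the slope \<open>V' R / R\<close> of the chord bounds all later slopes of \<open>V'\<close>.\<close>

lemma strongly_convex_minorant:
  "\<exists>Vc Vc' c B. 0 < c \<and> (\<forall>x. (Vc has_real_derivative Vc' x) (at x)) \<and>
     (\<forall>x y. Vc x + Vc' x * (y - x) + c / 2 * (y - x)\<^sup>2 \<le> Vc y) \<and> (\<forall>x. \<bar>Vc x - V x\<bar> \<le> B)"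
proof -
  obtain R where R: "0 < R" "1 * R \<le> V' R" using superlinear by blast
  define c where "c = V' R / R"
  have c: "0 < c" using R by (auto simp: c_def intro!: divide_pos_pos)
  have cR: "c * R = V' R" using R by (simp add: c_def)
  define P where "P x = c * x\<^sup>2 / 2 + (V R - c * R\<^sup>2 / 2)" for x
  define Vc where "Vc x = (if x \<in> {-R..R} then P x else V x)" for x
  define Vc' where "Vc' x = (if x \<in> {-R..R} then c * x else V' x)" for x
  have Pd: "(P has_real_derivative c * x) (at x)" for x
    unfolding P_def by (auto intro!: derivative_eq_intros)
  have bd: "x = R \<or> x = - R" if "x \<in> closure {-R..R}" "x \<in> closure (- {-R..R})" for x
  proof -
    have "x \<in> {-R..R}" using that(1) by simp
    moreover have "x \<notin> {-R<..<R}"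
      using that(2) by (simp add: closure_complement interior_atLeastAtMost_real)
    ultimately show ?thesis by auto
  qed
  have d: "(Vc has_real_derivative Vc' x) (at x)" for x
  proof -
    have "((\<lambda>x. if x \<in> {-R..R} then P x else V x) has_derivative
       (if x \<in> {-R..R} then (\<lambda>h. (c * x) * h) else (\<lambda>h. V' x * h))) (at x within ({-R..R} \<union> - {-R..R}))"
    proof (rule has_derivative_If_within_closures)
      show "(P has_derivative (\<lambda>h. (c * x) * h)) (at x within X)" for X
        using has_field_derivative_at_within[OF Pd] by (simp add: has_field_derivative_def)
      show "(V has_derivative (\<lambda>h. V' x * h)) (at x within X)" for X
        using has_field_derivative_at_within[OF V'] by (simp add: has_field_derivative_def)
      show "P x = V x" if "x \<in> closure {-R..R}" "x \<in> closure (- {-R..R})"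
        using bd[OF that] by (auto simp: P_def V_even)
      show "(\<lambda>h. (c * x) * h) = (\<lambda>h. V' x * h)" if "x \<in> closure {-R..R}" "x \<in> closure (- {-R..R})"
        using bd[OF that] cR by (auto simp: V'_odd)
    qed auto
    then have "(Vc has_derivative (if x \<in> {-R..R} then (\<lambda>h. (c * x) * h) else (\<lambda>h. V' x * h))) (at x)"
      by (simp add: Vc_def[abs_def])
    then show ?thesis
      unfolding has_field_derivative_def
      by (cases "x \<in> {-R..R}") (simp_all only: Vc'_def if_True if_False)
  qed
  have V'ge: "c * x \<le> V' x" if "R \<le> x" for x
    using V'_linear_growth[OF R(1) that] by (simp add: c_def)
  have inc: "V' x - c * x \<le> V' y - c * y" if "R \<le> x" "x \<le> y" for x y
  proof -
    have "V' x / x * y \<le> V' y" using V'_linear_growth[of x y] R that by auto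
    moreover have "c * (y - x) \<le> V' x / x * (y - x)"
      using V'ge[OF that(1)] R that by (intro mult_right_mono) (auto simp: field_simps)
    moreover have "V' x / x * y = V' x + V' x / x * (y - x)" using R that by (simp add: field_simps)
    ultimately show ?thesis by (simp add: algebra_simps)
  qed
  define q' where "q' x = Vc' x - c * x" for x
  have odd: "q' (- x) = - q' x" for x by (auto simp: q'_def Vc'_def V'_odd)
  have nn: "0 \<le> q' x" if "0 \<le> x" for x using V'ge[of x] that by (auto simp: q'_def Vc'_def)
  have m0: "q' x \<le> q' y" if "0 \<le> x" "x \<le> y" for x y
    using nn[of y] inc[of x y] that by (auto simp: q'_def Vc'_def)
  have mono: "q' x \<le> q' y" if "x \<le> y" for x y
  proof -
    consider "0 \<le> x" | "x < 0" "0 \<le> y" | "y < 0" by linarith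
    then show ?thesis
    proof cases
      case 1 then show ?thesis using m0 that by blast
    next
      case 2 then show ?thesis using nn[of y] nn[of "- x"] odd[of x] by linarith
    next
      case 3 then show ?thesis using m0[of "- y" "- x"] odd[of x] odd[of y] that by linarith
    qed
  qed
  have "Vc x + Vc' x * (y - x) + c / 2 * (y - x)\<^sup>2 \<le> Vc y" for x y
  proof -
    have "((\<lambda>x. Vc x - c * x\<^sup>2 / 2) has_real_derivative q' x) (at x)" for x
      unfolding q'_def by (auto intro!: derivative_eq_intros d)
    from mono_deriv_above_tangent[of _ q', OF this mono, of x y]
    show ?thesis by (simp add: q'_def power2_eq_square algebra_simps)
  qed
  moreover have "\<exists>B. \<forall>x. \<bar>Vc x - V x\<bar> \<le> B"
  proof -
    have "compact ((\<lambda>x. P x - V x) ` {-R..R})"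
      by (intro compact_continuous_image) (auto simp: P_def intro!: continuous_intros V_cont)
    then obtain B where B: "\<And>x. x \<in> {-R..R} \<Longrightarrow> \<bar>P x - V x\<bar> \<le> B"
      using compact_imp_bounded bounded_real by (metis (no_types, lifting) imageI)
    have "0 \<le> B" using B[of R] R abs_ge_zero order_trans by (metis atLeastAtMost_iff less_eq_real_def neg_le_0_iff_le)
    then show ?thesis using B by (intro exI[of _ B]) (auto simp: Vc_def)
  qed
  ultimately show ?thesis using c d by blast
qed

text \<open>A log-Sobolev inequality for all tilts with one constant. Bounded derivatives make the right side
  integrable.\<close>

definition tilt_log_sobolev :: "real \<Rightarrow> bool" where
  "tilt_log_sobolev \<kappa> \<longleftrightarrow> \<kappa> > 0 \<and> (\<forall>t f f'. (\<forall>x. (f has_real_derivative f' x) (at x)) \<longrightarrow> continuous_on UNIV f' \<longrightarrow>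
     pos_bounded (tilt t) f \<longrightarrow> bounded (range f') \<longrightarrow>
     ent (tilt t) f \<le> \<kappa> * (LINT x|tilt t. (f' x)\<^sup>2 / f x))"

lemma tilt_log_sobolevD:
  assumes "tilt_log_sobolev \<kappa>" "\<And>x. (f has_real_derivative f' x) (at x)" "continuous_on UNIV f'"
    "pos_bounded (tilt t) f" "bounded (range f')"
  shows "ent (tilt t) f \<le> \<kappa> * (LINT x|tilt t. (f' x)\<^sup>2 / f x)"
  using assms unfolding tilt_log_sobolev_def by blast

text \<open>The bounded perturbation does not depend on the tilt, which only adds a linear term to the
  strongly convex part.\<close>

lemma log_sobolev_tilt: "\<exists>\<kappa>. tilt_log_sobolev \<kappa>"
proof -
  obtain Vc Vc' c B where c: "0 < c" and d: "\<And>x. (Vc has_real_derivative Vc' x) (at x)"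
    and conv: "\<And>x y. Vc x + Vc' x * (y - x) + c / 2 * (y - x)\<^sup>2 \<le> Vc y" and B: "\<And>x. \<bar>Vc x - V x\<bar> \<le> B"
    using strongly_convex_minorant by blast
  have Vcc: "continuous_on UNIV Vc" using d DERIV_isCont continuous_at_imp_continuous_on by blast
  have [measurable]: "Vc \<in> borel_measurable borel" using Vcc by (rule borel_measurable_continuous_onI)
  define K where "K = exp (4 * B) / (2 * c)"
  have "ent (tilt t) f \<le> K * (LINT x|tilt t. (f' x)\<^sup>2 / f x)"
    if f': "\<And>x. (f has_real_derivative f' x) (at x)" and f'c: "continuous_on UNIV f'"
      and f: "pos_bounded (tilt t) f" and f'b: "bounded (range f')" for t f f'
  proof -
    define Z where "Z = (LINT x|lborel. exp (t * x - Vc x))"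
    define ZV where "ZV = (LINT x|lborel. exp (- V x))"
    have ZV: "0 < ZV" using Z_pos by (simp add: ZV_def)
    have iV: "integrable lborel (\<lambda>x. exp (t * x - V x))" using integrable_exp_V[of 0 t] by simp
    have ub: "exp (t * x - Vc x) \<le> exp B * exp (t * x - V x)" for x
      using B[of x] by (simp add: mult_exp_exp abs_le_iff)
    have lb: "exp (t * x - V x) \<le> exp B * exp (t * x - Vc x)" for x
      using B[of x] by (simp add: mult_exp_exp abs_le_iff)
    have ic: "integrable lborel (\<lambda>x. exp (t * x - Vc x))"
      by (rule Bochner_Integration.integrable_bound[OF integrable_mult_right[OF iV, of "exp B"]]) (use ub in auto)
    have LV: "L t = (LINT x|lborel. exp (t * x - V x)) / ZV"
      unfolding L_def by (subst integral_alpha) (auto simp: rho_def ZV_def[symmetric] mult_exp_exp)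
    have "(LINT x|lborel. exp (t * x - Vc x)) \<le> (LINT x|lborel. exp B * exp (t * x - V x))"
      by (intro integral_mono ic integrable_mult_right iV ub)
    then have Z1: "Z \<le> exp B * (L t * ZV)" using ZV by (simp add: Z_def LV)
    have "(LINT x|lborel. exp (t * x - V x)) \<le> (LINT x|lborel. exp B * exp (t * x - Vc x))"
      by (intro integral_mono ic integrable_mult_right iV lb)
    then have Z2: "L t * ZV \<le> exp B * Z" using ZV by (simp add: Z_def LV)
    have LZ: "0 < L t * ZV" using L_pos ZV by simp
    have Z: "0 < Z" using Z2 LZ zero_less_mult_pos[of "exp B" Z] by simp
    define U where "U x = Vc x - t * x + ln Z" for x
    define U' where "U' x = Vc' x - t" for x
    define M where "M = density lborel (\<lambda>x. ennreal (exp (- U x)))"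
    have [measurable]: "U \<in> borel_measurable borel" unfolding U_def by measurable
    have eU: "exp (- U x) = exp (t * x - Vc x) / Z" for x
      using Z by (simp add: U_def exp_diff exp_minus divide_inverse exp_add)
    have M: "prob_space M"
    proof
      have "emeasure M UNIV = (\<integral>\<^sup>+x. ennreal (exp (t * x - Vc x) / Z) \<partial>lborel)"
        by (simp add: M_def emeasure_density eU)
      also have "\<dots> = ennreal (LINT x|lborel. exp (t * x - Vc x) / Z)"
        using ic Z by (intro nn_integral_eq_integral) auto
      also have "(LINT x|lborel. exp (t * x - Vc x) / Z) = 1" using Z by (simp add: Z_def)
      finally show "emeasure M (space M) = 1" by (simp add: M_def)
    qed
    define h where "h x = exp (Vc x - V x) * (Z / (L t * ZV))" for x
    have hm[measurable]: "h \<in> borel_measurable borel" unfolding h_def by measurable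
    have hpos: "0 \<le> h x" for x using Z LZ by (simp add: h_def)
    have Zq: "Z / (L t * ZV) \<le> exp B" "exp (- B) \<le> Z / (L t * ZV)"
      using Z1 Z2 LZ by (simp_all add: divide_le_eq pos_le_divide_eq exp_minus field_simps)
    have hB: "h x \<le> exp (2 * B)" for x
    proof -
      have "h x \<le> exp B * exp B"
        unfolding h_def using B[of x] Zq Z LZ by (intro mult_mono) (auto simp: abs_le_iff)
      then show ?thesis by (simp add: mult_exp_exp)
    qed
    have hb: "exp (- 2 * B) \<le> h x" for x
    proof -
      have "exp (- B) * exp (- B) \<le> h x"
        unfolding h_def using B[of x] Zq by (intro mult_mono) (auto simp: abs_le_iff)
      then show ?thesis by (simp add: mult_exp_exp)
    qed
    have tM: "tilt t = density M (\<lambda>x. ennreal (h x))"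
    proof -
      have "rho x * (exp (t * x) / L t) = exp (- U x) * h x" for x
      proof -
        have "exp (- U x) * h x = exp (t * x - Vc x) * exp (Vc x - V x) / (L t * ZV)"
          using Z by (simp add: eU h_def)
        also have "exp (t * x - Vc x) * exp (Vc x - V x) = exp (t * x) * exp (- V x)"
          by (simp add: mult_exp_exp)
        finally show ?thesis by (simp add: rho_def ZV_def mult_ac)
      qed
      then show ?thesis
        unfolding tilt_eq M_def using hpos
        by (subst density_density_eq) (auto simp: ennreal_mult')
    qed
    have fM: "pos_bounded M f" using f by (auto simp: pos_bounded_def M_def)
    obtain e where e: "0 < e" "\<And>x. e \<le> f x" using fM by (auto simp: pos_bounded_def M_def)
    obtain C where C: "\<And>x. \<bar>f' x\<bar> \<le> C" using f'b by (auto simp: bounded_iff)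
    have [measurable]: "f \<in> borel_measurable borel" "f' \<in> borel_measurable borel"
      using pos_bounded_measurable[OF f] f'c by (auto intro: borel_measurable_continuous_onI)
    have g0: "0 \<le> (f' x)\<^sup>2 / f x" for x using e(1) e(2)[of x] by simp
    have gb: "\<bar>(f' x)\<^sup>2 / f x\<bar> \<le> C\<^sup>2 / e" for x
    proof -
      have "(f' x)\<^sup>2 \<le> C\<^sup>2" using C[of x] by (metis abs_le_square_iff abs_of_nonneg abs_ge_zero order_trans)
      then have "(f' x)\<^sup>2 / f x \<le> C\<^sup>2 / e" using e(1) e(2)[of x] by (intro frac_le) auto
      then show ?thesis using g0[of x] by simp
    qed
    interpret M: prob_space M by (rule M)
    have gi: "integrable M (\<lambda>x. (f' x)\<^sup>2 / f x)"
      by (rule integrable_bounded[OF M.finite_measure_axioms _ gb]) (simp add: M_def)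
    have Ud: "(U has_real_derivative U' x) (at x)" for x
      unfolding U_def U'_def by (auto intro!: derivative_eq_intros d)
    have Uc: "U x + U' x * (y - x) + c / 2 * (y - x)\<^sup>2 \<le> U y" for x y
      using conv[of x y] by (simp add: U_def U'_def algebra_simps)
    have "ent (tilt t) f \<le> exp (2 * B) * ent M f"
      unfolding tM by (rule ent_density_le) (use M hpos hB fM prob_space_tilt[of t] tM in \<open>auto simp: M_def\<close>)
    also have "\<dots> \<le> exp (2 * B) * (1 / (2 * c) * (LINT x|M. (f' x)\<^sup>2 / f x))"
      using log_sobolev_real[OF M[unfolded M_def] c Ud Uc f' f'c fM[unfolded M_def] gi[unfolded M_def]]
      by (intro mult_left_mono) (auto simp: M_def)
    also have "(LINT x|M. (f' x)\<^sup>2 / f x) \<le> (LINT x|M. exp (2 * B) * (h x * ((f' x)\<^sup>2 / f x)))"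
    proof (rule integral_mono[OF gi])
      have "integrable M (\<lambda>x. h x * ((f' x)\<^sup>2 / f x))"
      proof (rule integrable_bounded[OF M.finite_measure_axioms, of _ "exp (2 * B) * (C\<^sup>2 / e)"])
        show "\<bar>h x * ((f' x)\<^sup>2 / f x)\<bar> \<le> exp (2 * B) * (C\<^sup>2 / e)" for x
          unfolding abs_mult using hB[of x] hpos[of x] gb[of x] by (intro mult_mono) auto
      qed (simp add: M_def)
      then show "integrable M (\<lambda>x. exp (2 * B) * (h x * ((f' x)\<^sup>2 / f x)))" by (rule integrable_mult_right)
      fix x
      have "exp (2 * B) * exp (- 2 * B) \<le> exp (2 * B) * h x" using hb by (intro mult_left_mono) auto
      then have "1 \<le> exp (2 * B) * h x" by (simp add: mult_exp_exp)
      from mult_right_mono[OF this g0[of x]]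
      show "(f' x)\<^sup>2 / f x \<le> exp (2 * B) * (h x * ((f' x)\<^sup>2 / f x))" by (simp add: mult.assoc)
    qed
    also have "(LINT x|M. exp (2 * B) * (h x * ((f' x)\<^sup>2 / f x))) = exp (2 * B) * (LINT x|tilt t. (f' x)\<^sup>2 / f x)"
    proof -
      have "(LINT x|tilt t. (f' x)\<^sup>2 / f x) = (LINT x|M. h x * ((f' x)\<^sup>2 / f x))"
        unfolding tM using hpos by (subst integral_density) (auto simp: M_def)
      then show ?thesis by (simp only: integral_mult_right_zero)
    qed
    finally have "ent (tilt t) f \<le> exp (2 * B) * (1 / (2 * c) * (exp (2 * B) * (LINT x|tilt t. (f' x)\<^sup>2 / f x)))"
      using c by (simp add: mult_left_mono divide_right_mono)
    also have "exp (2 * B) * (1 / (2 * c) * (exp (2 * B) * I)) = K * I" for I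
    proof -
      have "exp (4 * B) = exp (2 * B) * exp (2 * B)" by (simp add: mult_exp_exp)
      then show ?thesis by (simp add: K_def)
    qed
    finally show ?thesis .
  qed
  moreover have "0 < K" using c by (simp add: K_def)
  ultimately have "tilt_log_sobolev K" unfolding tilt_log_sobolev_def by blast
  then show ?thesis by blast
qed

end

section \<open>The critical temperature is the variance of the single-particle measure\<close>

abbreviation (input) attraction :: "real \<Rightarrow> real \<Rightarrow> real" where
  "attraction \<equiv> (\<lambda>x y. - (x * y))"

lemma lebesgue_density_density:
  fixes g :: "real \<Rightarrow> real"
  assumes [measurable]: "g \<in> borel_measurable borel" and g: "\<And>x. 0 \<le> g x"
  shows "AE x in lborel. lebesgue_density (density lborel (\<lambda>x. ennreal (g x))) x = g x"
proof -
  have "AE x in lborel. ennreal (g x) = RN_deriv lborel (density lborel (\<lambda>x. ennreal (g x))) x"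
    by (rule sigma_finite_measure.RN_deriv_unique[OF sigma_finite_lborel]) auto
  then show ?thesis
    unfolding lebesgue_density_def by eventually_elim (metis enn2real_ennreal g)
qed

context confinement
begin

text \<open>The Lebesgue densities of the probability measures with finite free energy.\<close>

definition finite_energy :: "(real \<Rightarrow> real) \<Rightarrow> bool" where
  "finite_energy g \<longleftrightarrow> g \<in> borel_measurable borel \<and> (\<forall>x. 0 \<le> g x) \<and>
     integrable lborel g \<and> (LINT x|lborel. g x) = 1 \<and>
     integrable lborel (\<lambda>x. g x * ln (g x)) \<and> integrable lborel (\<lambda>x. g x * V x) \<and>
     integrable lborel (\<lambda>x. g x * x)"

definition energy :: "real \<Rightarrow> (real \<Rightarrow> real) \<Rightarrow> real" where
  "energy T g = (LINT x|lborel. g x * ln (g x)) + (LINT x|lborel. g x * V x)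
     - (LINT x|lborel. g x * x)\<^sup>2 / (2 * T)"

lemma finite_energyD:
  assumes "finite_energy g"
  shows "g \<in> borel_measurable borel" "\<And>x. 0 \<le> g x" "integrable lborel g" "(LINT x|lborel. g x) = 1"
    "integrable lborel (\<lambda>x. g x * ln (g x))" "integrable lborel (\<lambda>x. g x * V x)"
    "integrable lborel (\<lambda>x. g x * x)"
  using assms by (auto simp: finite_energy_def)

lemma finite_energy_prob:
  assumes g: "finite_energy g"
  shows "density lborel (\<lambda>x. ennreal (g x)) \<in> space (prob_algebra borel)"
proof -
  note g = finite_energyD[OF g]
  have [measurable]: "g \<in> borel_measurable borel" by (rule g)
  have "emeasure (density lborel (\<lambda>x. ennreal (g x))) UNIV = (\<integral>\<^sup>+x. ennreal (g x) \<partial>lborel)"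
    by (simp add: emeasure_density)
  also have "\<dots> = ennreal (LINT x|lborel. g x)" using g by (intro nn_integral_eq_integral) auto
  finally have "prob_space (density lborel (\<lambda>x. ennreal (g x)))" using g(4) by (intro prob_spaceI) simp
  then show ?thesis by (simp add: space_prob_algebra)
qed

lemma free_energy_density:
  assumes g: "finite_energy g"
  shows "free_energy V attraction T (density lborel (\<lambda>x. ennreal (g x))) = ereal (energy T g)"
proof -
  note g' = finite_energyD[OF g]
  have [measurable]: "g \<in> borel_measurable borel" by (rule g')
  define \<rho> where "\<rho> = density lborel (\<lambda>x. ennreal (g x))"
  interpret \<rho>: prob_space \<rho> using finite_energy_prob[OF g] by (simp add: \<rho>_def space_prob_algebra)
  have ac: "absolutely_continuous lborel \<rho>"
    by (auto simp: \<rho>_def intro!: absolutely_continuousI_density)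
  have AE: "AE x in lborel. lebesgue_density \<rho> x = g x"
    unfolding \<rho>_def by (rule lebesgue_density_density) (use g' in auto)
  have [measurable]: "lebesgue_density \<rho> \<in> borel_measurable borel"
    unfolding lebesgue_density_def by (auto cong: measurable_cong_sets)
  have AE': "AE x in lborel. lebesgue_density \<rho> x * ln (lebesgue_density \<rho> x) = g x * ln (g x)"
    using AE by eventually_elim simp
  have i1: "integrable lborel (\<lambda>x. lebesgue_density \<rho> x * ln (lebesgue_density \<rho> x))"
    using AE' g'(5) by (subst integrable_cong_AE[where g="\<lambda>x. g x * ln (g x)"]) auto
  have e1: "(LINT x|lborel. lebesgue_density \<rho> x * ln (lebesgue_density \<rho> x)) = (LINT x|lborel. g x * ln (g x))"
    using AE' by (intro integral_cong_AE) auto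
  have id: "integrable \<rho> h" "(LINT x|\<rho>. h x) = (LINT x|lborel. g x * h x)"
    if "integrable lborel (\<lambda>x. g x * h x)" and [measurable]: "h \<in> borel_measurable borel" for h :: "real \<Rightarrow> real"
    using that g'(2) unfolding \<rho>_def by (simp_all add: integrable_density integral_density)
  have iV: "integrable \<rho> V" and eV: "(LINT x|\<rho>. V x) = (LINT x|lborel. g x * V x)"
    using id[of V] g'(6) by simp_all
  have ix: "integrable \<rho> (\<lambda>x. x)" and ex: "(LINT x|\<rho>. x) = (LINT x|lborel. g x * x)"
    by (rule id(1)[of "\<lambda>x. x", OF g'(7)], simp) (rule id(2)[of "\<lambda>x. x", OF g'(7)], simp)
  have sf: "sigma_finite_measure \<rho>" by (rule \<rho>.sigma_finite_measure_axioms)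
  have iW: "integrable (\<rho> \<Otimes>\<^sub>M \<rho>) (\<lambda>(x, y). - (x * y))"
    and eW: "(LINT (x, y)|(\<rho> \<Otimes>\<^sub>M \<rho>). - (x * y)) = - (LINT x|\<rho>. x)\<^sup>2"
    using integrable_pair_mult[OF sf sf integrable_minus[OF ix] ix] by (simp_all add: power2_eq_square)
  show ?thesis
    using ac i1 iV iW eW unfolding \<rho>_def[symmetric]
    by (simp add: free_energy_def e1 eV energy_def ex[symmetric])
qed

text \<open>Integrability of \<open>x * y\<close> under the product measure forces a finite first moment: almost every
  section is integrable, and a section at some \<open>x \<noteq> 0\<close> is a multiple of \<open>y\<close>.\<close>

lemma finite_free_energyE:
  assumes \<rho>: "\<rho> \<in> space (prob_algebra borel)" and fin: "free_energy V attraction T \<rho> \<noteq> \<infinity>"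
  obtains g where "finite_energy g" "\<rho> = density lborel (\<lambda>x. ennreal (g x))"
proof -
  have s[measurable_cong, simp]: "sets \<rho> = sets borel" and P: "prob_space \<rho>" using \<rho> by (auto simp: space_prob_algebra)
  interpret \<rho>: prob_space \<rho> by (rule P)
  define g where "g = lebesgue_density \<rho>"
  have ac: "absolutely_continuous lborel \<rho>" and i1: "integrable lborel (\<lambda>x. g x * ln (g x))"
    and iV: "integrable \<rho> V" and iW: "integrable (\<rho> \<Otimes>\<^sub>M \<rho>) (\<lambda>(x, y). - (x * y))"
    using fin by (auto simp: free_energy_def g_def split: if_splits)
  have gm[measurable]: "g \<in> borel_measurable borel"
    unfolding g_def lebesgue_density_def by (auto cong: measurable_cong_sets)
  have g0: "0 \<le> g x" for x by (simp add: g_def lebesgue_density_def)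
  have "AE x in lborel. RN_deriv lborel \<rho> x \<noteq> \<infinity>"
    by (rule sigma_finite_measure.RN_deriv_finite[OF sigma_finite_lborel]) (use ac \<rho>.sigma_finite_measure_axioms in auto)
  then have AE: "AE x in lborel. RN_deriv lborel \<rho> x = ennreal (g x)"
    unfolding g_def lebesgue_density_def by eventually_elim (simp add: less_top)
  have "density lborel (RN_deriv lborel \<rho>) = \<rho>"
    by (rule sigma_finite_measure.density_RN_deriv[OF sigma_finite_lborel]) (use ac in auto)
  then have \<rho>g: "\<rho> = density lborel (\<lambda>x. ennreal (g x))"
    using density_cong[OF _ _ AE] by simp
  have id: "integrable \<rho> h \<longleftrightarrow> integrable lborel (\<lambda>x. g x * h x)"
     "(LINT x|\<rho>. h x) = (LINT x|lborel. g x * h x)"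
    if [measurable]: "h \<in> borel_measurable borel" for h :: "real \<Rightarrow> real"
    using that g0 by (simp_all add: \<rho>g integrable_density integral_density)
  interpret pair: pair_sigma_finite \<rho> \<rho> by standard
  have ix: "integrable \<rho> (\<lambda>x. x)"
  proof -
    from pair.AE_integrable_fst'[OF iW]
    have "AE x in \<rho>. integrable \<rho> (\<lambda>y. - (x * y))" by simp
    moreover have "AE x in \<rho>. x \<noteq> 0"
    proof -
      have "AE x in lborel. x \<noteq> (0::real)" by (rule AE_lborel_singleton)
      then show ?thesis unfolding \<rho>g by (subst AE_density) (auto elim: eventually_mono)
    qed
    ultimately have "AE x in \<rho>. integrable \<rho> (\<lambda>y::real. y)"
    proof eventually_elim
      case (elim x)
      from integrable_mult_right[OF elim(1), of "- 1 / x"] elim(2) show ?case by simp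
    qed
    then show ?thesis by simp
  qed
  have "finite_energy g"
    unfolding finite_energy_def
  proof (intro conjI allI)
    show "integrable lborel g" using id(1)[of "\<lambda>_. 1"] by simp
    show "(LINT x|lborel. g x) = 1" using id(2)[of "\<lambda>_. 1"] \<rho>.prob_space by simp
    show "integrable lborel (\<lambda>x. g x * V x)" using id(1)[of V] iV by simp
    show "integrable lborel (\<lambda>x. g x * x)" by (rule id(1)[of "\<lambda>x. x", THEN iffD1, OF _ ix]) simp
  qed (use g0 i1 in auto)
  with \<rho>g show ?thesis using that by blast
qed

definition logZ :: real where "logZ = ln (LINT x|lborel. exp (- V x))"

text \<open>The Lebesgue density of the tilted single-particle measure.\<close>

definition tau :: "real \<Rightarrow> real \<Rightarrow> real" where "tau t x = rho x * (exp (t * x) / L t)"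

lemma tau_pos: "0 < tau t x"
  using rho_pos L_pos by (simp add: tau_def)

lemma tau_measurable[measurable]: "tau t \<in> borel_measurable borel"
  unfolding tau_def by measurable

lemma ln_tau: "ln (tau t x) = t * x - V x - logZ - p t"
  using Z_pos L_pos[of t] by (simp add: tau_def rho_def ln_mult ln_div logZ_def p_def)

lemma finite_energy_tau:
  "finite_energy (tau t)"
  "(LINT x|lborel. tau t x * x) = p' t"
  "energy T (tau t) = t * p' t - p t - logZ - (p' t)\<^sup>2 / (2 * T)"
proof -
  have i1: "integrable lborel (tau t)" and e1: "(LINT x|lborel. tau t x) = 1"
  proof -
    have "integrable lborel (\<lambda>x. rho x * exp (t * x))" "(LINT x|lborel. rho x * exp (t * x)) = L t"
      using integrable_alpha_exp[of t] by (simp_all add: integrable_alpha_iff integral_alpha L_def)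
    then show "integrable lborel (tau t)" "(LINT x|lborel. tau t x) = 1"
      using L_pos[of t] by (simp_all add: tau_def[abs_def])
  qed
  have ix: "integrable lborel (\<lambda>x. tau t x * x)" and ex: "(LINT x|lborel. tau t x * x) = p' t"
  proof -
    have "integrable lborel (\<lambda>x. rho x * (x * exp (t * x)))" "(LINT x|lborel. rho x * (x * exp (t * x))) = L1 t"
      using integrable_alpha_x_exp[of t] by (simp_all add: integrable_alpha_iff integral_alpha L1_def)
    then have "integrable lborel (\<lambda>x. rho x * (x * exp (t * x)) / L t)" "(LINT x|lborel. rho x * (x * exp (t * x)) / L t) = p' t"
      by (simp_all add: p'_def)
    moreover have "(\<lambda>x. rho x * (x * exp (t * x)) / L t) = (\<lambda>x. tau t x * x)"
      by (simp add: tau_def[abs_def] mult_ac)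
    ultimately show "integrable lborel (\<lambda>x. tau t x * x)" "(LINT x|lborel. tau t x * x) = p' t"
      by simp_all
  qed
  have iV: "integrable lborel (\<lambda>x. tau t x * V x)"
  proof -
    obtain b where b: "\<And>x. 2 * x\<^sup>2 - b \<le> V x" using V_lower_bound by blast
    define K where "K = 1 / ((LINT y|lborel. exp (- V y)) * L t)"
    have K: "0 < K" using Z_pos L_pos[of t] by (simp add: K_def)
    have tK: "tau t x = K * exp (t * x - V x)" for x
      by (simp add: tau_def rho_def K_def mult_exp_exp)
    have j1: "integrable lborel (\<lambda>x. 2 * exp (b / 2) * exp (t * x - 2 * x\<^sup>2 / 2) + 2 * \<bar>b\<bar> * exp (t * x - V x))"
      using has_bochner_integral_gaussian[of 2 t] integrable_exp_V[of 0 t]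
      by (intro Bochner_Integration.integrable_add integrable_mult_right) (auto simp: has_bochner_integral_iff)
    have "integrable lborel (\<lambda>x. exp (t * x - V x) * V x)"
    proof (rule Bochner_Integration.integrable_bound[OF j1])
      have "\<bar>exp (t * x - V x) * V x\<bar> \<le> 2 * exp (b / 2) * exp (t * x - 2 * x\<^sup>2 / 2) + 2 * \<bar>b\<bar> * exp (t * x - V x)" for x
      proof -
        have "V x / 2 \<le> exp (V x / 2)" using exp_ge_add_one_self[of "V x / 2"] by linarith
        moreover have "- b \<le> V x" using b[of x] by (smt (verit) zero_le_power2)
        ultimately have "\<bar>V x\<bar> \<le> 2 * exp (V x / 2) + 2 * \<bar>b\<bar>" using exp_gt_zero[of "V x / 2"] by linarith
        then have "exp (t * x - V x) * \<bar>V x\<bar> \<le> exp (t * x - V x) * (2 * exp (V x / 2) + 2 * \<bar>b\<bar>)"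
          by (intro mult_left_mono) auto
        also have "\<dots> = 2 * exp (t * x - V x / 2) + 2 * \<bar>b\<bar> * exp (t * x - V x)"
        proof -
          have "exp (t * x - V x) * exp (V x / 2) = exp (t * x - V x / 2)" by (simp add: mult_exp_exp)
          then show ?thesis by (simp add: distrib_left)
        qed
        also have "exp (t * x - V x / 2) \<le> exp (b / 2) * exp (t * x - 2 * x\<^sup>2 / 2)"
          unfolding mult_exp_exp using b[of x] by simp
        finally show ?thesis by (simp add: abs_mult)
      qed
      then show "AE x in lborel. norm (exp (t * x - V x) * V x) \<le> norm (2 * exp (b / 2) * exp (t * x - 2 * x\<^sup>2 / 2) + 2 * \<bar>b\<bar> * exp (t * x - V x))"
        by (intro AE_I2) (simp only: real_norm_def, rule order_trans[OF _ abs_ge_self])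
    qed simp
    from integrable_mult_right[OF this, of K] show ?thesis by (simp add: tK mult.assoc)
  qed
  have l: "tau t x * ln (tau t x) = t * (tau t x * x) - tau t x * V x - (logZ + p t) * tau t x" for x
    by (simp add: ln_tau algebra_simps)
  have il: "integrable lborel (\<lambda>x. tau t x * ln (tau t x))"
    unfolding l using i1 ix iV by (intro Bochner_Integration.integrable_diff integrable_mult_right)
  have el: "(LINT x|lborel. tau t x * ln (tau t x)) = t * p' t - (LINT x|lborel. tau t x * V x) - (logZ + p t)"
    unfolding l using i1 ix iV by (simp add: ex e1)
  show "finite_energy (tau t)"
    unfolding finite_energy_def using tau_pos[of t] i1 e1 il iV ix by (auto simp: less_imp_le)
  show "(LINT x|lborel. tau t x * x) = p' t" by (rule ex)
  show "energy T (tau t) = t * p' t - p t - logZ - (p' t)\<^sup>2 / (2 * T)"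
    by (simp add: energy_def el ex)
qed

text \<open>The entropy of \<open>g\<close> relative to a tilted measure is nonnegative, and it vanishes only if
  \<open>g\<close> is the tilted density.\<close>

lemma energy_ge:
  assumes g: "finite_energy g"
  defines "m \<equiv> LINT x|lborel. g x * x"
  shows "t * m - p t - logZ - m\<^sup>2 / (2 * T) \<le> energy T g"
    and "t * m - p t - logZ - m\<^sup>2 / (2 * T) = energy T g \<Longrightarrow> AE x in lborel. g x = tau t x"
proof -
  note g' = finite_energyD[OF g]
  have [measurable]: "g \<in> borel_measurable borel" by (rule g')
  note tau = finite_energyD[OF finite_energy_tau(1)[of t]]
  define D where "D x = g x * ln (g x) - g x * ln (tau t x) - g x + tau t x" for x
  have D0: "0 \<le> D x" for x
    using mult_ln_tangent[of "g x" "tau t x"] tau_pos[of t x] g'(2)[of x]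
    by (cases "g x = 0") (auto simp: D_def)
  have gl: "g x * ln (tau t x) = t * (g x * x) - g x * V x - (logZ + p t) * g x" for x
    by (simp add: ln_tau algebra_simps)
  have il: "integrable lborel (\<lambda>x. g x * ln (tau t x))"
    unfolding gl using g' by (intro Bochner_Integration.integrable_diff integrable_mult_right)
  have el: "(LINT x|lborel. g x * ln (tau t x)) = t * m - (LINT x|lborel. g x * V x) - (logZ + p t)"
    unfolding gl using g' by (simp add: m_def)
  have iD: "integrable lborel D"
    unfolding D_def using g' il tau by (intro Bochner_Integration.integrable_add Bochner_Integration.integrable_diff)
  have eD: "(LINT x|lborel. D x) = energy T g - (t * m - p t - logZ - m\<^sup>2 / (2 * T))"
    unfolding D_def using g' il tau by (simp add: energy_def el m_def[symmetric])
  have "0 \<le> (LINT x|lborel. D x)" using D0 by simp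
  then show "t * m - p t - logZ - m\<^sup>2 / (2 * T) \<le> energy T g" using eD by simp
  assume "t * m - p t - logZ - m\<^sup>2 / (2 * T) = energy T g"
  then have "(LINT x|lborel. D x) = 0" using eD by simp
  then have "AE x in lborel. D x = 0" using integral_nonneg_eq_0_iff_AE[OF iD] D0 by auto
  then show "AE x in lborel. g x = tau t x"
  proof eventually_elim
    case (elim x)
    show ?case
    proof (cases "g x = 0")
      case True then show ?thesis using elim tau_pos[of t x] by (simp add: D_def)
    next
      case False
      then have gp: "0 < g x" using g'(2)[of x] by simp
      have tp: "0 < tau t x" by (rule tau_pos)
      have "ln (tau t x / g x) = tau t x / g x - 1"
        using elim gp tp by (simp add: D_def ln_div field_simps)
      then have "tau t x / g x = 1" using gp tp by (intro ln_eq_minus_one) auto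
      then show ?thesis using gp by simp
    qed
  qed
qed

lemma tau_0: "tau 0 = rho"
  by (simp add: tau_def[abs_def] L_0)

lemma alpha_tau: "alpha V = density lborel (\<lambda>x. ennreal (tau 0 x))"
  by (simp add: alpha_eq tau_0)

text \<open>Compare with the tilt by \<open>m / T\<close>, where \<open>m\<close> is the mean: the energy exceeds the energy of
  \<open>alpha V\<close> by at least \<open>(T - sigma2) m\<^sup>2 / (2 T\<^sup>2)\<close>.\<close>

lemma unique_minimiser_above:
  assumes T: "sigma2 < T"
  shows "unique_minimiser V attraction T"
proof -
  have Tpos: "0 < T" using T sigma2_pos by linarith
  have aP: "alpha V \<in> space (prob_algebra borel)"
    unfolding alpha_tau by (rule finite_energy_prob[OF finite_energy_tau(1)])
  have aE: "free_energy V attraction T (alpha V) = ereal (- logZ)"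
    unfolding alpha_tau free_energy_density[OF finite_energy_tau(1)] finite_energy_tau(3)
    by (simp add: p_0 p'_0)
  have lower: "- logZ \<le> energy T g" and eq: "energy T g \<le> - logZ \<Longrightarrow> AE x in lborel. g x = tau 0 x"
    if g: "finite_energy g" for g
  proof -
    define m where "m = (LINT x|lborel. g x * x)"
    have "p (m / T) \<le> sigma2 / 2 * (m / T)\<^sup>2" by (rule p_le)
    then have "(T - sigma2) * m\<^sup>2 / (2 * T\<^sup>2) \<le> m / T * m - p (m / T) - m\<^sup>2 / (2 * T)"
      using Tpos by (simp add: power2_eq_square field_simps)
    also have "\<dots> \<le> energy T g + logZ"
      using energy_ge(1)[OF g, of "m / T" T] by (simp add: m_def)
    finally have *: "(T - sigma2) * m\<^sup>2 / (2 * T\<^sup>2) \<le> energy T g + logZ" .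
    have "0 \<le> (T - sigma2) * m\<^sup>2 / (2 * T\<^sup>2)" using T by simp
    then show "- logZ \<le> energy T g" using * by linarith
    assume le: "energy T g \<le> - logZ"
    then have "(T - sigma2) * m\<^sup>2 / (2 * T\<^sup>2) \<le> 0" using * by linarith
    then have "m \<le> 0 \<and> 0 \<le> m"
      using T Tpos by (simp add: divide_le_0_iff mult_le_0_iff not_less power2_eq_square) linarith
    then have m0: "m = 0" by linarith
    have "energy T g = - logZ" using le \<open>- logZ \<le> energy T g\<close> by linarith
    then show "AE x in lborel. g x = tau 0 x"
      using m0 by (intro energy_ge(2)[OF g, of 0 T]) (simp add: m_def[symmetric] p_0)
  qed
  show ?thesis
    unfolding unique_minimiser_def
  proof (rule ex1I[of _ "alpha V"])
    show "is_arg_min (free_energy V attraction T) (\<lambda>\<rho>. \<rho> \<in> space (prob_algebra borel)) (alpha V)"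
      unfolding is_arg_min_def
    proof (intro conjI aP notI)
      assume "\<exists>\<rho>. \<rho> \<in> space (prob_algebra borel) \<and> free_energy V attraction T \<rho> < free_energy V attraction T (alpha V)"
      then obtain \<rho> where \<rho>: "\<rho> \<in> space (prob_algebra borel)" "free_energy V attraction T \<rho> < ereal (- logZ)"
        by (auto simp: aE)
      then have "free_energy V attraction T \<rho> \<noteq> \<infinity>" by auto
      from finite_free_energyE[OF \<rho>(1) this] obtain g where
        g: "finite_energy g" "\<rho> = density lborel (\<lambda>x. ennreal (g x))" .
      show False using \<rho>(2) lower[OF g(1)] free_energy_density[OF g(1), of T] by (simp add: g(2))
    qed
    fix \<rho> assume "is_arg_min (free_energy V attraction T) (\<lambda>\<rho>. \<rho> \<in> space (prob_algebra borel)) \<rho>"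
    then have \<rho>: "\<rho> \<in> space (prob_algebra borel)" "\<not> free_energy V attraction T (alpha V) < free_energy V attraction T \<rho>"
      using aP by (auto simp: is_arg_min_def)
    then have "free_energy V attraction T \<rho> \<noteq> \<infinity>" by (auto simp: aE)
    from finite_free_energyE[OF \<rho>(1) this] obtain g where
      g: "finite_energy g" "\<rho> = density lborel (\<lambda>x. ennreal (g x))" .
    have "energy T g \<le> - logZ" using \<rho>(2) free_energy_density[OF g(1), of T] by (simp add: g(2) aE)
    from eq[OF g(1) this] show "\<rho> = alpha V"
      unfolding g(2) alpha_tau using finite_energyD(1)[OF g(1)]
      by (intro density_cong) (auto elim: eventually_mono)
  qed
qed

text \<open>Below the variance a unique minimiser would be invariant under reflection, hence centred,
  and a centred measure has at least the energy of \<open>alpha V\<close>. But a slightly tilted measure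
  has less.\<close>

lemma not_unique_minimiser_below:
  assumes T: "0 < T" "T < sigma2"
  shows "\<not> unique_minimiser V attraction T"
proof
  assume "unique_minimiser V attraction T"
  then obtain \<rho> where min: "is_arg_min (free_energy V attraction T) (\<lambda>\<rho>. \<rho> \<in> space (prob_algebra borel)) \<rho>"
    and uniq: "\<And>\<rho>'. is_arg_min (free_energy V attraction T) (\<lambda>\<rho>. \<rho> \<in> space (prob_algebra borel)) \<rho>' \<Longrightarrow> \<rho>' = \<rho>"
    unfolding unique_minimiser_def by blast
  have \<rho>P: "\<rho> \<in> space (prob_algebra borel)" using min by (simp add: is_arg_min_def)
  have le: "free_energy V attraction T \<rho> \<le> free_energy V attraction T \<rho>'" if "\<rho>' \<in> space (prob_algebra borel)" for \<rho>'
    using min that by (auto simp: is_arg_min_def not_less)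
  have le_tau: "free_energy V attraction T \<rho> \<le> ereal (energy T (tau t))" for t
    using le[OF finite_energy_prob[OF finite_energy_tau(1)[of t]]] free_energy_density[OF finite_energy_tau(1)[of t], of T] by simp
  have "free_energy V attraction T \<rho> \<noteq> \<infinity>" using le_tau[of 0] by auto
  from finite_free_energyE[OF \<rho>P this] obtain g where
    g: "finite_energy g" and \<rho>g: "\<rho> = density lborel (\<lambda>x. ennreal (g x))" .
  note g' = finite_energyD[OF g]
  have [measurable]: "g \<in> borel_measurable borel" by (rule g')
  define h where "h x = g (- x)" for x
  have refl: "integrable lborel (\<lambda>x. f (- x))" "(LINT x|lborel. f (- x)) = (LINT x|lborel. f x)"
    if "integrable lborel f" for f :: "real \<Rightarrow> real"
    using lborel_integrable_real_affine[OF that, of "-1" 0] lborel_integral_real_affine[of "-1" f 0] by simp_all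
  have h: "finite_energy h"
    unfolding finite_energy_def h_def
    using g'(2) refl[OF g'(3)] refl[OF g'(5)] refl[OF g'(6)] refl[OF g'(7)] g'(4)
    by (auto simp: V_even)
  have hx: "(LINT x|lborel. h x * x) = - (LINT x|lborel. g x * x)"
    using refl(2)[OF g'(7)] by (simp add: h_def)
  have "energy T h = energy T g"
    using refl(2)[OF g'(5)] refl(2)[OF g'(6)] hx by (simp add: energy_def h_def V_even)
  then have "is_arg_min (free_energy V attraction T) (\<lambda>\<rho>. \<rho> \<in> space (prob_algebra borel)) (density lborel (\<lambda>x. ennreal (h x)))"
    using min finite_energy_prob[OF h] free_energy_density[OF h, of T] free_energy_density[OF g, of T]
    by (simp add: is_arg_min_def \<rho>g)
  from uniq[OF this] have \<rho>h: "\<rho> = density lborel (\<lambda>x. ennreal (h x))" by simp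
  have mean: "(LINT x|\<rho>. x) = (LINT x|lborel. f x * x)"
    if "\<rho> = density lborel (\<lambda>x. ennreal (f x))" "finite_energy f" for f
    using finite_energyD[OF that(2)] unfolding that(1) by (subst integral_density) auto
  have m0: "(LINT x|lborel. g x * x) = 0"
    using mean[OF \<rho>g g] mean[OF \<rho>h h] hx by simp
  have lower: "- logZ \<le> energy T g" using energy_ge(1)[OF g, of 0 T] by (simp add: m0 p_0)
  obtain t where t: "T * t\<^sup>2 / 2 < p t"
  proof -
    \<comment> \<open>With \<open>t\<^sup>2 = 2 * y\<close> the claim follows from \<open>exp (T * y) \<le> 1 + T * y + (T * y)\<^sup>2 < 1 + sigma2 * y \<le> L t\<close>.\<close>
    define y where "y = min (1 / T) ((sigma2 - T) / (2 * T\<^sup>2))"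
    have y: "0 < y" "T * y \<le> 1" "T\<^sup>2 * y < sigma2 - T"
    proof -
      show "0 < y" using T by (simp add: y_def)
      have "T * y \<le> T * (1 / T)" unfolding y_def using T by (intro mult_left_mono) auto
      then show "T * y \<le> 1" using T by simp
      have "T\<^sup>2 * y \<le> T\<^sup>2 * ((sigma2 - T) / (2 * T\<^sup>2))" unfolding y_def by (intro mult_left_mono) auto
      then show "T\<^sup>2 * y < sigma2 - T" using T by simp
    qed
    have "exp (T * y) \<le> 1 + T * y + (T * y)\<^sup>2" using y T by (intro exp_bound) auto
    also have "\<dots> = 1 + y * (T + T\<^sup>2 * y)" by (simp add: power2_eq_square algebra_simps)
    also have "\<dots> < 1 + y * sigma2" using y by (intro add_strict_left_mono mult_strict_left_mono) auto
    also have "\<dots> = 1 + sigma2 / 2 * (sqrt (2 * y))\<^sup>2" using y by simp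
    also have "\<dots> \<le> L (sqrt (2 * y))" by (rule L_ge)
    also have "\<dots> = exp (p (sqrt (2 * y)))" by (simp add: exp_p)
    finally have "T * y < p (sqrt (2 * y))" by simp
    then show thesis using y by (intro that[of "sqrt (2 * y)"]) simp
  qed
  have "energy T (tau t) + logZ = T * t\<^sup>2 / 2 - p t - (p' t - T * t)\<^sup>2 / (2 * T)"
    using T by (simp add: finite_energy_tau(3) power2_eq_square field_simps)
  moreover have "0 \<le> (p' t - T * t)\<^sup>2 / (2 * T)" using T by simp
  ultimately have "energy T (tau t) < - logZ" using t by linarith
  then show False using lower le_tau[of t] free_energy_density[OF g, of T] by (simp add: \<rho>g)
qed

lemma critical_temperature_eq: "critical_temperature V attraction = sigma2"
  unfolding critical_temperature_def
proof (rule cInf_eq_minimum)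
  show "sigma2 \<in> {T. T > 0 \<and> (\<forall>T'>T. unique_minimiser V attraction T')}"
    using sigma2_pos unique_minimiser_above by simp
  fix T assume "T \<in> {T. T > 0 \<and> (\<forall>T'>T. unique_minimiser V attraction T')}"
  then have T: "0 < T" "\<And>T'. T < T' \<Longrightarrow> unique_minimiser V attraction T'" by auto
  show "sigma2 \<le> T"
  proof (rule ccontr)
    assume "\<not> sigma2 \<le> T"
    then obtain T' where "T < T'" "T' < sigma2" using dense by (metis not_le)
    then show False using T not_unique_minimiser_below[of T'] by auto
  qed
qed

end

section \<open>The mean-field measure as a mixture of product measures\<close>

locale high_temperature = confinement +
  fixes N :: nat and T :: real
  assumes N: "1 \<le> N" and T: "sigma2 < T"
begin

lemma T_pos: "0 < T" and N_pos: "0 < real N"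
  using T sigma2_pos N by auto

abbreviation A :: "(nat \<Rightarrow> real) measure" where "A \<equiv> PiM {..<N} (\<lambda>_. alpha V)"
abbreviation Q :: "real \<Rightarrow> (nat \<Rightarrow> real) measure" where "Q t \<equiv> PiM {..<N} (\<lambda>_. tilt t)"
definition S :: "(nat \<Rightarrow> real) \<Rightarrow> real" where "S x = (\<Sum>i<N. x i)"

lemma prob_space_A: "prob_space A"
  by (rule prob_space_PiM) (rule prob_space_alpha)

lemma prob_space_Q: "prob_space (Q t)"
  by (rule prob_space_PiM) (rule prob_space_tilt)

sublocale A: prob_space A by (rule prob_space_A)

lemma sets_Q[measurable_cong]: "sets (Q t) = sets A"
  by (rule sets_PiM_cong) auto

lemma space_A: "space A = Rn N" and space_Q: "space (Q t) = Rn N"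
  by (simp_all add: space_PiM)

lemma S_measurable[measurable]: "S \<in> borel_measurable A"
proof -
  have "(\<lambda>x. x i) \<in> borel_measurable A" if "i < N" for i
  proof -
    have "(\<lambda>x. x i) \<in> measurable A (alpha V)" by (rule measurable_component_singleton) (use that in auto)
    then show ?thesis by (simp cong: measurable_cong_sets)
  qed
  then show ?thesis unfolding S_def by (intro borel_measurable_sum) auto
qed

lemma exp_S: "exp (t * S x) = (\<Prod>i<N. exp (t * x i))"
  by (simp add: S_def sum_distrib_left exp_sum)

lemma integrable_exp_S: "integrable A (\<lambda>x. exp (t * S x))"
  and integral_exp_S: "(LINT x|A. exp (t * S x)) = L t ^ N"
proof -
  interpret P: product_prob_space "\<lambda>_. alpha V" "{..<N}" by (rule product_prob_spaceI) (rule prob_space_alpha)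
  show "integrable A (\<lambda>x. exp (t * S x))"
    unfolding exp_S by (rule P.product_integrable_prod) (use integrable_alpha_exp in auto)
  show "(LINT x|A. exp (t * S x)) = L t ^ N"
    unfolding exp_S by (subst P.product_integral_prod) (use integrable_alpha_exp in \<open>auto simp: L_def\<close>)
qed

lemma Q_eq: "Q t = density A (\<lambda>x. ennreal (exp (t * S x) / L t ^ N))"
proof -
  have "Q t = density A (\<lambda>x. \<Prod>i<N. ennreal (exp (t * x i) / L t))"
    unfolding tilt_def
    by (rule PiM_density) (use prob_space_alpha prob_space_tilt[of t] in \<open>auto simp: tilt_def\<close>)
  also have "(\<lambda>x. \<Prod>i<N. ennreal (exp (t * x i) / L t)) = (\<lambda>x. ennreal (exp (t * S x) / L t ^ N))"
    using L_pos[of t] by (subst prod_ennreal) (auto simp: exp_S prod_dividef less_imp_le)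
  finally show ?thesis .
qed

lemma L_power_pos: "0 < L t ^ N"
  using L_pos by simp

lemma integrable_Q_iff: "F \<in> borel_measurable A \<Longrightarrow> integrable (Q t) F \<longleftrightarrow> integrable A (\<lambda>x. F x * exp (t * S x))"
  for F :: "_ \<Rightarrow> real"
proof -
  assume [measurable]: "F \<in> borel_measurable A"
  have "integrable (Q t) F \<longleftrightarrow> integrable A (\<lambda>x. (exp (t * S x) / L t ^ N) * F x)"
    unfolding Q_eq using L_power_pos[of t] by (subst integrable_density) auto
  also have "(\<lambda>x. (exp (t * S x) / L t ^ N) * F x) = (\<lambda>x. (F x * exp (t * S x)) * (1 / L t ^ N))"
    by (simp add: mult_ac)
  also have "integrable A \<dots> \<longleftrightarrow> integrable A (\<lambda>x. F x * exp (t * S x))"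
  proof
    assume "integrable A (\<lambda>x. (F x * exp (t * S x)) * (1 / L t ^ N))"
    from integrable_mult_left[OF this, of "L t ^ N"] show "integrable A (\<lambda>x. F x * exp (t * S x))"
      using L_pos[of t] by simp
  qed (rule integrable_mult_left)
  finally show ?thesis .
qed

lemma integral_Q: "F \<in> borel_measurable A \<Longrightarrow> (LINT x|Q t. F x) = (LINT x|A. F x * exp (t * S x)) / L t ^ N"
  for F :: "_ \<Rightarrow> real"
proof -
  assume [measurable]: "F \<in> borel_measurable A"
  have "(LINT x|Q t. F x) = (LINT x|A. (exp (t * S x) / L t ^ N) * F x)"
    unfolding Q_eq using L_power_pos[of t] by (subst integral_density) auto
  also have "(\<lambda>x. (exp (t * S x) / L t ^ N) * F x) = (\<lambda>x. F x * exp (t * S x) / L t ^ N)"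
    by (simp add: mult_ac)
  finally show ?thesis by simp
qed

text \<open>The mixing measure \<open>nu\<close> is the law of the Hubbard--Stratonovich field: it has density
  \<open>exp (- U)\<close>, the normalised \<open>mixing_weight\<close>.\<close>

definition mixing_weight :: "real \<Rightarrow> real" where "mixing_weight t = exp (- (real N * (T * t\<^sup>2 / 2 - p t)))"
definition Zn :: real where "Zn = (LINT t|lborel. mixing_weight t)"
definition U :: "real \<Rightarrow> real" where "U t = real N * (T * t\<^sup>2 / 2 - p t) + ln Zn"
definition U' :: "real \<Rightarrow> real" where "U' t = real N * (T * t - p' t)"
definition nu :: "real measure" where "nu = density lborel (\<lambda>t. ennreal (exp (- U t)))"

lemma p_measurable[measurable]: "p \<in> borel_measurable borel"
  unfolding p_def by measurable

lemma mixing_weight_measurable[measurable]: "mixing_weight \<in> borel_measurable borel"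
  unfolding mixing_weight_def by measurable

lemma U_measurable[measurable]: "U \<in> borel_measurable borel"
  unfolding U_def by measurable

lemma mixing_weight_pos: "0 < mixing_weight t" by (simp add: mixing_weight_def)

lemma mixing_weight_eq: "mixing_weight t = exp (- (real N * T * t\<^sup>2 / 2)) * L t ^ N"
proof -
  have "L t ^ N = exp (real N * p t)" by (simp add: exp_p[symmetric] exp_of_nat_mult)
  then show ?thesis by (simp add: mixing_weight_def mult_exp_exp algebra_simps)
qed

lemma mixing_weight_le: "mixing_weight t \<le> exp (0 * t - (real N * (T - sigma2)) * t\<^sup>2 / 2)"
proof -
  have "real N * p t \<le> real N * (sigma2 / 2 * t\<^sup>2)" using p_le by (intro mult_left_mono) auto
  then have "- (real N * (T * t\<^sup>2 / 2 - p t)) \<le> 0 * t - (real N * (T - sigma2)) * t\<^sup>2 / 2"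
    by (simp add: field_simps)
  then show ?thesis by (simp only: mixing_weight_def exp_le_cancel_iff)
qed

lemma integrable_mixing_weight: "integrable lborel mixing_weight"
proof (rule Bochner_Integration.integrable_bound)
  show "integrable lborel (\<lambda>t. exp (0 * t - (real N * (T - sigma2)) * t\<^sup>2 / 2))"
    using has_bochner_integral_gaussian[of "real N * (T - sigma2)" 0] T N_pos
    by (simp add: has_bochner_integral_iff)
  show "AE t in lborel. norm (mixing_weight t) \<le> norm (exp (0 * t - (real N * (T - sigma2)) * t\<^sup>2 / 2))"
    using mixing_weight_le mixing_weight_pos by (simp add: less_imp_le)
qed simp

lemma Zn_pos: "0 < Zn"
proof -
  have "Zn = 0 \<longleftrightarrow> (AE t in lborel. mixing_weight t = 0)"
    unfolding Zn_def using integrable_mixing_weight mixing_weight_pos by (intro integral_nonneg_eq_0_iff_AE) (auto simp: less_imp_le)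
  moreover have "\<not> (AE t in lborel. mixing_weight t = 0)" using mixing_weight_pos by (simp add: less_imp_neq[symmetric] AE_iff_measurable[OF _ refl])
  moreover have "0 \<le> Zn" unfolding Zn_def using mixing_weight_pos by (simp add: less_imp_le)
  ultimately show ?thesis by linarith
qed

lemma exp_U: "exp (- U t) = mixing_weight t / Zn"
proof -
  have "- U t = - (real N * (T * t\<^sup>2 / 2 - p t)) - ln Zn" by (simp add: U_def)
  then show ?thesis using Zn_pos by (simp only: exp_diff mixing_weight_def exp_ln)
qed

lemma space_nu[simp]: "space nu = UNIV" and sets_nu[simp, measurable_cong]: "sets nu = sets borel"
  by (simp_all add: nu_def)

lemma prob_space_nu: "prob_space nu"
proof
  have "emeasure nu UNIV = (\<integral>\<^sup>+t. ennreal (mixing_weight t / Zn) \<partial>lborel)"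
    by (simp add: nu_def emeasure_density exp_U)
  also have "\<dots> = ennreal (LINT t|lborel. mixing_weight t / Zn)"
    using integrable_mixing_weight Zn_pos mixing_weight_pos by (intro nn_integral_eq_integral) (auto simp: less_imp_le)
  also have "(LINT t|lborel. mixing_weight t / Zn) = 1" using Zn_pos by (simp add: Zn_def)
  finally show "emeasure nu (space nu) = 1" by simp
qed

sublocale nu: prob_space nu by (rule prob_space_nu)

abbreviation m :: "(nat \<Rightarrow> real) measure" where "m \<equiv> mean_field_measure V attraction N T"

lemma sets_m[measurable_cong]: "sets m = sets A" and space_m: "space m = Rn N"
  by (simp_all add: mean_field_measure_def space_A)

lemma gibbs_weight_eq: "gibbs_weight attraction N T x = exp ((S x)\<^sup>2 / (2 * (real N * T)))"
proof -
  have "(\<Sum>i<N. \<Sum>j<N. - (x i * x j)) = - (S x)\<^sup>2"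
    by (simp add: S_def power2_eq_square sum_product sum_negf)
  then show ?thesis by (simp add: gibbs_weight_def mult_ac)
qed

text \<open>The Hubbard--Stratonovich transformation: the Gibbs weight \<open>exp (S\<^sup>2 / (2 N T))\<close> is a
  Gaussian average of the exponential tilts \<open>exp (t S)\<close>.\<close>

lemma nn_integral_gibbs:
  assumes [measurable]: "F \<in> borel_measurable A"
  shows "(\<integral>\<^sup>+x. ennreal (gibbs_weight attraction N T x) * F x \<partial>A) =
     ennreal (sqrt (real N * T / (2 * pi)) * Zn) * (\<integral>\<^sup>+t. \<integral>\<^sup>+x. F x \<partial>Q t \<partial>nu)"
proof -
  define c where "c = sqrt (real N * T / (2 * pi))"
  have c: "0 < c" using T_pos N_pos by (simp add: c_def)
  interpret AL: pair_sigma_finite A lborel ..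
  have gauss: "ennreal (gibbs_weight attraction N T x) =
      (\<integral>\<^sup>+t. ennreal (c * exp (S x * t - (real N * T) * t\<^sup>2 / 2)) \<partial>lborel)" for x
  proof -
    note G = has_bochner_integral_gaussian[of "real N * T" "S x"]
    have NT: "0 < real N * T" using T_pos N_pos by simp
    have "(\<integral>\<^sup>+t. ennreal (c * exp (S x * t - (real N * T) * t\<^sup>2 / 2)) \<partial>lborel) =
       ennreal (LINT t|lborel. c * exp (S x * t - (real N * T) * t\<^sup>2 / 2))"
      using G[OF NT] c by (intro nn_integral_eq_integral) (auto simp: has_bochner_integral_iff)
    also have "(LINT t|lborel. c * exp (S x * t - (real N * T) * t\<^sup>2 / 2)) =
       c * (sqrt (2 * pi / (real N * T)) * exp ((S x)\<^sup>2 / (2 * (real N * T))))"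
      using G[OF NT] by (simp add: has_bochner_integral_iff)
    also have "c * (sqrt (2 * pi / (real N * T)) * y) = y" for y
    proof -
      have "c * sqrt (2 * pi / (real N * T)) = sqrt ((real N * T / (2 * pi)) * (2 * pi / (real N * T)))"
        unfolding c_def by (rule real_sqrt_mult[symmetric])
      also have "\<dots> = 1" using T_pos N_pos by simp
      finally show ?thesis by (simp only: mult.assoc[symmetric] mult_1_left)
    qed
    finally show ?thesis by (simp add: gibbs_weight_eq)
  qed
  have "(\<integral>\<^sup>+x. ennreal (gibbs_weight attraction N T x) * F x \<partial>A) =
     (\<integral>\<^sup>+x. \<integral>\<^sup>+t. ennreal (c * exp (S x * t - (real N * T) * t\<^sup>2 / 2)) * F x \<partial>lborel \<partial>A)"
    by (simp add: gauss nn_integral_multc)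
  also have "\<dots> = (\<integral>\<^sup>+t. \<integral>\<^sup>+x. ennreal (c * exp (S x * t - (real N * T) * t\<^sup>2 / 2)) * F x \<partial>A \<partial>lborel)"
    by (rule AL.Fubini'[symmetric]) measurable
  also have "\<dots> = (\<integral>\<^sup>+t. ennreal (c * Zn) * (ennreal (exp (- U t)) * (\<integral>\<^sup>+x. F x \<partial>Q t)) \<partial>lborel)"
  proof (rule nn_integral_cong)
    fix t :: real
    have e: "c * exp (S x * t - (real N * T) * t\<^sup>2 / 2) = (c * Zn * exp (- U t)) * (exp (t * S x) / L t ^ N)" for x
    proof -
      have "S x * t - (real N * T) * t\<^sup>2 / 2 = t * S x + - (real N * T * t\<^sup>2 / 2)" by (simp add: mult.commute)
      then have "exp (S x * t - (real N * T) * t\<^sup>2 / 2) = exp (t * S x) * exp (- (real N * T * t\<^sup>2 / 2))"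
        by (simp only: exp_add)
      moreover have "(Zn * (a * l / Zn)) * (b / l) = b * a" if "0 < l" for a b l
        using Zn_pos that by simp
      from this[OF L_power_pos[of t]]
      have "(Zn * exp (- U t)) * (exp (t * S x) / L t ^ N) = exp (t * S x) * exp (- (real N * T * t\<^sup>2 / 2))"
        by (simp only: exp_U mixing_weight_eq)
      ultimately show ?thesis by (simp only: mult.assoc)
    qed
    have pos: "0 \<le> c * Zn * exp (- U t)" "0 \<le> exp (t * S x) / L t ^ N" for x
      using c Zn_pos L_power_pos[of t] by (simp_all add: less_imp_le)
    have "(\<integral>\<^sup>+x. ennreal (c * exp (S x * t - (real N * T) * t\<^sup>2 / 2)) * F x \<partial>A) =
      (\<integral>\<^sup>+x. ennreal (c * Zn * exp (- U t)) * (ennreal (exp (t * S x) / L t ^ N) * F x) \<partial>A)"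
      unfolding e ennreal_mult[OF pos] by (simp only: mult.assoc)
    also have "\<dots> = ennreal (c * Zn * exp (- U t)) * (\<integral>\<^sup>+x. ennreal (exp (t * S x) / L t ^ N) * F x \<partial>A)"
      by (rule nn_integral_cmult) measurable
    also have "(\<integral>\<^sup>+x. ennreal (exp (t * S x) / L t ^ N) * F x \<partial>A) = (\<integral>\<^sup>+x. F x \<partial>Q t)"
      unfolding Q_eq by (subst nn_integral_density) auto
    also have "ennreal (c * Zn * exp (- U t)) = ennreal (c * Zn) * ennreal (exp (- U t))"
      using c Zn_pos by (intro ennreal_mult) auto
    finally show "(\<integral>\<^sup>+x. ennreal (c * exp (S x * t - (real N * T) * t\<^sup>2 / 2)) * F x \<partial>A) =
       ennreal (c * Zn) * (ennreal (exp (- U t)) * (\<integral>\<^sup>+x. F x \<partial>Q t))" by (simp add: mult.assoc)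
  qed
  also have "\<dots> = ennreal (c * Zn) * (\<integral>\<^sup>+t. ennreal (exp (- U t)) * (\<integral>\<^sup>+x. F x \<partial>Q t) \<partial>lborel)"
  proof (rule nn_integral_cmult)
    have "(\<lambda>t. \<integral>\<^sup>+x. F x \<partial>Q t) = (\<lambda>t. \<integral>\<^sup>+x. ennreal (exp (t * S x) / L t ^ N) * F x \<partial>A)"
      unfolding Q_eq by (intro ext, subst nn_integral_density) auto
    also have "\<dots> \<in> borel_measurable lborel" by measurable
    finally show "(\<lambda>t. ennreal (exp (- U t)) * (\<integral>\<^sup>+x. F x \<partial>Q t)) \<in> borel_measurable lborel" by measurable
  qed
  also have "(\<integral>\<^sup>+t. ennreal (exp (- U t)) * (\<integral>\<^sup>+x. F x \<partial>Q t) \<partial>lborel) = (\<integral>\<^sup>+t. \<integral>\<^sup>+x. F x \<partial>Q t \<partial>nu)"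
  proof -
    have "(\<lambda>t. \<integral>\<^sup>+x. F x \<partial>Q t) = (\<lambda>t. \<integral>\<^sup>+x. ennreal (exp (t * S x) / L t ^ N) * F x \<partial>A)"
      unfolding Q_eq by (intro ext, subst nn_integral_density) auto
    also have "\<dots> \<in> borel_measurable lborel" by measurable
    finally show ?thesis unfolding nu_def by (subst nn_integral_density) auto
  qed
  finally show ?thesis by (simp add: c_def)
qed

lemma partition_function_eq:
  "partition_function V attraction N T = ennreal (sqrt (real N * T / (2 * pi)) * Zn)"
  using nn_integral_gibbs[of "\<lambda>_. 1"]
  by (simp add: partition_function_def prob_space.emeasure_space_1[OF prob_space_Q] nu.emeasure_space_1[simplified])

lemma nn_integral_m:
  assumes [measurable]: "F \<in> borel_measurable A"
  shows "(\<integral>\<^sup>+x. F x \<partial>m) = (\<integral>\<^sup>+t. \<integral>\<^sup>+x. F x \<partial>Q t \<partial>nu)"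
proof -
  define z where "z = sqrt (real N * T / (2 * pi)) * Zn"
  have z: "0 < z" using T_pos N_pos Zn_pos by (simp add: z_def)
  have gm[measurable]: "(\<lambda>x. gibbs_weight attraction N T x) \<in> borel_measurable A" unfolding gibbs_weight_eq by measurable
  have "(\<integral>\<^sup>+x. F x \<partial>m) = (\<integral>\<^sup>+x. ennreal (gibbs_weight attraction N T x) / ennreal z * F x \<partial>A)"
    unfolding mean_field_measure_def partition_function_eq z_def[symmetric]
    by (subst nn_integral_density) auto
  also have "\<dots> = (\<integral>\<^sup>+x. ennreal (gibbs_weight attraction N T x) * F x / ennreal z \<partial>A)"
    by (simp add: divide_ennreal_def mult_ac)
  also have "\<dots> = (\<integral>\<^sup>+x. ennreal (gibbs_weight attraction N T x) * F x \<partial>A) / ennreal z"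
    by (rule nn_integral_divide) measurable
  also have "\<dots> = ennreal z * (\<integral>\<^sup>+t. \<integral>\<^sup>+x. F x \<partial>Q t \<partial>nu) / ennreal z"
    by (subst nn_integral_gibbs) (auto simp: z_def)
  also have "\<dots> = (\<integral>\<^sup>+t. \<integral>\<^sup>+x. F x \<partial>Q t \<partial>nu)"
    using z by (simp add: ennreal_mult_divide_eq mult.commute[of "ennreal z"])
  finally show ?thesis .
qed

lemma prob_space_m: "prob_space m"
proof
  have "emeasure m (space m) = (\<integral>\<^sup>+x. 1 \<partial>m)" by simp
  also have "\<dots> = 1"
    by (subst nn_integral_m)
      (simp_all add: prob_space.emeasure_space_1[OF prob_space_Q] nu.emeasure_space_1[simplified])
  finally show "emeasure m (space m) = 1" .
qed

sublocale m: prob_space m by (rule prob_space_m)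

lemma integral_Q_measurable[measurable]:
  fixes F :: "_ \<Rightarrow> real"
  assumes [measurable]: "F \<in> borel_measurable A"
  shows "(\<lambda>t. LINT x|Q t. F x) \<in> borel_measurable borel"
  unfolding integral_Q[OF assms] by measurable

lemma integrable_Q_bounded:
  fixes F :: "_ \<Rightarrow> real"
  assumes F: "F \<in> borel_measurable A" and B: "\<And>x. x \<in> Rn N \<Longrightarrow> \<bar>F x\<bar> \<le> B"
  shows "integrable (Q t) F" "\<bar>LINT x|Q t. F x\<bar> \<le> B"
proof -
  interpret Q: prob_space "Q t" by (rule prob_space_Q)
  show i: "integrable (Q t) F"
    by (rule integrable_bounded[of _ _ B]) (use F B Q.finite_measure_axioms in \<open>auto simp: space_Q cong: measurable_cong_sets\<close>)
  show "\<bar>LINT x|Q t. F x\<bar> \<le> B"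
    using integral_between[OF prob_space_Q i, of "- B" B] B by (auto simp: space_Q abs_le_iff minus_le_iff)
qed

lemma integral_m:
  fixes F :: "_ \<Rightarrow> real"
  assumes F[measurable]: "F \<in> borel_measurable A" and B: "\<And>x. x \<in> Rn N \<Longrightarrow> \<bar>F x\<bar> \<le> B"
  shows "(LINT x|m. F x) = (LINT t|nu. LINT x|Q t. F x)"
proof -
  have pos: "(LINT x|m. F x) = (LINT t|nu. LINT x|Q t. F x)"
    if F[measurable]: "F \<in> borel_measurable A" and B: "\<And>x. x \<in> Rn N \<Longrightarrow> 0 \<le> F x" "\<And>x. x \<in> Rn N \<Longrightarrow> F x \<le> B"
    for F :: "_ \<Rightarrow> real" and B
  proof -
    have B': "\<bar>F x\<bar> \<le> B" if "x \<in> Rn N" for x using B[OF that] by simp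
    have "(LINT x|m. F x) = enn2real (\<integral>\<^sup>+x. ennreal (F x) \<partial>m)"
      by (rule integral_eq_nn_integral) (use B in \<open>auto simp: space_m cong: measurable_cong_sets\<close>)
    also have "(\<integral>\<^sup>+x. ennreal (F x) \<partial>m) = (\<integral>\<^sup>+t. \<integral>\<^sup>+x. ennreal (F x) \<partial>Q t \<partial>nu)"
      by (rule nn_integral_m) measurable
    also have "\<dots> = (\<integral>\<^sup>+t. ennreal (LINT x|Q t. F x) \<partial>nu)"
      by (intro nn_integral_cong nn_integral_eq_integral integrable_Q_bounded(1)[OF F B'])
        (use B in \<open>auto simp: space_Q\<close>)
    also have "enn2real \<dots> = (LINT t|nu. LINT x|Q t. F x)"
      by (rule integral_eq_nn_integral[symmetric])
        (use B in \<open>auto intro!: integral_nonneg_AE AE_I2 simp: space_Q cong: measurable_cong_sets\<close>)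
    finally show ?thesis .
  qed
  have i: "integrable m F"
    by (rule integrable_bounded[of _ _ B]) (use F B m.finite_measure_axioms in \<open>auto simp: space_m cong: measurable_cong_sets\<close>)
  have i2: "integrable nu (\<lambda>t. LINT x|Q t. F x)"
    by (rule integrable_bounded[of _ _ B])
      (use F integrable_Q_bounded(2)[OF F B] nu.finite_measure_axioms in \<open>auto cong: measurable_cong_sets\<close>)
  have Q1: "measure (Q t) (space (Q t)) = 1" for t by (rule prob_space.prob_space[OF prob_space_Q])
  have "(LINT x|m. F x + B) = (LINT t|nu. LINT x|Q t. F x + B)"
  proof (rule pos[of "\<lambda>x. F x + B" "B + B"])
    fix x assume "x \<in> Rn N"
    from B[OF this] show "0 \<le> F x + B" "F x + B \<le> B + B" by linarith+
  qed measurable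
  also have "(LINT x|m. F x + B) = (LINT x|m. F x) + B" using i by (simp add: m.prob_space)
  also have "(\<lambda>t. LINT x|Q t. F x + B) = (\<lambda>t. (LINT x|Q t. F x) + B)"
  proof
    fix t
    interpret Q: prob_space "Q t" by (rule prob_space_Q)
    show "(LINT x|Q t. F x + B) = (LINT x|Q t. F x) + B"
      using integrable_Q_bounded(1)[OF F B] by (simp add: Q1)
  qed
  also have "(LINT t|nu. (LINT x|Q t. F x) + B) = (LINT t|nu. LINT x|Q t. F x) + B"
    using i2 by (simp add: nu.prob_space[simplified])
  finally show ?thesis by simp
qed

end

section \<open>Smooth functions on products of the line\<close>

lemma borel_measurable_continuous_on_Rn:
  fixes F :: "(nat \<Rightarrow> real) \<Rightarrow> real"
  assumes F: "continuous_on (Rn n) F" and M: "\<And>i. sets (M i) = sets borel"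
  shows "F \<in> borel_measurable (PiM {..<n} M)"
proof -
  have s: "sets (PiM {..<n} M) = sets (PiM {..<n} (\<lambda>_. borel :: real measure))"
    by (rule sets_PiM_cong) (use M in auto)
  have sp: "space (PiM {..<n} (\<lambda>_. borel :: real measure)) = Rn n" by (simp add: space_PiM)
  have "(\<lambda>x. x) \<in> measurable (PiM {..<n} (\<lambda>_. borel :: real measure)) (PiM UNIV (\<lambda>_. borel))"
  proof (rule measurable_PiM_single')
    fix i :: nat
    show "(\<lambda>x. x i) \<in> borel_measurable (PiM {..<n} (\<lambda>_. borel :: real measure))"
    proof (cases "i < n")
      case True
      then show ?thesis by (intro measurable_component_singleton) auto
    next
      case False
      have "(\<lambda>x. x i) \<in> borel_measurable (PiM {..<n} (\<lambda>_. borel :: real measure)) \<longleftrightarrow>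
         (\<lambda>x. undefined :: real) \<in> borel_measurable (PiM {..<n} (\<lambda>_. borel :: real measure))"
        using False by (intro measurable_cong) (auto simp: sp PiE_def extensional_def)
      then show ?thesis by simp
    qed
  qed auto
  then have "(\<lambda>x. x) \<in> measurable (PiM {..<n} (\<lambda>_. borel :: real measure)) borel"
    using sets_PiM_equal_borel by (metis measurable_cong_sets)
  then have "(\<lambda>x. x) \<in> measurable (PiM {..<n} (\<lambda>_. borel :: real measure)) (restrict_space borel (Rn n))"
    by (intro measurable_restrict_space2) (auto simp: sp)
  from measurable_compose[OF this borel_measurable_continuous_on_restrict[OF F]]
  have "F \<in> borel_measurable (PiM {..<n} (\<lambda>_. borel :: real measure))" by simp
  then show ?thesis using s by (simp cong: measurable_cong_sets)
qed

lemma upd_Rn: "x \<in> Rn n \<Longrightarrow> i < n \<Longrightarrow> x(i := t) \<in> Rn n"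
  by (auto simp: PiE_def extensional_def)

lemma continuous_on_upd:
  fixes x :: "nat \<Rightarrow> real"
  shows "continuous_on X (\<lambda>t. x(i := t))"
proof (rule continuous_on_coordinatewise_then_product)
  show "continuous_on X (\<lambda>t. (x(i := t)) j)" for j
    by (cases "j = i") (auto intro: continuous_intros)
qed

lemma continuous_on_line:
  fixes F :: "(nat \<Rightarrow> real) \<Rightarrow> real"
  assumes "continuous_on (Rn n) F" "x \<in> Rn n" "i < n"
  shows "continuous_on UNIV (\<lambda>t. F (x(i := t)))"
  by (rule continuous_on_compose2[OF assms(1) continuous_on_upd]) (use upd_Rn assms in auto)

lemma partial_deriv_line:
  assumes "partially_differentiable i F (x(i := t))"
  shows "((\<lambda>s. F (x(i := s))) has_real_derivative partial_deriv i F (x(i := t))) (at t)"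
  using assms
  by (simp add: partially_differentiable_def partial_deriv_def DERIV_deriv_iff_real_differentiable)

lemma bounded_on_Rn:
  fixes F :: "(nat \<Rightarrow> real) \<Rightarrow> real"
  assumes F: "continuous_on (Rn n) F" and K: "compact K" "K \<subseteq> Rn n" and z: "\<And>x. x \<in> Rn n - K \<Longrightarrow> F x = 0"
  shows "\<exists>B\<ge>0. \<forall>x\<in>Rn n. \<bar>F x\<bar> \<le> B"
proof -
  have "compact (F ` K)"
    by (rule compact_continuous_image[OF continuous_on_subset[OF F K(2)] K(1)])
  then obtain B where B: "\<And>x. x \<in> K \<Longrightarrow> \<bar>F x\<bar> \<le> B"
    using compact_imp_bounded bounded_real by (metis (no_types, lifting) imageI)
  have "\<bar>F x\<bar> \<le> max B 0" if "x \<in> Rn n" for x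
    using B[of x] z[of x] that by (cases "x \<in> K") auto
  then show ?thesis by (intro exI[of _ "max B 0"]) auto
qed

text \<open>Minimise the Taylor upper bound of \<open>f (x + h) \<ge> 0\<close> over \<open>h\<close>.\<close>

lemma sq_deriv_le_nonneg_function:
  fixes f f' f'' :: "real \<Rightarrow> real"
  assumes f': "\<And>x. (f has_real_derivative f' x) (at x)" and f'': "\<And>x. (f' has_real_derivative f'' x) (at x)"
    and M: "0 < M" "\<And>x. \<bar>f'' x\<bar> \<le> M" and pos: "\<And>x. 0 \<le> f x"
  shows "(f' x)\<^sup>2 \<le> 2 * M * f x"
proof -
  define q where "q y = M * y\<^sup>2 / 2 - f y" for y
  define q' where "q' y = M * y - f' y" for y
  have "q' y \<le> q' z" if "y \<le> z" for y z
  proof (rule DERIV_nonneg_imp_nondecreasing[OF that])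
    fix s
    have "(q' has_real_derivative M - f'' s) (at s)"
      unfolding q'_def by (auto intro!: derivative_eq_intros f'')
    moreover have "0 \<le> M - f'' s" using M(2)[of s] by linarith
    ultimately show "\<exists>D. DERIV q' s :> D \<and> 0 \<le> D" by blast
  qed
  moreover have "(q has_real_derivative q' y) (at y)" for y
    unfolding q_def q'_def by (auto intro!: derivative_eq_intros f')
  moreover define k where "k = f' x / M"
  ultimately have "q x + q' x * ((x - k) - x) \<le> q (x - k)"
    by (intro mono_deriv_above_tangent)
  moreover have f'k: "f' x = M * k" using M(1) by (simp add: k_def)
  ultimately have "M * k\<^sup>2 \<le> 2 * f x"
    using pos[of "x - k"] by (simp add: q_def q'_def power2_eq_square field_simps)
  then have "M * (M * k\<^sup>2) \<le> M * (2 * f x)" using M(1) by (intro mult_left_mono) auto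
  then show ?thesis by (simp add: f'k power2_eq_square mult_ac)
qed

text \<open>For a smooth nonnegative \<open>F\<close> with compact support the square of a partial derivative is
  dominated by \<open>F\<close>. So the Fisher information has a bounded integrand.\<close>

lemma smooth_bounds:
  assumes F: "smooth n F" "compactly_supported n F" and pos: "\<And>x. x \<in> Rn n \<Longrightarrow> 0 \<le> F x"
  obtains B where "0 < B" "\<And>x. x \<in> Rn n \<Longrightarrow> F x \<le> B"
    "\<And>i x. i < n \<Longrightarrow> x \<in> Rn n \<Longrightarrow> \<bar>partial_deriv i F x\<bar> \<le> B"
    "\<And>i x. i < n \<Longrightarrow> x \<in> Rn n \<Longrightarrow> (partial_deriv i F x)\<^sup>2 \<le> B * F x"
proof -
  have "Ck n 2 F" using F by (auto simp: smooth_def)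
  then have Fc: "continuous_on (Rn n) F"
    and pd: "\<And>i x. i < n \<Longrightarrow> x \<in> Rn n \<Longrightarrow> partially_differentiable i F x"
    and Dc: "\<And>i. i < n \<Longrightarrow> continuous_on (Rn n) (partial_deriv i F)"
    and pd2: "\<And>i x. i < n \<Longrightarrow> x \<in> Rn n \<Longrightarrow> partially_differentiable i (partial_deriv i F) x"
    and DDc: "\<And>i. i < n \<Longrightarrow> continuous_on (Rn n) (partial_deriv i (partial_deriv i F))"
    by (auto simp: numeral_2_eq_2)
  obtain K where K: "compact K" "K \<subseteq> Rn n" and z: "\<And>x. x \<in> Rn n - K \<Longrightarrow> F x = 0"
    using F by (auto simp: compactly_supported_def)
  have d: "((\<lambda>s. F (x(i := s))) has_real_derivative partial_deriv i F (x(i := t))) (at t)"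
    if "i < n" "x \<in> Rn n" for i x t
    using partial_deriv_line pd that upd_Rn by blast
  have dd: "((\<lambda>s. partial_deriv i F (x(i := s))) has_real_derivative partial_deriv i (partial_deriv i F) (x(i := t))) (at t)"
    if "i < n" "x \<in> Rn n" for i x t
    using partial_deriv_line pd2 that upd_Rn by blast
  have Dz: "partial_deriv i F x = 0" if "i < n" "x \<in> Rn n - K" for i x
  proof (rule DERIV_local_min)
    show "((\<lambda>s. F (x(i := s))) has_real_derivative partial_deriv i F x) (at (x i))"
      using d[of i x "x i"] that by simp
    show "\<forall>y. \<bar>x i - y\<bar> < 1 \<longrightarrow> F (x(i := x i)) \<le> F (x(i := y))"
      using z[OF that(2)] pos upd_Rn that by auto
  qed simp
  have DDz: "partial_deriv i (partial_deriv i F) x = 0" if i: "i < n" and x: "x \<in> Rn n - K" for i x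
  proof -
    define O' where "O' = (\<lambda>t. x(i := t)) -` (- K)"
    have "closed K" using K(1) by (rule compact_imp_closed)
    then have "open O'" unfolding O'_def using continuous_on_upd[of UNIV x i]
      by (intro open_vimage) auto
    moreover have "x i \<in> O'" using x by (simp add: O'_def)
    moreover have "((\<lambda>_. 0) has_real_derivative 0) (at (x i))" by simp
    moreover have "0 = partial_deriv i F (x(i := t))" if "t \<in> O'" for t
      using Dz[OF i, of "x(i := t)"] that upd_Rn i x by (auto simp: O'_def)
    ultimately have "((\<lambda>t. partial_deriv i F (x(i := t))) has_real_derivative 0) (at (x i))"
      by (metis (mono_tags, lifting) has_field_derivative_transform_within_open)
    moreover have "((\<lambda>t. partial_deriv i F (x(i := t))) has_real_derivative partial_deriv i (partial_deriv i F) x) (at (x i))"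
      using dd[OF i, of x "x i"] x by simp
    ultimately show ?thesis by (rule DERIV_unique[symmetric])
  qed
  obtain B0 where B0: "0 \<le> B0" "\<And>x. x \<in> Rn n \<Longrightarrow> \<bar>F x\<bar> \<le> B0"
    using bounded_on_Rn[OF Fc K z] by blast
  have "\<exists>B\<ge>0. \<forall>x\<in>Rn n. \<bar>partial_deriv i F x\<bar> \<le> B" if "i < n" for i
    using bounded_on_Rn[OF Dc[OF that] K Dz[OF that]] .
  then obtain B1 where B1: "\<And>i. i < n \<Longrightarrow> 0 \<le> B1 i" "\<And>i x. i < n \<Longrightarrow> x \<in> Rn n \<Longrightarrow> \<bar>partial_deriv i F x\<bar> \<le> B1 i"
    by metis
  have "\<exists>B\<ge>0. \<forall>x\<in>Rn n. \<bar>partial_deriv i (partial_deriv i F) x\<bar> \<le> B" if "i < n" for i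
    using bounded_on_Rn[OF DDc[OF that] K DDz[OF that]] .
  then obtain B2 where B2: "\<And>i. i < n \<Longrightarrow> 0 \<le> B2 i" "\<And>i x. i < n \<Longrightarrow> x \<in> Rn n \<Longrightarrow> \<bar>partial_deriv i (partial_deriv i F) x\<bar> \<le> B2 i"
    by metis
  define C where "C = 1 + B0 + (\<Sum>i<n. B1 i) + (\<Sum>i<n. B2 i)"
  have s1: "B1 i \<le> (\<Sum>i<n. B1 i)" "B2 i \<le> (\<Sum>i<n. B2 i)" if "i < n" for i
    using that B1(1) B2(1) by (auto intro!: member_le_sum)
  have s0: "0 \<le> (\<Sum>i<n. B1 i)" "0 \<le> (\<Sum>i<n. B2 i)" using B1(1) B2(1) by (auto intro: sum_nonneg)
  have C: "0 < C" using B0 s0 by (simp add: C_def)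
  show thesis
  proof (rule that[of "2 * C"])
    show "0 < 2 * C" using C by simp
    show "F x \<le> 2 * C" if "x \<in> Rn n" for x
      using B0(1) B0(2)[OF that] s0 unfolding C_def by (simp add: abs_le_iff)
    show "\<bar>partial_deriv i F x\<bar> \<le> 2 * C" if "i < n" "x \<in> Rn n" for i x
    proof -
      have "\<bar>partial_deriv i F x\<bar> \<le> (\<Sum>i<n. B1 i)" using B1(2)[OF that] s1(1)[OF that(1)] by (rule order_trans)
      moreover have "(\<Sum>i<n. B1 i) \<le> C" using B0(1) s0 by (simp add: C_def)
      ultimately show ?thesis using C by linarith
    qed
    show "(partial_deriv i F x)\<^sup>2 \<le> 2 * C * F x" if i: "i < n" "x \<in> Rn n" for i x
    proof -
      have "(partial_deriv i F (x(i := x i)))\<^sup>2 \<le> 2 * C * F (x(i := x i))"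
      proof (rule sq_deriv_le_nonneg_function[OF d[OF i] dd[OF i] C])
        show "\<bar>partial_deriv i (partial_deriv i F) (x(i := t))\<bar> \<le> C" for t
        proof -
          have "\<bar>partial_deriv i (partial_deriv i F) (x(i := t))\<bar> \<le> (\<Sum>i<n. B2 i)"
            using B2(2)[OF i(1) upd_Rn[OF i(2,1)]] s1(2)[OF i(1)] by (rule order_trans)
          moreover have "(\<Sum>i<n. B2 i) \<le> C" using B0(1) s0 by (simp add: C_def)
          ultimately show ?thesis by linarith
        qed
        show "0 \<le> F (x(i := t))" for t using pos upd_Rn[OF i(2,1)] by blast
      qed
      then show ?thesis by simp
    qed
  qed
qed

text \<open>At a zero of \<open>F\<close> the left side vanishes, as \<open>sqrt F\<close> has a minimum there or no partial derivative,
  and the right side is a division by \<open>0\<close>.\<close>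

lemma partial_deriv_sqrt_sq:
  assumes pd: "\<And>t. partially_differentiable i F (x(i := t))" and pos: "\<And>t. 0 \<le> F (x(i := t))"
  shows "(partial_deriv i (\<lambda>y. sqrt (F y)) x)\<^sup>2 = (partial_deriv i F x)\<^sup>2 / (4 * F x)"
proof (cases "F x = 0")
  case True
  have "partial_deriv i (\<lambda>y. sqrt (F y)) x = 0"
  proof (cases "partially_differentiable i (\<lambda>y. sqrt (F y)) x")
    case pd': True
    have "partial_deriv i (\<lambda>y. sqrt (F y)) x = 0"
    proof (rule DERIV_local_min)
      show "((\<lambda>t. sqrt (F (x(i := t)))) has_real_derivative partial_deriv i (\<lambda>y. sqrt (F y)) x) (at (x i))"
        using partial_deriv_line[of i "\<lambda>y. sqrt (F y)" x "x i"] pd' by simp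
      show "\<forall>y. \<bar>x i - y\<bar> < 1 \<longrightarrow> sqrt (F (x(i := x i))) \<le> sqrt (F (x(i := y)))"
        using True pos by simp
    qed simp
    then show ?thesis .
  qed (simp add: partial_deriv_def)
  then show ?thesis using True by simp
next
  case False
  then have Fp: "0 < F x" using pos[of "x i"] by simp
  have "((\<lambda>t. F (x(i := t))) has_real_derivative partial_deriv i F x) (at (x i))"
    using partial_deriv_line[of i F x "x i"] pd[of "x i"] by simp
  then have d: "((\<lambda>t. sqrt (F (x(i := t)))) has_real_derivative partial_deriv i F x / (2 * sqrt (F x))) (at (x i))"
    using Fp by (auto intro!: derivative_eq_intros simp: field_simps)
  then have "partially_differentiable i (\<lambda>y. sqrt (F y)) x"
    unfolding partially_differentiable_def using real_differentiable_def by blast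
  then have "partial_deriv i (\<lambda>y. sqrt (F y)) x = partial_deriv i F x / (2 * sqrt (F x))"
    using d by (simp add: partial_deriv_def DERIV_imp_deriv)
  then show ?thesis using Fp by (simp add: power_divide power_mult_distrib)
qed

lemma abs_x_ln_x_le:
  fixes y :: real
  assumes "0 \<le> y"
  shows "\<bar>y * ln y\<bar> \<le> 1 + y\<^sup>2"
proof (cases "y = 0")
  case False
  then have y: "0 < y" using assms by simp
  have "y * ln y \<le> y * (y - 1)" using y by (intro mult_left_mono ln_le_minus_one) auto
  also have "\<dots> \<le> y\<^sup>2" using y by (simp add: power2_eq_square algebra_simps)
  finally have 1: "y * ln y \<le> y\<^sup>2" .
  have "y * ln 1 + y - 1 \<le> y * ln y" using mult_ln_tangent[OF y, of 1] by simp
  then have "- 1 \<le> y * ln y" using y by simp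
  then show ?thesis using 1 zero_le_power2[of y] by (intro abs_leI) linarith+
qed simp

lemma x_ln_x_tendsto_0: "((\<lambda>x::real. x * ln x) \<longlongrightarrow> 0) (at_right 0)"
proof (rule tendsto_sandwich)
  show "((\<lambda>x::real. 2 * x - 2 * sqrt x) \<longlongrightarrow> 0) (at_right 0)"
    by (auto intro!: tendsto_eq_intros)
  show "((\<lambda>x::real. x * (x - 1)) \<longlongrightarrow> 0) (at_right 0)"
    by (auto intro!: tendsto_eq_intros)
  show "\<forall>\<^sub>F x::real in at_right 0. 2 * x - 2 * sqrt x \<le> x * ln x"
    using eventually_at_right_less[of "0::real"]
  proof eventually_elim
    case (elim x)
    have "ln (inverse (sqrt x)) \<le> inverse (sqrt x) - 1" using elim by (intro ln_le_minus_one) auto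
    then have "2 * (1 - inverse (sqrt x)) \<le> ln x" using elim by (simp add: ln_inverse ln_sqrt)
    then have "x * (2 * (1 - inverse (sqrt x))) \<le> x * ln x" using elim by (intro mult_left_mono) auto
    moreover have "x * inverse (sqrt x) = sqrt x" using elim by (simp add: real_div_sqrt divide_inverse[symmetric])
    ultimately show ?case by (simp add: algebra_simps)
  qed
  show "\<forall>\<^sub>F x::real in at_right 0. x * ln x \<le> x * (x - 1)"
    using eventually_at_right_less[of "0::real"]
    by eventually_elim (auto intro!: mult_left_mono ln_le_minus_one)
qed


lemma tendsto_x_ln_x:
  fixes a :: "nat \<Rightarrow> real"
  assumes a: "a \<longlonglongrightarrow> l" and pos: "\<And>n. 0 \<le> a n"
  shows "(\<lambda>n. a n * ln (a n)) \<longlonglongrightarrow> l * ln l"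
proof -
  have l: "0 \<le> l" using LIMSEQ_le_const[OF a] pos by blast
  show ?thesis
  proof (cases "l = 0")
    case False
    then show ?thesis by (intro tendsto_intros a) auto
  next
    case True
    have "((\<lambda>x::real. x * ln x) \<longlongrightarrow> 0 * ln 0) (at 0 within {0..})"
    proof -
      have "((\<lambda>x::real. x * ln x) \<longlongrightarrow> 0) (at 0 within {0<..})" by (rule x_ln_x_tendsto_0)
      then show ?thesis
        using at_within_Ici_at_right[of "0::real"] by (simp add: at_within_Ici_at_right)
    qed
    then have "continuous (at 0 within {0..}) (\<lambda>x::real. x * ln x)" by (simp add: continuous_within)
    then show ?thesis
      using a pos True unfolding continuous_within_sequentially by (auto simp: comp_def)
  qed
qed

section \<open>The lower bound on the log-Sobolev constant\<close>

context high_temperature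
begin

lemma mixing_mean_deriv:
  fixes F :: "(nat \<Rightarrow> real) \<Rightarrow> real"
  assumes F[measurable]: "F \<in> borel_measurable A" and B: "\<And>x. x \<in> Rn N \<Longrightarrow> \<bar>F x\<bar> \<le> B"
  defines "G \<equiv> \<lambda>t. LINT x|Q t. F x"
  defines "G' \<equiv> \<lambda>t. (LINT x|Q t. F x * S x) - G t * (real N * p' t)"
  shows "integrable (Q t) (\<lambda>x. F x * S x)" "(G has_real_derivative G' t) (at t)" "continuous_on UNIV G'"
proof -
  have i: "integrable A (\<lambda>x. F x * exp (t * S x))" for t
  proof (rule Bochner_Integration.integrable_bound[OF integrable_mult_right[OF integrable_exp_S, of B]])
    show "AE x in A. norm (F x * exp (t * S x)) \<le> norm (B * exp (t * S x))"
    proof (rule AE_I2)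
      fix x assume "x \<in> space A"
      then have "\<bar>F x\<bar> \<le> \<bar>B\<bar>" using B[of x] by (simp add: space_A)
      then show "norm (F x * exp (t * S x)) \<le> norm (B * exp (t * S x))" by (simp add: abs_mult)
    qed
  qed measurable
  have FS[measurable]: "(\<lambda>x. F x * S x) \<in> borel_measurable A" by measurable
  have i1: "integrable A (\<lambda>x. F x * S x * exp (t * S x))" for t
    by (rule integrable_times_exp[OF S_measurable F i])
  then show iQ: "integrable (Q t) (\<lambda>x. F x * S x)" for t by (simp add: integrable_Q_iff)
  define H where "H t = (LINT x|A. F x * exp (t * S x))" for t
  define H1 where "H1 t = (LINT x|A. F x * S x * exp (t * S x))" for t
  have H: "(H has_real_derivative H1 t) (at t)" for t
    unfolding H_def H1_def by (rule has_real_derivative_exp_integral[OF S_measurable F i])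
  have H1d: "(H1 has_real_derivative (LINT x|A. F x * S x * S x * exp (t * S x))) (at t)" for t
    unfolding H1_def by (rule has_real_derivative_exp_integral[OF S_measurable FS i1])
  define E where "E t = exp (- (real N * p t))" for t
  have LE: "y / L t ^ N = y * E t" for y t
    by (simp add: E_def exp_p[symmetric] exp_of_nat_mult exp_minus divide_inverse)
  have E: "(E has_real_derivative - (real N * p' t) * E t) (at t)" for t
    unfolding E_def by (auto intro!: derivative_eq_intros p_deriv)
  have Geq: "G = (\<lambda>t. H t * E t)" by (simp add: G_def integral_Q H_def LE)
  have G'eq: "G' = (\<lambda>t. H1 t * E t - H t * E t * (real N * p' t))"
    by (simp add: G'_def Geq integral_Q H1_def LE)
  show "(G has_real_derivative G' t) (at t)"
    unfolding Geq G'eq by (auto intro!: derivative_eq_intros H E simp: algebra_simps)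
  have "continuous_on UNIV H" "continuous_on UNIV H1" "continuous_on UNIV E"
    by (rule DERIV_continuous_on, rule H H1d E)+
  then show "continuous_on UNIV G'" unfolding G'eq by (intro continuous_intros p'_cont)
qed

text \<open>The derivative of the mean in the tilt parameter is a covariance with \<open>S\<close>. As \<open>S\<close> is
  sub-Gaussian with variance proxy \<open>N * sigma2\<close> under every \<open>Q t\<close>, the variational formula for
  the entropy, optimised over multiples of \<open>S\<close>, bounds this covariance by the entropy.\<close>

lemma covariance_sq_le_ent:
  fixes F :: "(nat \<Rightarrow> real) \<Rightarrow> real"
  assumes F: "pos_bounded A F"
  defines "G \<equiv> \<lambda>t. LINT x|Q t. F x"
  defines "G' \<equiv> \<lambda>t. (LINT x|Q t. F x * S x) - G t * (real N * p' t)"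
  shows "(G' t)\<^sup>2 / G t \<le> 2 * (real N * sigma2) * ent (Q t) F"
proof -
  obtain e B where Fm[measurable]: "F \<in> borel_measurable A" and e: "0 < e" "0 < B"
    "\<And>x. x \<in> Rn N \<Longrightarrow> e \<le> F x" "\<And>x. x \<in> Rn N \<Longrightarrow> F x \<le> B"
    using F by (rule pos_boundedE) (auto simp: space_A)
  have absB: "\<bar>F x\<bar> \<le> B" if "x \<in> Rn N" for x using e(1) e(3,4)[OF that] by linarith
  note d = mixing_mean_deriv[OF Fm absB]
  interpret Q: prob_space "Q t" by (rule prob_space_Q)
  have FQ: "pos_bounded (Q t) F"
    using e by (intro pos_boundedI[of _ _ e B]) (auto simp: space_Q cong: measurable_cong_sets)
  have G: "0 < G t" unfolding G_def by (rule pos_bounded_integral_pos[OF prob_space_Q FQ])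
  have Gt: "(LINT x|Q t. F x) = G t" by (simp add: G_def)
  have iF: "integrable (Q t) F" by (rule integrable_Q_bounded(1)[OF Fm absB])
  have key: "s * G' t \<le> ent (Q t) F + G t * (real N * (sigma2 / 2 * s\<^sup>2))" for s
  proof -
    define g where "g x = s * (S x - real N * p' t)" for x
    have i1: "integrable (Q t) (\<lambda>x. F x * g x)"
    proof -
      have "integrable (Q t) (\<lambda>x. s * (F x * S x) - s * (real N * p' t) * F x)"
        using d(1) iF by (intro Bochner_Integration.integrable_diff integrable_mult_right)
      then show ?thesis by (simp add: g_def algebra_simps)
    qed
    have e1: "(LINT x|Q t. F x * g x) = s * G' t"
    proof -
      have "(LINT x|Q t. F x * g x) = (LINT x|Q t. s * (F x * S x) - s * (real N * p' t) * F x)"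
        by (simp add: g_def algebra_simps)
      also have "\<dots> = s * (LINT x|Q t. F x * S x) - s * (real N * p' t) * (LINT x|Q t. F x)"
        using d(1) iF by simp
      finally show ?thesis by (simp add: G'_def G_def algebra_simps)
    qed
    have eg: "exp (g x) * exp (t * S x) = exp (- (s * (real N * p' t))) * exp ((t + s) * S x)" for x
      by (simp add: g_def mult_exp_exp algebra_simps)
    have gm[measurable]: "(\<lambda>x. exp (g x)) \<in> borel_measurable A" unfolding g_def by measurable
    have i2: "integrable (Q t) (\<lambda>x. exp (g x))"
      unfolding integrable_Q_iff[OF gm] eg by (intro integrable_mult_right integrable_exp_S)
    have "(LINT x|Q t. exp (g x)) = exp (- (s * (real N * p' t))) * L (t + s) ^ N / L t ^ N"
      unfolding integral_Q[OF gm] eg by (simp add: integral_exp_S)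
    also have "\<dots> = exp (real N * (p (t + s) - p t - s * p' t))"
      by (simp add: exp_p[symmetric] exp_of_nat_mult[symmetric] mult_exp_exp exp_diff[symmetric] algebra_simps)
    finally have e2: "ln (LINT x|Q t. exp (g x)) = real N * (p (t + s) - p t - s * p' t)" by simp
    have "p (t + s) - p t - s * p' t \<le> sigma2 / 2 * s\<^sup>2" using subgaussian[of "t + s" t] by (simp add: mult.commute)
    then have "G t * (real N * (p (t + s) - p t - s * p' t)) \<le> G t * (real N * (sigma2 / 2 * s\<^sup>2))"
      using G by (intro mult_left_mono) auto
    then show ?thesis
      using ent_variational[OF prob_space_Q FQ i1 i2] unfolding e1 e2 Gt by linarith
  qed
  \<comment> \<open>This multiple of \<open>S\<close> maximises the difference of the two sides of \<open>key\<close>.\<close>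
  define s where "s = G' t / (G t * (real N * sigma2))"
  have n0: "0 < real N * sigma2" using N_pos sigma2_pos by simp
  define X where "X = (G' t)\<^sup>2 / G t / (real N * sigma2)"
  have e1: "s * G' t = X" by (simp add: s_def X_def power2_eq_square)
  have e2: "G t * (real N * (sigma2 / 2 * s\<^sup>2)) = X / 2"
    unfolding s_def X_def using G N_pos sigma2_pos by (simp add: power2_eq_square field_simps)
  have "X \<le> 2 * ent (Q t) F" using key[of s] unfolding e1 e2 by simp
  then have "(G' t)\<^sup>2 / G t \<le> 2 * ent (Q t) F * (real N * sigma2)"
    unfolding X_def using n0 by (simp only: pos_divide_le_eq[of "real N * sigma2"])
  then show ?thesis by (simp only: mult_ac)
qed

text \<open>The entropy splits into the entropies under the product measures and the entropy of the
  conditional means under the mixing measure. The potential of the mixing measure is strongly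
  convex with constant \<open>N * (T - sigma2)\<close>.\<close>

lemma ent_m_le:
  assumes F: "pos_bounded A F"
  shows "ent m F \<le> T / (T - sigma2) * (LINT t|nu. ent (Q t) F)"
    and "integrable nu (\<lambda>t. ent (Q t) F)"
proof -
  obtain e B where Fm[measurable]: "F \<in> borel_measurable A" and e: "0 < e" "0 < B"
    "\<And>x. x \<in> Rn N \<Longrightarrow> e \<le> F x" "\<And>x. x \<in> Rn N \<Longrightarrow> F x \<le> B"
    using F by (rule pos_boundedE) (auto simp: space_A)
  have absB: "\<bar>F x\<bar> \<le> B" if "x \<in> Rn N" for x using e(1) e(3,4)[OF that] by linarith
  define G where "G t = (LINT x|Q t. F x)" for t
  define G' where "G' t = (LINT x|Q t. F x * S x) - G t * (real N * p' t)" for t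
  note d = mixing_mean_deriv(2,3)[OF Fm absB, folded G_def, folded G'_def]
  have G'm[measurable]: "G' \<in> borel_measurable borel" using d(2) by (rule borel_measurable_continuous_onI)
  have Gm[measurable]: "G \<in> borel_measurable borel" unfolding G_def by measurable
  have cs: "(G' t)\<^sup>2 / G t \<le> 2 * (real N * sigma2) * ent (Q t) F" for t
    using covariance_sq_le_ent[OF F, of t] by (simp add: G'_def G_def)
  have Gb: "e \<le> G t" "G t \<le> B" for t
    using integral_between[OF prob_space_Q[of t] integrable_Q_bounded(1)[OF Fm absB, of t], of e B] e
    by (auto simp: G_def space_Q)
  have Gnu: "pos_bounded nu G" using Gb e(1) by (intro pos_boundedI[of _ _ e B]) auto
  have FlF: "\<bar>F x * ln (F x)\<bar> \<le> B * (\<bar>ln e\<bar> + \<bar>ln B\<bar>)" if "x \<in> Rn N" for x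
    using absB[OF that] abs_ln_between[OF e(1) e(3)[OF that] e(4)[OF that]] e(2)
    by (simp add: abs_mult mult_mono)
  have FlFm[measurable]: "(\<lambda>x. F x * ln (F x)) \<in> borel_measurable A" by measurable
  have entm[measurable]: "(\<lambda>t. ent (Q t) F) \<in> borel_measurable borel"
    unfolding ent_def by measurable
  have entb: "\<bar>ent (Q t) F\<bar> \<le> 2 * (\<bar>B\<bar> * (\<bar>ln e\<bar> + \<bar>ln B\<bar>))" for t
    by (rule abs_ent_le[OF prob_space_Q]) (use e in \<open>auto simp: space_Q cong: measurable_cong_sets\<close>)
  show ie: "integrable nu (\<lambda>t. ent (Q t) F)"
    by (rule integrable_bounded[OF nu.finite_measure_axioms _ entb]) simp
  have c: "0 < real N * (T - sigma2)" using N_pos T by simp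
  have cG: "0 \<le> (G' t)\<^sup>2 / G t" for t using Gb(1)[of t] e(1) by simp
  have iG': "integrable nu (\<lambda>t. (G' t)\<^sup>2 / G t)"
  proof (rule Bochner_Integration.integrable_bound[OF integrable_mult_right[OF ie, of "2 * (real N * sigma2)"]])
    show "AE t in nu. norm ((G' t)\<^sup>2 / G t) \<le> norm (2 * (real N * sigma2) * ent (Q t) F)"
    proof (rule AE_I2)
      fix t
      have "norm ((G' t)\<^sup>2 / G t) = (G' t)\<^sup>2 / G t" using cG[of t] by (simp only: real_norm_def abs_of_nonneg)
      also have "\<dots> \<le> norm (2 * (real N * sigma2) * ent (Q t) F)"
        unfolding real_norm_def by (rule order_trans[OF cs abs_ge_self])
      finally show "norm ((G' t)\<^sup>2 / G t) \<le> norm (2 * (real N * sigma2) * ent (Q t) F)" .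
    qed
  qed simp
  have Ud: "(U has_real_derivative U' t) (at t)" for t
    unfolding U_def U'_def by (auto intro!: derivative_eq_intros p_deriv)
  have Uc: "U s + U' s * (t - s) + (real N * (T - sigma2)) / 2 * (t - s)\<^sup>2 \<le> U t" for s t
  proof -
    have "real N * (p t - p s - p' s * (t - s) - sigma2 / 2 * (t - s)\<^sup>2) \<le> real N * 0"
      using subgaussian[of t s] by (intro mult_left_mono) auto
    then show ?thesis by (simp add: U_def U'_def power2_eq_square field_simps)
  qed
  have "ent nu G \<le> 1 / (2 * (real N * (T - sigma2))) * (LINT t|nu. (G' t)\<^sup>2 / G t)"
    using log_sobolev_real[OF prob_space_nu[unfolded nu_def] c Ud Uc d(1,2) Gnu[unfolded nu_def] iG'[unfolded nu_def]]
    by (simp only: nu_def)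
  also have "\<dots> \<le> 1 / (2 * (real N * (T - sigma2))) * (LINT t|nu. 2 * (real N * sigma2) * ent (Q t) F)"
    using c iG' ie cs by (intro mult_left_mono integral_mono integrable_mult_right) auto
  also have "\<dots> = sigma2 / (T - sigma2) * (LINT t|nu. ent (Q t) F)"
    using N_pos T by (simp add: field_simps)
  finally have entG: "ent nu G \<le> sigma2 / (T - sigma2) * (LINT t|nu. ent (Q t) F)" .
  have m1: "(LINT x|m. F x) = (LINT t|nu. G t)" unfolding G_def by (rule integral_m[OF Fm absB])
  have m2: "(LINT x|m. F x * ln (F x)) = (LINT t|nu. LINT x|Q t. F x * ln (F x))"
    by (rule integral_m[OF FlFm FlF])
  have "(LINT t|nu. LINT x|Q t. F x * ln (F x)) = (LINT t|nu. ent (Q t) F + G t * ln (G t))"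
    by (simp add: ent_def G_def)
  also have "\<dots> = (LINT t|nu. ent (Q t) F) + (LINT t|nu. G t * ln (G t))"
    by (rule Bochner_Integration.integral_add[OF ie pos_bounded_integrable(2)[OF prob_space_nu Gnu]])
  finally have "ent m F = (LINT t|nu. ent (Q t) F) + ent nu G"
    by (simp add: ent_def[of m] ent_def[of nu] m1 m2)
  also have "\<dots> \<le> (1 + sigma2 / (T - sigma2)) * (LINT t|nu. ent (Q t) F)"
    using entG by (simp add: distrib_right)
  also have "1 + sigma2 / (T - sigma2) = T / (T - sigma2)" using T by (simp add: field_simps)
  finally show "ent m F \<le> T / (T - sigma2) * (LINT t|nu. ent (Q t) F)" .
qed

text \<open>Tensorisation adds the inequalities for the single coordinates, all with the same constant, so
  no dependence on \<open>N\<close> arises.\<close>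

lemma ent_m_gradient_le:
  fixes F :: "(nat \<Rightarrow> real) \<Rightarrow> real" and D :: "nat \<Rightarrow> (nat \<Rightarrow> real) \<Rightarrow> real"
  assumes k: "tilt_log_sobolev \<kappa>"
    and Fm[measurable]: "F \<in> borel_measurable A" and e: "0 < e" "\<And>x. x \<in> Rn N \<Longrightarrow> e \<le> F x"
    and B: "\<And>x. x \<in> Rn N \<Longrightarrow> F x \<le> B"
    and Dm: "\<And>i. i < N \<Longrightarrow> D i \<in> borel_measurable A"
    and D: "\<And>i x t. i < N \<Longrightarrow> x \<in> Rn N \<Longrightarrow> ((\<lambda>s. F (x(i := s))) has_real_derivative D i (x(i := t))) (at t)"
    and Dc: "\<And>i x. i < N \<Longrightarrow> x \<in> Rn N \<Longrightarrow> continuous_on UNIV (\<lambda>t. D i (x(i := t)))"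
    and DC: "\<And>i x. i < N \<Longrightarrow> x \<in> Rn N \<Longrightarrow> \<bar>D i x\<bar> \<le> C"
  shows "ent m F \<le> T / (T - sigma2) * \<kappa> * (LINT x|m. (\<Sum>i<N. (D i x)\<^sup>2 / F x))"
proof -
  have \<kappa>: "0 < \<kappa>" using k by (simp add: tilt_log_sobolev_def)
  have F: "pos_bounded A F" using e B by (intro pos_boundedI[of _ _ e B]) (auto simp: space_A)
  define I where "I i x = (D i x)\<^sup>2 / F x" for i x
  have Im: "I i \<in> borel_measurable A" if "i < N" for i
  proof -
    have [measurable]: "D i \<in> borel_measurable A" by (rule Dm[OF that])
    show ?thesis unfolding I_def by measurable
  qed
  have Ib: "0 \<le> I i x" "\<bar>I i x\<bar> \<le> C\<^sup>2 / e" if "i < N" "x \<in> Rn N" for i x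
  proof -
    show 0: "0 \<le> I i x" using e(1) e(2)[OF that(2)] by (simp add: I_def)
    have "\<bar>D i x\<bar> \<le> \<bar>C\<bar>" using DC[OF that] by linarith
    then have "(D i x)\<^sup>2 \<le> C\<^sup>2" by (simp add: abs_le_square_iff)
    then have "I i x \<le> C\<^sup>2 / e" unfolding I_def using e(1) e(2)[OF that(2)] by (intro frac_le) auto
    then show "\<bar>I i x\<bar> \<le> C\<^sup>2 / e" using 0 by simp
  qed
  have SIb: "\<bar>\<Sum>i<N. I i x\<bar> \<le> real N * (C\<^sup>2 / e)" if "x \<in> Rn N" for x
  proof -
    have "\<bar>\<Sum>i<N. I i x\<bar> \<le> (\<Sum>i<N. \<bar>I i x\<bar>)" by (rule sum_abs)
    also have "\<dots> \<le> (\<Sum>i<N. C\<^sup>2 / e)" using Ib(2) that by (intro sum_mono) auto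
    finally show ?thesis by simp
  qed
  have SIm[measurable]: "(\<lambda>x. \<Sum>i<N. I i x) \<in> borel_measurable A" using Im by (intro borel_measurable_sum) auto
  have ent_Q: "ent (Q t) F \<le> \<kappa> * (LINT x|Q t. (\<Sum>i<N. I i x))" for t
  proof -
    have FQ: "pos_bounded (Q t) F" using F e B
      by (intro pos_boundedI[of _ _ e B]) (auto simp: space_Q cong: measurable_cong_sets)
    have "ent (Q t) F \<le> (\<Sum>i<N. LINT x|Q t. ent (tilt t) (\<lambda>s. F (x(i := s))))"
      by (rule ent_PiM_le[OF _ prob_space_tilt FQ]) simp
    also have "\<dots> \<le> (\<Sum>i<N. \<kappa> * (LINT x|Q t. I i x))"
    proof (rule sum_mono)
      fix i assume "i \<in> {..<N}" then have i: "i < N" by simp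
      have ImQ: "I i \<in> borel_measurable (Q t)" using Im[OF i] by (simp cong: measurable_cong_sets)
      have IbQ: "\<bar>I i x\<bar> \<le> C\<^sup>2 / e" if "x \<in> space (Q t)" for x using Ib(2)[OF i] that by (simp add: space_Q)
      note upd = integral_PiM_update[OF finite_lessThan _ prob_space_tilt ImQ IbQ]
      have le: "ent (tilt t) (\<lambda>s. F (x(i := s))) \<le> \<kappa> * (LINT s|tilt t. I i (x(i := s)))" if x: "x \<in> Rn N" for x
      proof -
        have Fx: "continuous_on UNIV (\<lambda>s. F (x(i := s)))"
          using D[OF i x] DERIV_isCont continuous_at_imp_continuous_on by blast
        have "pos_bounded (tilt t) (\<lambda>s. F (x(i := s)))"
        proof (rule pos_boundedI[of _ _ e B])
          show "(\<lambda>s. F (x(i := s))) \<in> borel_measurable (tilt t)"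
            using borel_measurable_continuous_onI[OF Fx] by (simp cong: measurable_cong_sets)
        qed (use e B upd_Rn[OF x i] in auto)
        moreover have "bounded (range (\<lambda>s. D i (x(i := s))))"
          using DC[OF i upd_Rn[OF x i]] by (auto simp: bounded_iff)
        ultimately show ?thesis
          unfolding I_def using D[OF i x] Dc[OF i x]
          by (intro tilt_log_sobolevD[OF k, of "\<lambda>s. F (x(i := s))" "\<lambda>s. D i (x(i := s))" t])
      qed
      have "(LINT x|Q t. ent (tilt t) (\<lambda>s. F (x(i := s)))) \<le> (LINT x|Q t. \<kappa> * (LINT s|tilt t. I i (x(i := s))))"
      proof (rule integral_mono')
        show "integrable (Q t) (\<lambda>x. \<kappa> * (LINT s|tilt t. I i (x(i := s))))"
          using upd(2) i by (intro integrable_mult_right) auto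
        show "0 \<le> \<kappa> * (LINT s|tilt t. I i (x(i := s)))" if "x \<in> space (Q t)" for x
        proof -
          have "0 \<le> (LINT s|tilt t. I i (x(i := s)))"
            using Ib(1)[OF i] upd_Rn[of x N i] that i by (intro integral_nonneg_AE AE_I2) (auto simp: space_Q)
          then show ?thesis using \<kappa> by simp
        qed
      qed (use le in \<open>auto simp: space_Q\<close>)
      also have "\<dots> = \<kappa> * (LINT x|Q t. I i x)" using upd(1) i by simp
      finally show "(LINT x|Q t. ent (tilt t) (\<lambda>s. F (x(i := s)))) \<le> \<kappa> * (LINT x|Q t. I i x)" .
    qed
    also have "\<dots> = \<kappa> * (LINT x|Q t. (\<Sum>i<N. I i x))"
    proof -
      have "integrable (Q t) (I i)" if "i < N" for i
        by (rule integrable_Q_bounded(1)[OF Im[OF that] Ib(2)[OF that]])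
      then show ?thesis by (simp add: sum_distrib_left[symmetric])
    qed
    finally show ?thesis .
  qed
  have iSI: "integrable nu (\<lambda>t. LINT x|Q t. (\<Sum>i<N. I i x))"
    by (rule integrable_bounded[OF nu.finite_measure_axioms _ integrable_Q_bounded(2)[OF SIm SIb]]) simp
  have "(LINT t|nu. ent (Q t) F) \<le> (LINT t|nu. \<kappa> * (LINT x|Q t. (\<Sum>i<N. I i x)))"
    using ent_Q by (intro integral_mono ent_m_le(2)[OF F] integrable_mult_right iSI)
  also have "\<dots> = \<kappa> * (LINT x|m. (\<Sum>i<N. I i x))"
    by (simp add: integral_m[OF SIm SIb])
  finally have "T / (T - sigma2) * (LINT t|nu. ent (Q t) F) \<le> T / (T - sigma2) * (\<kappa> * (LINT x|m. (\<Sum>i<N. I i x)))"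
    using T T_pos by (intro mult_left_mono) auto
  with ent_m_le(1)[OF F] show ?thesis by (simp add: I_def)
qed

text \<open>The inequality applies to \<open>F + \<epsilon>\<close>, which is bounded away from \<open>0\<close>; then \<open>\<epsilon>\<close> tends to \<open>0\<close>.\<close>

lemma log_sobolev_m:
  assumes k: "tilt_log_sobolev \<kappa>"
  shows "log_sobolev N m ((T - sigma2) / (2 * T * \<kappa>))"
proof -
  have \<kappa>: "0 < \<kappa>" using k by (simp add: tilt_log_sobolev_def)
  define C where "C = T / (T - sigma2) * \<kappa>"
  have C: "0 < C" using T T_pos \<kappa> by (simp add: C_def)
  have "Ent m F \<le> 2 / ((T - sigma2) / (2 * T * \<kappa>)) * (LINT x|m. grad_norm_sq N (\<lambda>y. sqrt (F y)) x)"
    if F: "smooth N F" "compactly_supported N F" and pos: "\<And>x. x \<in> Rn N \<Longrightarrow> 0 \<le> F x" for F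
  proof -
    obtain B where B: "0 < B" "\<And>x. x \<in> Rn N \<Longrightarrow> F x \<le> B"
      "\<And>i x. i < N \<Longrightarrow> x \<in> Rn N \<Longrightarrow> \<bar>partial_deriv i F x\<bar> \<le> B"
      "\<And>i x. i < N \<Longrightarrow> x \<in> Rn N \<Longrightarrow> (partial_deriv i F x)\<^sup>2 \<le> B * F x"
      using smooth_bounds[OF F pos] by blast
    have "Ck N (Suc 0) F" using F unfolding smooth_def by blast
    then have Fc: "continuous_on (Rn N) F"
      and pd: "\<And>i x. i < N \<Longrightarrow> x \<in> Rn N \<Longrightarrow> partially_differentiable i F x"
      and Dc: "\<And>i. i < N \<Longrightarrow> continuous_on (Rn N) (partial_deriv i F)" by auto
    have Fm[measurable]: "F \<in> borel_measurable A" by (rule borel_measurable_continuous_on_Rn[OF Fc]) simp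
    have Dm: "partial_deriv i F \<in> borel_measurable A" if "i < N" for i
      by (rule borel_measurable_continuous_on_Rn[OF Dc[OF that]]) simp
    have absB: "\<bar>F x\<bar> \<le> B" if "x \<in> Rn N" for x using pos[OF that] B(2)[OF that] by simp
    define I where "I x = (\<Sum>i<N. (partial_deriv i F x)\<^sup>2 / F x)" for x
    have Im[measurable]: "I \<in> borel_measurable A"
      unfolding I_def using Dm by (intro borel_measurable_sum borel_measurable_divide borel_measurable_power Fm) auto
    have It: "(partial_deriv i F x)\<^sup>2 / F x \<le> B" "0 \<le> (partial_deriv i F x)\<^sup>2 / F x" if "i < N" "x \<in> Rn N" for i x
      using B(1) B(4)[OF that] pos[OF that(2)] by (cases "F x = 0"; simp add: divide_le_eq)+
    have Ib: "\<bar>I x\<bar> \<le> real N * B" if "x \<in> Rn N" for x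
    proof -
      have "\<bar>I x\<bar> = I x" unfolding I_def using It(2) that by (intro abs_of_nonneg sum_nonneg) auto
      also have "\<dots> \<le> (\<Sum>i<N. B)" unfolding I_def using It(1) that by (intro sum_mono) auto
      finally show ?thesis by simp
    qed
    have iI: "integrable m I"
      by (rule integrable_bounded[OF m.finite_measure_axioms _ Ib]) (auto simp: space_m cong: measurable_cong_sets)
    have grad: "grad_norm_sq N (\<lambda>y. sqrt (F y)) x = I x / 4" if x: "x \<in> Rn N" for x
    proof -
      have "(partial_deriv i (\<lambda>y. sqrt (F y)) x)\<^sup>2 = (partial_deriv i F x)\<^sup>2 / F x / 4" if "i < N" for i
        using partial_deriv_sqrt_sq[of i F x] pd[OF that] pos upd_Rn[OF x that] by simp
      then show ?thesis by (simp add: grad_norm_sq_def I_def sum_divide_distrib)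
    qed
    have gradI: "(LINT x|m. grad_norm_sq N (\<lambda>y. sqrt (F y)) x) = (LINT x|m. I x) / 4"
    proof -
      have "(LINT x|m. grad_norm_sq N (\<lambda>y. sqrt (F y)) x) = (LINT x|m. I x / 4)"
        by (intro Bochner_Integration.integral_cong refl) (simp add: space_m grad)
      then show ?thesis by simp
    qed
    define F' where "F' k x = F x + inverse (real (Suc k))" for k x
    have le: "ent m (F' k) \<le> C * (LINT x|m. I x)" for k
    proof -
      have "ent m (F' k) \<le> C * (LINT x|m. (\<Sum>i<N. (partial_deriv i F x)\<^sup>2 / F' k x))"
        unfolding C_def
      proof (rule ent_m_gradient_le[OF k])
        show "F' k \<in> borel_measurable A" unfolding F'_def by measurable
        show "0 < inverse (real (Suc k))" by simp
        show "inverse (real (Suc k)) \<le> F' k x" if "x \<in> Rn N" for x using pos[OF that] by (simp add: F'_def)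
        show "F' k x \<le> B + inverse (real (Suc k))" if "x \<in> Rn N" for x using B(2)[OF that] by (simp add: F'_def)
        show "((\<lambda>s. F' k (x(i := s))) has_real_derivative partial_deriv i F (x(i := t))) (at t)"
          if "i < N" "x \<in> Rn N" for i x t
          unfolding F'_def using partial_deriv_line[OF pd[OF that(1) upd_Rn[OF that(2,1)]]]
          by (auto intro!: derivative_eq_intros)
        show "continuous_on UNIV (\<lambda>t. partial_deriv i F (x(i := t)))" if "i < N" "x \<in> Rn N" for i x
          by (rule continuous_on_line[OF Dc[OF that(1)] that(2,1)])
      qed (use Dm B in auto)
      also have "\<dots> \<le> C * (LINT x|m. I x)"
      proof (intro mult_left_mono integral_mono')
        fix x assume "x \<in> space m" then have x: "x \<in> Rn N" by (simp add: space_m)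
        show "0 \<le> I x" unfolding I_def using It(2) x by (intro sum_nonneg) auto
        show "(\<Sum>i<N. (partial_deriv i F x)\<^sup>2 / F' k x) \<le> I x"
          unfolding I_def
        proof (rule sum_mono)
          fix i assume "i \<in> {..<N}"
          then have i: "i < N" by simp
          show "(partial_deriv i F x)\<^sup>2 / F' k x \<le> (partial_deriv i F x)\<^sup>2 / F x"
          proof (cases "F x = 0")
            case True
            then have "(partial_deriv i F x)\<^sup>2 = 0" using B(4)[OF i x] by simp
            then show ?thesis by simp
          next
            case False
            then have "0 < F x" using pos[OF x] by simp
            moreover have "F x \<le> F' k x" by (simp add: F'_def)
            ultimately show ?thesis by (intro divide_left_mono mult_pos_pos) auto
          qed
        qed
      qed (use iI C in auto)
      finally show ?thesis .
    qed
    have lim: "(\<lambda>k. ent m (F' k)) \<longlonglongrightarrow> ent m F"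
    proof -
      have h: "(\<lambda>k. inverse (real (Suc k))) \<longlonglongrightarrow> 0" by (rule LIMSEQ_inverse_real_of_nat)
      have ptw: "(\<lambda>k. F' k x) \<longlonglongrightarrow> F x" for x
        unfolding F'_def using tendsto_add[OF tendsto_const h, of "F x"] by simp
      have F'0: "0 \<le> F' k x" "F' k x \<le> B + 1" if "x \<in> Rn N" for k x
        using pos[OF that] B(2)[OF that] by (auto simp: F'_def inverse_le_1_iff intro: add_mono)
      have F'm[measurable]: "F' k \<in> borel_measurable A" for k unfolding F'_def by measurable
      have l1: "(\<lambda>k. LINT x|m. F' k x) \<longlonglongrightarrow> (LINT x|m. F x)"
      proof (rule integral_dominated_convergence[where w="\<lambda>_. B + 1"])
        show "AE x in m. norm (F' k x) \<le> B + 1" for k using F'0 by (auto intro!: AE_I2 simp: space_m)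
      qed (use ptw in \<open>auto cong: measurable_cong_sets\<close>)
      have l2: "(\<lambda>k. LINT x|m. F' k x * ln (F' k x)) \<longlonglongrightarrow> (LINT x|m. F x * ln (F x))"
      proof (rule integral_dominated_convergence[where w="\<lambda>_. 1 + (B + 1)\<^sup>2"])
        show "AE x in m. norm (F' k x * ln (F' k x)) \<le> 1 + (B + 1)\<^sup>2" for k
        proof (rule AE_I2)
          fix x assume "x \<in> space m" then have x: "x \<in> Rn N" by (simp add: space_m)
          have "(F' k x)\<^sup>2 \<le> (B + 1)\<^sup>2" using F'0[OF x] by (intro power_mono)
          then show "norm (F' k x * ln (F' k x)) \<le> 1 + (B + 1)\<^sup>2"
            using abs_x_ln_x_le[OF F'0(1)[OF x], of k] by simp
        qed
        show "AE x in m. (\<lambda>k. F' k x * ln (F' k x)) \<longlonglongrightarrow> F x * ln (F x)"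
          using ptw F'0 by (intro AE_I2 tendsto_x_ln_x) (auto simp: space_m)
      qed (auto cong: measurable_cong_sets)
      have "0 \<le> (LINT x|m. F' k x)" for k using F'0 by (intro integral_nonneg_AE AE_I2) (auto simp: space_m)
      from tendsto_diff[OF l2 tendsto_x_ln_x[OF l1 this]] show ?thesis by (simp add: ent_def)
    qed
    have "ent m F \<le> C * (LINT x|m. I x)"
      by (rule LIMSEQ_le_const2[OF lim]) (use le in auto)
    also have "\<dots> = 4 * C * (LINT x|m. grad_norm_sq N (\<lambda>y. sqrt (F y)) x)" by (simp add: gradI)
    also have "4 * C = 2 / ((T - sigma2) / (2 * T * \<kappa>))" by (simp add: C_def)
    finally show ?thesis by (simp add: ent_def Ent_def)
  qed
  moreover have "0 < (T - sigma2) / (2 * T * \<kappa>)" using T T_pos \<kappa> by simp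
  ultimately show ?thesis by (simp add: log_sobolev_def)
qed

end

section \<open>Smooth compactly supported test functions\<close>

primrec Ck_real :: "nat \<Rightarrow> (real \<Rightarrow> real) \<Rightarrow> bool" where
  "Ck_real 0 f \<longleftrightarrow> continuous_on UNIV f"
| "Ck_real (Suc k) f \<longleftrightarrow> (\<forall>x. f differentiable (at x)) \<and> Ck_real k (deriv f)"

lemma Ck_real_SucI:
  assumes f': "\<And>x. (f has_real_derivative f' x) (at x)" and k: "Ck_real k f'"
  shows "Ck_real (Suc k) f"
proof -
  have "deriv f = f'" using f' by (auto intro!: ext DERIV_imp_deriv)
  then show ?thesis using f' k by (auto simp: real_differentiable_def)
qed

lemma Ck_real_SucD:
  assumes "Ck_real (Suc k) f"
  shows "(f has_real_derivative deriv f x) (at x)" "Ck_real k (deriv f)"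
  using assms by (auto simp: DERIV_deriv_iff_real_differentiable)

lemma Ck_real_Suc_imp: "Ck_real (Suc k) f \<Longrightarrow> Ck_real k f"
proof (induction k arbitrary: f)
  case 0
  have "continuous_on UNIV f"
    by (rule DERIV_continuous_on, rule Ck_real_SucD(1)[OF 0])
  then show ?case by simp
next
  case (Suc k)
  then show ?case by simp
qed

lemma Ck_real_const: "Ck_real k (\<lambda>_. c)"
proof (induction k arbitrary: c)
  case (Suc k)
  then show ?case by (intro Ck_real_SucI[where f'="\<lambda>_. 0"]) auto
qed simp

lemma Ck_real_add: "Ck_real k f \<Longrightarrow> Ck_real k g \<Longrightarrow> Ck_real k (\<lambda>x. f x + g x)"
proof (induction k arbitrary: f g)
  case (Suc k)
  show ?case
    by (rule Ck_real_SucI[where f'="\<lambda>x. deriv f x + deriv g x"])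
      (use Ck_real_SucD[OF Suc.prems(1)] Ck_real_SucD[OF Suc.prems(2)] Suc.IH in \<open>auto intro!: DERIV_add\<close>)
qed (auto intro: continuous_intros)

lemma Ck_real_mult: "Ck_real k f \<Longrightarrow> Ck_real k g \<Longrightarrow> Ck_real k (\<lambda>x. f x * g x)"
proof (induction k arbitrary: f g)
  case (Suc k)
  note f = Ck_real_SucD[OF Suc.prems(1)] Ck_real_Suc_imp[OF Suc.prems(1)]
  note g = Ck_real_SucD[OF Suc.prems(2)] Ck_real_Suc_imp[OF Suc.prems(2)]
  show ?case
  proof (rule Ck_real_SucI)
    show "((\<lambda>x. f x * g x) has_real_derivative deriv f x * g x + deriv g x * f x) (at x)" for x
      by (rule DERIV_mult[OF f(1) g(1)])
    show "Ck_real k (\<lambda>x. deriv f x * g x + deriv g x * f x)"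
      by (rule Ck_real_add[OF Suc.IH[OF f(2) g(3)] Suc.IH[OF g(2) f(3)]])
  qed
qed (auto intro: continuous_intros)

lemma Ck_real_affine: "Ck_real k f \<Longrightarrow> Ck_real k (\<lambda>x. f (a * x + b))"
proof (induction k arbitrary: f)
  case 0
  then have "continuous_on UNIV f" by simp
  then have "continuous_on UNIV (\<lambda>x. f (a * x + b))"
    by (rule continuous_on_compose2) (auto intro!: continuous_intros)
  then show ?case by simp
next
  case (Suc k)
  note f = Ck_real_SucD[OF Suc.prems]
  show ?case
  proof (rule Ck_real_SucI)
    show "((\<lambda>x. f (a * x + b)) has_real_derivative deriv f (a * x + b) * a) (at x)" for x
      by (rule DERIV_chain2[OF f(1)]) (auto intro!: derivative_eq_intros)
    show "Ck_real k (\<lambda>x. deriv f (a * x + b) * a)"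
      by (rule Ck_real_mult[OF Suc.IH[OF f(2)] Ck_real_const])
  qed
qed

lemma Ck_real_exp: "Ck_real k (\<lambda>x. exp (a * x))"
proof (induction k)
  case 0
  then show ?case by (auto intro!: continuous_intros)
next
  case (Suc k)
  show ?case
  proof (rule Ck_real_SucI)
    show "((\<lambda>x. exp (a * x)) has_real_derivative exp (a * x) * a) (at x)" for x
      by (auto intro!: derivative_eq_intros)
    show "Ck_real k (\<lambda>x. exp (a * x) * a)" by (rule Ck_real_mult[OF Suc Ck_real_const])
  qed
qed

text \<open>The class of functions \<open>q (1 / t) * exp (- 1 / t)\<close>, \<open>q\<close> a polynomial, extended by \<open>0\<close>, is
  closed under differentiation.\<close>

definition flat_exp :: "real poly \<Rightarrow> real \<Rightarrow> real" where
  "flat_exp q t = (if 0 < t then poly q (1 / t) * exp (- (1 / t)) else 0)"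

lemma poly_times_exp_minus_tendsto_0:
  fixes q :: "real poly"
  shows "((\<lambda>s. poly q s * exp (- s)) \<longlongrightarrow> 0) at_top"
proof -
  have "((\<lambda>s. \<Sum>i\<le>degree q. coeff q i * (s ^ i / exp s)) \<longlongrightarrow> (\<Sum>i\<le>degree q. coeff q i * 0)) at_top"
    by (intro tendsto_sum tendsto_mult tendsto_const tendsto_power_div_exp_0)
  moreover have "(\<Sum>i\<le>degree q. coeff q i * (s ^ i / exp s)) = poly q s * exp (- s)" for s
    by (simp add: poly_altdef sum_distrib_right exp_minus divide_inverse mult.assoc)
  ultimately show ?thesis by simp
qed

lemma flat_exp_deriv:
  "(flat_exp q has_real_derivative flat_exp ([:0, 0, 1:] * (q - pderiv q)) t) (at t)"
proof (cases t "0 :: real" rule: linorder_cases)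
  case less
  have "((\<lambda>_. 0) has_real_derivative 0) (at t)" by simp
  then have "(flat_exp q has_real_derivative 0) (at t)"
    by (rule has_field_derivative_transform_within_open[of _ _ _ "{..<0}"]) (use less in \<open>auto simp: flat_exp_def\<close>)
  then show ?thesis using less by (simp add: flat_exp_def)
next
  case equal
  have "((\<lambda>s. (flat_exp q s - flat_exp q 0) / (s - 0)) \<longlongrightarrow> 0) (at 0)"
  proof (rule filterlim_split_at)
    have "\<forall>\<^sub>F s in at_left (0::real). (flat_exp q s - flat_exp q 0) / (s - 0) = 0"
      using eventually_at_left_real[of "-1" 0] by (auto elim!: eventually_mono simp: flat_exp_def)
    then show "((\<lambda>s. (flat_exp q s - flat_exp q 0) / (s - 0)) \<longlongrightarrow> 0) (at_left 0)"
      by (rule tendsto_eventually)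
    have "((\<lambda>s. poly ([:0, 1:] * q) (inverse s) * exp (- inverse s)) \<longlongrightarrow> 0) (at_right 0)"
      by (rule filterlim_compose[OF poly_times_exp_minus_tendsto_0 filterlim_inverse_at_top_right])
    moreover have "\<forall>\<^sub>F s in at_right (0::real). poly ([:0, 1:] * q) (inverse s) * exp (- inverse s) =
        (flat_exp q s - flat_exp q 0) / (s - 0)"
      using eventually_at_right_less[of "0::real"]
      by eventually_elim (simp add: flat_exp_def divide_inverse)
    ultimately show "((\<lambda>s. (flat_exp q s - flat_exp q 0) / (s - 0)) \<longlongrightarrow> 0) (at_right 0)"
      by (rule Lim_transform_eventually)
  qed
  then show ?thesis using equal by (simp add: has_field_derivative_iff flat_exp_def)
next
  case greater
  have "((\<lambda>t. poly q (1 / t) * exp (- (1 / t))) has_real_derivative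
     (poly (pderiv q) (1 / t) * (- 1 / t\<^sup>2)) * exp (- (1 / t)) + poly q (1 / t) * (exp (- (1 / t)) * (1 / t\<^sup>2))) (at t)"
    using greater
    by (auto intro!: derivative_eq_intros DERIV_chain2[OF poly_DERIV] simp: power2_eq_square)
  then have "(flat_exp q has_real_derivative
     (poly (pderiv q) (1 / t) * (- 1 / t\<^sup>2)) * exp (- (1 / t)) + poly q (1 / t) * (exp (- (1 / t)) * (1 / t\<^sup>2))) (at t)"
    by (rule has_field_derivative_transform_within_open[of _ _ _ "{0<..}"]) (use greater in \<open>auto simp: flat_exp_def\<close>)
  moreover have "(poly (pderiv q) (1 / t) * (- 1 / t\<^sup>2)) * exp (- (1 / t)) + poly q (1 / t) * (exp (- (1 / t)) * (1 / t\<^sup>2))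
     = flat_exp ([:0, 0, 1:] * (q - pderiv q)) t"
    using greater by (simp add: flat_exp_def power2_eq_square algebra_simps)
  ultimately show ?thesis by simp
qed

lemma Ck_real_flat_exp: "Ck_real k (flat_exp q)"
proof (induction k arbitrary: q)
  case 0
  have "continuous_on UNIV (flat_exp q)" by (rule DERIV_continuous_on, rule flat_exp_deriv)
  then show ?case by simp
next
  case (Suc k)
  show ?case by (rule Ck_real_SucI[OF flat_exp_deriv Suc])
qed

text \<open>The factor \<open>exp 2\<close> normalises the maximum, at \<open>0\<close>, to \<open>1\<close>. So \<open>bump (t / R)\<close> increases to \<open>1\<close> as
  \<open>R\<close> grows.\<close>

definition bump :: "real \<Rightarrow> real" where
  "bump t = exp 2 * (flat_exp 1 (1 * t + 1) * flat_exp 1 (- 1 * t + 1))"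

lemma Ck_real_bump: "Ck_real k bump"
  unfolding bump_def[abs_def]
  by (rule Ck_real_mult[OF Ck_real_const
        Ck_real_mult[OF Ck_real_affine[OF Ck_real_flat_exp] Ck_real_affine[OF Ck_real_flat_exp]]])

lemma bump_0: "bump 0 = 1"
  by (simp add: bump_def flat_exp_def mult_exp_exp)

lemma bump_eq_0: "1 \<le> \<bar>t\<bar> \<Longrightarrow> bump t = 0"
  by (auto simp: bump_def flat_exp_def)

lemma bump_bounds: "0 \<le> bump t" "bump t \<le> 1"
proof -
  show "0 \<le> bump t" by (simp add: bump_def flat_exp_def)
  show "bump t \<le> 1"
  proof (cases "\<bar>t\<bar> < 1")
    case True
    then have t: "0 < 1 + t" "0 < 1 - t" by auto
    have "1 / (1 + t) + 1 / (1 - t) = 2 / ((1 + t) * (1 - t))" using t by (simp add: field_simps)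
    moreover have "(1 + t) * (1 - t) \<le> 1" by (simp add: algebra_simps)
    then have "2 / 1 \<le> 2 / ((1 + t) * (1 - t))" using t by (intro divide_left_mono) auto
    ultimately have "2 - 1 / (1 + t) - 1 / (1 - t) \<le> 0" by simp
    moreover have "bump t = exp (2 - 1 / (1 + t) - 1 / (1 - t))"
      using t by (simp add: bump_def flat_exp_def mult_exp_exp add.commute)
    ultimately show ?thesis by simp
  next
    case False
    then show ?thesis by (simp add: bump_eq_0)
  qed
qed

lemma bump_deriv: "(bump has_real_derivative deriv bump t) (at t)"
  using Ck_real_SucD(1)[OF Ck_real_bump[of "Suc 0"]] .

lemma bump_cont: "continuous_on UNIV bump"
  by (rule DERIV_continuous_on, rule bump_deriv)

lemma deriv_bump_cont: "continuous_on UNIV (deriv bump)"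
  using Ck_real_SucD(2)[OF Ck_real_bump[of "Suc 0"]] by simp

lemma bump_deriv_bounded: "\<exists>C\<ge>0. \<forall>t. \<bar>deriv bump t\<bar> \<le> C"
proof -
  have "compact (deriv bump ` {-1..1})"
    by (intro compact_continuous_image continuous_on_subset[OF deriv_bump_cont]) auto
  then obtain C where C: "\<And>t. t \<in> {-1..1} \<Longrightarrow> \<bar>deriv bump t\<bar> \<le> C"
    using compact_imp_bounded bounded_real by (metis (no_types, lifting) imageI)
  have "deriv bump t = 0" if "t \<notin> {-1..1}" for t
  proof -
    have o: "open (- {-1..1::real})" by auto
    have "((\<lambda>_. 0) has_real_derivative 0) (at t)" by simp
    then have "(bump has_real_derivative 0) (at t)"
      by (rule has_field_derivative_transform_within_open[OF _ o]) (use that in \<open>auto simp: bump_eq_0\<close>)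
    then show ?thesis by (rule DERIV_imp_deriv)
  qed
  then have "\<bar>deriv bump t\<bar> \<le> max C 0" for t
    using C[of t] by (cases "t \<in> {-1..1}") auto
  then show ?thesis by (intro exI[of _ "max C 0"]) auto
qed

text \<open>Products of functions of one coordinate each. A partial derivative replaces one factor by its
  derivative, which keeps the form.\<close>

definition prodf :: "nat \<Rightarrow> (nat \<Rightarrow> real \<Rightarrow> real) \<Rightarrow> (nat \<Rightarrow> real) \<Rightarrow> real" where
  "prodf n f x = (\<Prod>i<n. f i (x i))"

lemma prodf_upd:
  assumes "i < n"
  shows "prodf n f (x(i := t)) = f i t * (\<Prod>j\<in>{..<n} - {i}. f j (x j))"
proof -
  have "prodf n f (x(i := t)) = f i t * (\<Prod>j\<in>{..<n} - {i}. f j ((x(i := t)) j))"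
    unfolding prodf_def using assms by (subst prod.remove[of _ i]) auto
  also have "(\<Prod>j\<in>{..<n} - {i}. f j ((x(i := t)) j)) = (\<Prod>j\<in>{..<n} - {i}. f j (x j))"
    by (intro prod.cong) auto
  finally show ?thesis .
qed

lemma prodf_fun_upd:
  assumes i: "i < n"
  shows "prodf n (f(i := h)) x = h (x i) * (\<Prod>j\<in>{..<n} - {i}. f j (x j))"
proof -
  have "prodf n (f(i := h)) x = prodf n (f(i := h)) (x(i := x i))" by simp
  also have "\<dots> = h (x i) * (\<Prod>j\<in>{..<n} - {i}. (f(i := h)) j (x j))"
    by (subst prodf_upd[OF i]) simp
  also have "(\<Prod>j\<in>{..<n} - {i}. (f(i := h)) j (x j)) = (\<Prod>j\<in>{..<n} - {i}. f j (x j))"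
    by (intro prod.cong refl) auto
  finally show ?thesis .
qed

lemma prodf_line_deriv:
  assumes "i < n" and d: "(f i has_real_derivative d) (at t)"
  shows "((\<lambda>s. prodf n f (x(i := s))) has_real_derivative d * (\<Prod>j\<in>{..<n} - {i}. f j (x j))) (at t)"
  unfolding prodf_upd[OF assms(1)] using d by (rule DERIV_cmult_right)

lemma partial_deriv_prodf:
  assumes i: "i < n" and d: "\<And>t. (f i has_real_derivative f' t) (at t)"
  shows "partially_differentiable i (prodf n f) x" "partial_deriv i (prodf n f) = prodf n (f(i := f'))"
proof -
  have D: "((\<lambda>s. prodf n f (x(i := s))) has_real_derivative prodf n (f(i := f')) x) (at (x i))" for x
    unfolding prodf_fun_upd[OF i]
    using prodf_line_deriv[of i n f "f' (x i)" "x i" x, OF i d] by simp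
  show pd: "partially_differentiable i (prodf n f) x" for x
    unfolding partially_differentiable_def using D real_differentiable_def by blast
  show "partial_deriv i (prodf n f) = prodf n (f(i := f'))"
    using pd D by (auto intro!: ext DERIV_imp_deriv simp: partial_deriv_def)
qed

lemma continuous_on_prodf:
  assumes "\<And>i. i < n \<Longrightarrow> continuous_on UNIV (f i)"
  shows "continuous_on (Rn n) (prodf n f)"
proof -
  have "continuous_on (Rn n) (\<lambda>x. f i (x i))" if "i < n" for i
  proof (rule continuous_on_compose2[OF assms[OF that]])
    show "continuous_on (Rn n) (\<lambda>x. x i)"
      by (rule continuous_on_subset[OF continuous_on_product_coordinates]) simp
  qed auto
  then show ?thesis unfolding prodf_def by (auto intro!: continuous_on_prod)
qed

lemma Ck_prodf: "(\<And>i k. i < n \<Longrightarrow> Ck_real k (f i)) \<Longrightarrow> Ck n k (prodf n f)"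
proof (induction k arbitrary: f)
  case 0
  then have "continuous_on (Rn n) (prodf n f)"
    using 0[where k=0] by (intro continuous_on_prodf) simp
  then show ?case by simp
next
  case (Suc k)
  have c: "continuous_on (Rn n) (prodf n f)"
    using Suc.prems[where k=0] by (intro continuous_on_prodf) simp
  have "(\<forall>x\<in>Rn n. partially_differentiable i (prodf n f) x) \<and> Ck n k (partial_deriv i (prodf n f))" if i: "i < n" for i
  proof -
    have d: "(f i has_real_derivative deriv (f i) t) (at t)" for t
      using Ck_real_SucD(1)[OF Suc.prems[OF i, of "Suc 0"]] .
    have "Ck n k (prodf n (f(i := deriv (f i))))"
    proof (rule Suc.IH)
      show "Ck_real k' ((f(i := deriv (f i))) j)" if "j < n" for j k'
        using Suc.prems[OF that, of k'] Ck_real_SucD(2)[OF Suc.prems[OF i, of "Suc k'"]] by simp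
    qed
    then show ?thesis using partial_deriv_prodf[of i n f, OF i d] by simp
  qed
  then show ?case using c by simp
qed

lemma smooth_prodf: "(\<And>i k. i < n \<Longrightarrow> Ck_real k (f i)) \<Longrightarrow> smooth n (prodf n f)"
  unfolding smooth_def using Ck_prodf by blast

lemma compact_cube: "compact (PiE {..<n} (\<lambda>_. {-R..R :: real}))"
proof -
  have "compactin (product_topology (\<lambda>i. euclidean) UNIV)
      (PiE UNIV (\<lambda>i. if i < n then {-R..R} else {undefined :: real}))"
    by (subst compactin_PiE) auto
  moreover have "PiE UNIV (\<lambda>i. if i < n then {-R..R} else {undefined :: real}) = PiE {..<n} (\<lambda>_. {-R..R})"
    by (auto simp: PiE_def Pi_def extensional_def split: if_splits)
  ultimately show ?thesis by (simp add: euclidean_product_topology)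
qed

lemma compactly_supported_prodf:
  assumes "\<And>i t. i < n \<Longrightarrow> R < \<bar>t\<bar> \<Longrightarrow> f i t = 0"
  shows "compactly_supported n (prodf n f)"
  unfolding compactly_supported_def
proof (intro exI conjI ballI)
  show "compact (PiE {..<n} (\<lambda>_. {-R..R}))" by (rule compact_cube)
  fix x assume x: "x \<in> Rn n - PiE {..<n} (\<lambda>_. {-R..R})"
  then obtain i where i: "i < n" "x i \<notin> {-R..R}" by (auto simp: PiE_def Pi_def)
  then have "f i (x i) = 0" using assms[of i "x i"] by auto
  then show "prodf n f x = 0" unfolding prodf_def using i by (intro prod_zero) auto
qed auto

section \<open>The upper bound on the log-Sobolev constant\<close>

context high_temperature
begin

lemma integrable_exp_mixing_weight: "integrable lborel (\<lambda>s. exp (c * s) * mixing_weight s)"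
proof (rule Bochner_Integration.integrable_bound)
  show "integrable lborel (\<lambda>s. exp (c * s - (real N * (T - sigma2)) * s\<^sup>2 / 2))"
    using has_bochner_integral_gaussian[of "real N * (T - sigma2)" c] T N_pos
    by (simp add: has_bochner_integral_iff)
  show "AE s in lborel. norm (exp (c * s) * mixing_weight s) \<le> norm (exp (c * s - (real N * (T - sigma2)) * s\<^sup>2 / 2))"
  proof (rule AE_I2)
    fix s
    have "exp (c * s) * mixing_weight s \<le> exp (c * s) * exp (0 * s - (real N * (T - sigma2)) * s\<^sup>2 / 2)"
      by (intro mult_left_mono mixing_weight_le) auto
    also have "\<dots> = exp (c * s - (real N * (T - sigma2)) * s\<^sup>2 / 2)" by (simp add: mult_exp_exp)
    finally show "norm (exp (c * s) * mixing_weight s) \<le> norm (exp (c * s - (real N * (T - sigma2)) * s\<^sup>2 / 2))"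
      using mixing_weight_pos[of s] by (simp add: abs_mult)
  qed
qed simp

text \<open>Given the field \<open>s\<close>, the mean of \<open>exp (t S)\<close> is \<open>(L (s + t) / L s) ^ N\<close>. Translating the field by
  \<open>t\<close> moves \<open>t\<close> into the Gaussian factor of the mixing weight.\<close>

lemma exp_S_moment:
  "has_bochner_integral m (\<lambda>x. exp (t * S x))
     (exp (- (real N * T * t\<^sup>2 / 2)) * (LINT s|lborel. exp (real N * T * t * s) * mixing_weight s) / Zn)"
proof (rule has_bochner_integral_nn_integral)
  let ?r = "exp (- (real N * T * t\<^sup>2 / 2)) * (LINT s|lborel. exp (real N * T * t * s) * mixing_weight s) / Zn"
  show "(\<lambda>x. exp (t * S x)) \<in> borel_measurable m" by measurable
  show "AE x in m. 0 \<le> exp (t * S x)" by simp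
  show "0 \<le> ?r" using Zn_pos mixing_weight_pos by (intro divide_nonneg_pos mult_nonneg_nonneg integral_nonneg_AE AE_I2) (auto simp: less_imp_le)
  have e: "exp (t * S x) * exp (s * S x) = exp ((s + t) * S x)" for s x
    by (simp add: mult_exp_exp algebra_simps)
  have Qi: "integrable (Q s) (\<lambda>x. exp (t * S x))" for s
    by (subst integrable_Q_iff) (simp_all add: e integrable_exp_S)
  have Qe: "(LINT x|Q s. exp (t * S x)) = L (s + t) ^ N / L s ^ N" for s
    by (subst integral_Q) (simp_all add: e integral_exp_S)
  have "(\<integral>\<^sup>+x. ennreal (exp (t * S x)) \<partial>m) = (\<integral>\<^sup>+s. \<integral>\<^sup>+x. ennreal (exp (t * S x)) \<partial>Q s \<partial>nu)"
    by (rule nn_integral_m) measurable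
  also have "\<dots> = (\<integral>\<^sup>+s. ennreal (L (s + t) ^ N / L s ^ N) \<partial>nu)"
    by (simp add: nn_integral_eq_integral[OF Qi] Qe)
  also have "\<dots> = (\<integral>\<^sup>+s. ennreal (exp (- U s)) * ennreal (L (s + t) ^ N / L s ^ N) \<partial>lborel)"
    unfolding nu_def by (subst nn_integral_density) auto
  also have "\<dots> = (\<integral>\<^sup>+s. ennreal (exp (- (real N * T * s\<^sup>2 / 2)) * L (s + t) ^ N / Zn) \<partial>lborel)"
  proof (rule nn_integral_cong)
    fix s
    have "exp (- U s) * (L (s + t) ^ N / L s ^ N) = exp (- (real N * T * s\<^sup>2 / 2)) * L (s + t) ^ N / Zn"
      using L_pos[of s] unfolding exp_U mixing_weight_eq by simp
    moreover have "0 \<le> L (s + t) ^ N / L s ^ N" using L_power_pos by (simp add: less_imp_le)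
    ultimately show "ennreal (exp (- U s)) * ennreal (L (s + t) ^ N / L s ^ N) =
       ennreal (exp (- (real N * T * s\<^sup>2 / 2)) * L (s + t) ^ N / Zn)"
      by (subst ennreal_mult[symmetric]) auto
  qed
  also have "\<dots> = ennreal \<bar>1\<bar> * (\<integral>\<^sup>+s. ennreal (exp (- (real N * T * (- t + 1 * s)\<^sup>2 / 2)) * L (- t + 1 * s + t) ^ N / Zn) \<partial>lborel)"
    by (rule nn_integral_real_affine) auto
  also have "\<dots> = (\<integral>\<^sup>+s. ennreal (exp (- (real N * T * t\<^sup>2 / 2)) * (exp (real N * T * t * s) * mixing_weight s) / Zn) \<partial>lborel)"
  proof -
    have "exp (- (real N * T * (- t + 1 * s)\<^sup>2 / 2)) * L (- t + 1 * s + t) ^ N =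
        exp (- (real N * T * t\<^sup>2 / 2)) * (exp (real N * T * t * s) * mixing_weight s)" for s
    proof -
      have "- (real N * T * (- t + 1 * s)\<^sup>2 / 2) = - (real N * T * t\<^sup>2 / 2) + (real N * T * t * s + - (real N * T * s\<^sup>2 / 2))"
        by (simp add: power2_eq_square field_simps)
      then have E: "exp (- (real N * T * (- t + 1 * s)\<^sup>2 / 2)) =
          exp (- (real N * T * t\<^sup>2 / 2)) * (exp (real N * T * t * s) * exp (- (real N * T * s\<^sup>2 / 2)))"
        by (simp only: exp_add)
      show ?thesis unfolding E mixing_weight_eq by simp
    qed
    then show ?thesis by simp
  qed
  also have "\<dots> = ennreal (LINT s|lborel. exp (- (real N * T * t\<^sup>2 / 2)) * (exp (real N * T * t * s) * mixing_weight s) / Zn)"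
    using mixing_weight_pos Zn_pos integrable_exp_mixing_weight[of "real N * T * t"]
    by (intro nn_integral_eq_integral integrable_divide integrable_mult_right AE_I2) (auto simp: less_imp_le)
  also have "(LINT s|lborel. exp (- (real N * T * t\<^sup>2 / 2)) * (exp (real N * T * t * s) * mixing_weight s) / Zn) = ?r" by simp
  finally show "(\<integral>\<^sup>+x. ennreal (exp (t * S x)) \<partial>m) = ennreal ?r" .
qed

lemma integrable_m_exp_S: "integrable m (\<lambda>x. exp (t * S x))"
  using exp_S_moment by (auto simp: has_bochner_integral_iff)

text \<open>Differentiate both sides of the previous formula with respect to \<open>t\<close>.\<close>

lemma S_exp_S_moment:
  "integrable m (\<lambda>x. S x * exp (t * S x))"
  "(LINT x|m. S x * exp (t * S x)) = - (real N * T * t) * (LINT x|m. exp (t * S x)) +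
     exp (- (real N * T * t\<^sup>2 / 2)) * (real N * T) * (LINT s|lborel. s * (exp (real N * T * t * s) * mixing_weight s)) / Zn"
proof -
  have Sm: "S \<in> borel_measurable m" by measurable
  show "integrable m (\<lambda>x. S x * exp (t * S x))"
    using integrable_times_exp[of S m "\<lambda>_. 1" t] integrable_m_exp_S Sm by simp
  have d1: "((\<lambda>t. LINT x|m. exp (t * S x)) has_real_derivative (LINT x|m. S x * exp (t * S x))) (at t)"
    using has_real_derivative_exp_integral[of S m "\<lambda>_. 1" t] integrable_m_exp_S Sm by simp
  define J where "J c = (LINT s|lborel. exp (c * s) * mixing_weight s)" for c
  have J: "(J has_real_derivative (LINT s|lborel. s * (exp (c * s) * mixing_weight s))) (at c)" for c
  proof -
    have "((\<lambda>c. LINT s|lborel. mixing_weight s * exp (c * s)) has_real_derivative (LINT s|lborel. mixing_weight s * s * exp (c * s))) (at c)"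
      by (rule has_real_derivative_exp_integral) (use integrable_exp_mixing_weight in \<open>auto simp: mult.commute\<close>)
    then show ?thesis by (simp add: J_def[abs_def] mult_ac)
  qed
  have eq: "(\<lambda>t. LINT x|m. exp (t * S x)) = (\<lambda>t. exp (- (real N * T * t\<^sup>2 / 2)) * J (real N * T * t) / Zn)"
    using exp_S_moment by (auto simp: has_bochner_integral_iff J_def)
  have JJ: "((\<lambda>t. J (real N * T * t)) has_real_derivative (LINT s|lborel. s * (exp (real N * T * t * s) * mixing_weight s)) * (real N * T)) (at t)"
    by (rule DERIV_chain2[OF J]) (auto intro!: derivative_eq_intros)
  have E: "((\<lambda>t. exp (- (real N * T * t\<^sup>2 / 2))) has_real_derivative exp (- (real N * T * t\<^sup>2 / 2)) * (- (real N * T * t))) (at t)"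
    by (auto intro!: derivative_eq_intros)
  have d2: "((\<lambda>t. exp (- (real N * T * t\<^sup>2 / 2)) * J (real N * T * t) / Zn) has_real_derivative
     (exp (- (real N * T * t\<^sup>2 / 2)) * (- (real N * T * t)) * J (real N * T * t) +
      (LINT s|lborel. s * (exp (real N * T * t * s) * mixing_weight s)) * (real N * T) * exp (- (real N * T * t\<^sup>2 / 2))) / Zn) (at t)"
    by (rule DERIV_cdivide[OF DERIV_mult[OF E JJ]])
  have At: "(LINT x|m. exp (t * S x)) = exp (- (real N * T * t\<^sup>2 / 2)) * J (real N * T * t) / Zn"
    using eq by meson
  from DERIV_unique[OF d1[unfolded eq] d2]
  show "(LINT x|m. S x * exp (t * S x)) = - (real N * T * t) * (LINT x|m. exp (t * S x)) +
     exp (- (real N * T * t\<^sup>2 / 2)) * (real N * T) * (LINT s|lborel. s * (exp (real N * T * t * s) * mixing_weight s)) / Zn"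
    unfolding At by (simp add: add_divide_distrib diff_divide_distrib mult_ac)
qed

text \<open>The function \<open>exp (t S)\<close> is the limit of squares of products of the functions
  \<open>exp (t y / 2) * bump (y / R)\<close> of the coordinates \<open>y = x i\<close>, and all integrals converge by domination.\<close>

lemma log_sobolev_exp_S:
  assumes ls: "log_sobolev N m \<gamma>"
  shows "(LINT x|m. t * S x * exp (t * S x)) - (LINT x|m. exp (t * S x)) * ln (LINT x|m. exp (t * S x))
     \<le> 2 / \<gamma> * (real N * t\<^sup>2 / 4 * (LINT x|m. exp (t * S x)))"
proof -
  obtain C where C: "0 \<le> C" "\<And>y. \<bar>deriv bump y\<bar> \<le> C" using bump_deriv_bounded by blast
  define r where "r n = inverse (real (Suc n))" for n
  have r: "0 < r n" "r n \<le> 1" for n by (auto simp: r_def inverse_le_1_iff)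
  have rlim: "r \<longlonglongrightarrow> 0" unfolding r_def[abs_def] by (rule LIMSEQ_inverse_real_of_nat)
  define g where "g n y = exp (t / 2 * y) * bump (r n * y + 0)" for n y
  define g' where "g' n y = exp (t / 2 * y) * (t / 2) * bump (r n * y + 0) + deriv bump (r n * y + 0) * r n * exp (t / 2 * y)" for n y
  have gk: "Ck_real k (g n)" for n k
    unfolding g_def[abs_def] by (rule Ck_real_mult[OF Ck_real_exp Ck_real_affine[OF Ck_real_bump]])
  have gd: "(g n has_real_derivative g' n y) (at y)" for n y
  proof -
    have "((\<lambda>y. bump (r n * y + 0)) has_real_derivative deriv bump (r n * y + 0) * r n) (at y)"
      by (rule DERIV_chain2[OF bump_deriv]) (auto intro!: derivative_eq_intros)
    moreover have "((\<lambda>y. exp (t / 2 * y)) has_real_derivative exp (t / 2 * y) * (t / 2)) (at y)"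
      by (auto intro!: derivative_eq_intros)
    ultimately show ?thesis unfolding g_def[abs_def] g'_def by (intro DERIV_mult)
  qed
  have g0: "0 \<le> g n y" "g n y \<le> exp (t / 2 * y)" for n y
    using bump_bounds[of "r n * y + 0"] by (auto simp: g_def mult_left_le)
  define K where "K = \<bar>t\<bar> / 2 + C"
  have K: "0 \<le> K" using C by (simp add: K_def)
  have g'b: "\<bar>g' n y\<bar> \<le> K * exp (t / 2 * y)" for n y
  proof -
    have b: "\<bar>bump (r n * y + 0)\<bar> \<le> 1" using bump_bounds by (simp add: abs_le_iff order_trans[of _ 0])
    have "\<bar>g' n y\<bar> \<le> \<bar>exp (t / 2 * y) * (t / 2) * bump (r n * y + 0)\<bar> + \<bar>deriv bump (r n * y + 0) * r n * exp (t / 2 * y)\<bar>"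
      unfolding g'_def by (rule abs_triangle_ineq)
    also have "\<bar>exp (t / 2 * y) * (t / 2) * bump (r n * y + 0)\<bar> \<le> exp (t / 2 * y) * (\<bar>t\<bar> / 2) * 1"
      unfolding abs_mult using b by (intro mult_mono) auto
    also have "\<bar>deriv bump (r n * y + 0) * r n * exp (t / 2 * y)\<bar> \<le> C * 1 * exp (t / 2 * y)"
      unfolding abs_mult using r[of n] C by (intro mult_mono) auto
    finally show ?thesis by (simp add: K_def algebra_simps)
  qed
  have arg: "(\<lambda>n. r n * y + 0) \<longlonglongrightarrow> 0" for y
    using tendsto_mult[OF rlim tendsto_const, of y] by simp
  have bl: "(\<lambda>n. bump (r n * y + 0)) \<longlonglongrightarrow> 1" for y
    using continuous_on_tendsto_compose[OF bump_cont arg] by (simp add: bump_0)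
  have dbl: "(\<lambda>n. deriv bump (r n * y + 0)) \<longlonglongrightarrow> deriv bump 0" for y
    using continuous_on_tendsto_compose[OF deriv_bump_cont arg] by simp
  have gl: "(\<lambda>n. g n y) \<longlonglongrightarrow> exp (t / 2 * y)" for y
    unfolding g_def using tendsto_mult[OF tendsto_const bl, of "exp (t / 2 * y)"] by simp
  have g'l: "(\<lambda>n. g' n y) \<longlonglongrightarrow> t / 2 * exp (t / 2 * y)" for y
  proof -
    have "(\<lambda>n. g' n y) \<longlonglongrightarrow> exp (t / 2 * y) * (t / 2) * 1 + deriv bump 0 * 0 * exp (t / 2 * y)"
      unfolding g'_def by (intro tendsto_intros bl dbl rlim)
    then show ?thesis by (simp add: mult.commute)
  qed
  define F where "F n = prodf N (\<lambda>_ y. g n y * g n y)" for n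
  define P where "P n = prodf N (\<lambda>_. g n)" for n
  define P' where "P' n i = prodf N ((\<lambda>_. g n)(i := g' n))" for n i
  have eS2: "(\<Prod>i<N. exp (t / 2 * x i)) = exp (t / 2 * S x)" for x by (rule exp_S[symmetric])
  have FP: "F n x = (P n x)\<^sup>2" for n x
    by (simp add: F_def P_def prodf_def power2_eq_square prod.distrib)
  have P0: "0 \<le> P n x" for n x unfolding P_def prodf_def using g0 by (intro prod_nonneg) auto
  have sq: "(\<lambda>y. sqrt (F n y)) = P n" for n using P0 by (auto simp: FP)
  have Pb: "P n x \<le> exp (t / 2 * S x)" for n x
    unfolding P_def prodf_def eS2[symmetric] using g0 by (intro prod_mono) auto
  have P'b: "\<bar>P' n i x\<bar> \<le> K * exp (t / 2 * S x)" if i: "i < N" for n i x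
  proof -
    have "P' n i x = g' n (x i) * (\<Prod>j\<in>{..<N} - {i}. g n (x j))"
      unfolding P'_def by (rule prodf_fun_upd[OF i])
    then have "\<bar>P' n i x\<bar> = \<bar>g' n (x i)\<bar> * (\<Prod>j\<in>{..<N} - {i}. g n (x j))"
      using g0 by (simp add: abs_mult prod_nonneg)
    also have "\<dots> \<le> (K * exp (t / 2 * x i)) * (\<Prod>j\<in>{..<N} - {i}. exp (t / 2 * x j))"
      using g0 K by (intro mult_mono g'b prod_mono prod_nonneg) auto
    also have "\<dots> = K * (\<Prod>j<N. exp (t / 2 * x j))"
      using i by (simp add: prod.remove[of "{..<N}" i])
    finally show ?thesis by (simp only: eS2)
  qed
  have Pl: "(\<lambda>n. P n x) \<longlonglongrightarrow> exp (t / 2 * S x)" for x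
    unfolding P_def prodf_def eS2[symmetric] by (intro tendsto_prod gl)
  have P'l: "(\<lambda>n. P' n i x) \<longlonglongrightarrow> t / 2 * exp (t / 2 * S x)" if i: "i < N" for i x
  proof -
    have eq: "P' n i x = g' n (x i) * (\<Prod>j\<in>{..<N} - {i}. g n (x j))" for n
      unfolding P'_def by (rule prodf_fun_upd[OF i])
    have "(\<lambda>n. P' n i x) \<longlonglongrightarrow> (t / 2 * exp (t / 2 * x i)) * (\<Prod>j\<in>{..<N} - {i}. exp (t / 2 * x j))"
      unfolding eq by (intro tendsto_mult tendsto_prod gl g'l)
    also have "(t / 2 * exp (t / 2 * x i)) * (\<Prod>j\<in>{..<N} - {i}. exp (t / 2 * x j)) = t / 2 * (\<Prod>j<N. exp (t / 2 * x j))"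
      using i by (simp add: prod.remove[of "{..<N}" i])
    finally show ?thesis by (simp only: eS2)
  qed
  have e2: "(exp (t / 2 * S x))\<^sup>2 = exp (t * S x)" for x by (simp add: power2_eq_square mult_exp_exp)
  have Fb: "0 \<le> F n x" "F n x \<le> exp (t * S x)" for n x
    using power_mono[OF Pb[of n x] P0[of n x], of 2, unfolded e2] by (auto simp: FP)
  have Fl: "(\<lambda>n. F n x) \<longlonglongrightarrow> exp (t * S x)" for x
    unfolding FP e2[symmetric] by (intro tendsto_power Pl)
  have smF: "smooth N (F n)" for n
    unfolding F_def by (rule smooth_prodf, rule Ck_real_mult[OF gk gk])
  have csF: "compactly_supported N (F n)" for n
    unfolding F_def
  proof (rule compactly_supported_prodf[where R="real (Suc n)"])
    fix y assume "real (Suc n) < \<bar>y\<bar>"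
    then have "1 \<le> \<bar>r n * y + 0\<bar>"
      by (simp add: r_def abs_mult divide_inverse[symmetric] le_divide_eq mult.commute[of "inverse _"])
    then show "g n y * g n y = 0" by (simp add: g_def bump_eq_0)
  qed
  have grad: "grad_norm_sq N (\<lambda>y. sqrt (F n y)) x = (\<Sum>i<N. (P' n i x)\<^sup>2)" for n x
    unfolding grad_norm_sq_def sq
    by (intro sum.cong refl) (simp add: P_def P'_def partial_deriv_prodf(2)[of _ N "\<lambda>_. g n" "g' n", OF _ gd])
  have main: "Ent m (F n) \<le> 2 / \<gamma> * (LINT x|m. (\<Sum>i<N. (P' n i x)\<^sup>2))" for n
  proof -
    have "Ent m (F n) \<le> 2 / \<gamma> * (LINT x|m. grad_norm_sq N (\<lambda>y. sqrt (F n y)) x)"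
      using ls smF[of n] csF[of n] Fb(1) unfolding log_sobolev_def by blast
    then show ?thesis by (simp only: grad)
  qed
  have Fm[measurable]: "F n \<in> borel_measurable A" for n
  proof -
    have "Ck N 0 (F n)" using smF[of n] unfolding smooth_def by blast
    then show ?thesis by (intro borel_measurable_continuous_on_Rn) auto
  qed
  have P'm: "P' n i \<in> borel_measurable A" if i: "i < N" for n i
  proof -
    have "smooth N (P n)" unfolding P_def by (rule smooth_prodf, rule gk)
    then have "Ck N (Suc 0) (P n)" unfolding smooth_def by blast
    then have "continuous_on (Rn N) (partial_deriv i (P n))" using i by simp
    also have "partial_deriv i (P n) = P' n i"
      unfolding P_def P'_def by (rule partial_deriv_prodf(2)[OF i gd])
    finally show ?thesis by (intro borel_measurable_continuous_on_Rn) auto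
  qed
  have l1: "(\<lambda>n. LINT x|m. F n x) \<longlonglongrightarrow> (LINT x|m. exp (t * S x))"
    by (rule integral_dominated_convergence[where w="\<lambda>x. exp (t * S x)"])
      (use Fb Fl integrable_m_exp_S in \<open>auto cong: measurable_cong_sets\<close>)
  have l2: "(\<lambda>n. LINT x|m. F n x * ln (F n x)) \<longlonglongrightarrow> (LINT x|m. exp (t * S x) * ln (exp (t * S x)))"
  proof (rule integral_dominated_convergence[where w="\<lambda>x. 1 + exp (2 * t * S x)"])
    show "integrable m (\<lambda>x. 1 + exp (2 * t * S x))" using integrable_m_exp_S[of "2 * t"] by simp
    show "AE x in m. (\<lambda>n. F n x * ln (F n x)) \<longlonglongrightarrow> exp (t * S x) * ln (exp (t * S x))"
      using Fl Fb by (intro AE_I2 tendsto_x_ln_x)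
    show "AE x in m. norm (F n x * ln (F n x)) \<le> 1 + exp (2 * t * S x)" for n
    proof (rule AE_I2)
      fix x
      have "(F n x)\<^sup>2 \<le> (exp (t * S x))\<^sup>2" using Fb by (intro power_mono)
      also have "\<dots> = exp (2 * t * S x)" by (simp add: power2_eq_square mult_exp_exp)
      finally show "norm (F n x * ln (F n x)) \<le> 1 + exp (2 * t * S x)"
        using abs_x_ln_x_le[OF Fb(1)[of n x]] by simp
    qed
  qed (auto cong: measurable_cong_sets)
  have l3: "(\<lambda>n. LINT x|m. (\<Sum>i<N. (P' n i x)\<^sup>2)) \<longlonglongrightarrow> (LINT x|m. (\<Sum>i<N. (t / 2 * exp (t / 2 * S x))\<^sup>2))"
  proof (rule integral_dominated_convergence[where w="\<lambda>x. real N * K\<^sup>2 * exp (t * S x)"])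
    show "AE x in m. (\<lambda>n. \<Sum>i<N. (P' n i x)\<^sup>2) \<longlonglongrightarrow> (\<Sum>i<N. (t / 2 * exp (t / 2 * S x))\<^sup>2)"
      by (intro AE_I2 tendsto_sum tendsto_power P'l) auto
    show "AE x in m. norm (\<Sum>i<N. (P' n i x)\<^sup>2) \<le> real N * K\<^sup>2 * exp (t * S x)" for n
    proof (rule AE_I2)
      fix x
      have "(P' n i x)\<^sup>2 \<le> K\<^sup>2 * exp (t * S x)" if "i < N" for i
        using power_mono[OF P'b[OF that, of n x], of 2, unfolded power_mult_distrib e2] by simp
      then have "(\<Sum>i<N. (P' n i x)\<^sup>2) \<le> (\<Sum>i<N. K\<^sup>2 * exp (t * S x))" by (intro sum_mono) auto
      then show "norm (\<Sum>i<N. (P' n i x)\<^sup>2) \<le> real N * K\<^sup>2 * exp (t * S x)"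
        by (simp add: sum_nonneg)
    qed
    show "(\<lambda>x. \<Sum>i<N. (P' n i x)\<^sup>2) \<in> borel_measurable m" for n
    proof -
      have "(\<lambda>x. \<Sum>i<N. (P' n i x)\<^sup>2) \<in> borel_measurable A" using P'm by (intro borel_measurable_sum borel_measurable_power) auto
      then show ?thesis by (simp cong: measurable_cong_sets)
    qed
  qed (use integrable_m_exp_S in \<open>auto cong: measurable_cong_sets\<close>)
  have "0 \<le> (LINT x|m. F n x)" for n using Fb by (intro integral_nonneg_AE AE_I2)
  from tendsto_diff[OF l2 tendsto_x_ln_x[OF l1 this]]
  have "(\<lambda>n. Ent m (F n)) \<longlonglongrightarrow> (LINT x|m. exp (t * S x) * ln (exp (t * S x))) - (LINT x|m. exp (t * S x)) * ln (LINT x|m. exp (t * S x))"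
    by (simp only: Ent_def)
  from LIMSEQ_le[OF this tendsto_mult_left[OF l3, of "2 / \<gamma>"]] main
  have "(LINT x|m. exp (t * S x) * ln (exp (t * S x))) - (LINT x|m. exp (t * S x)) * ln (LINT x|m. exp (t * S x))
     \<le> 2 / \<gamma> * (LINT x|m. (\<Sum>i<N. (t / 2 * exp (t / 2 * S x))\<^sup>2))" by blast
  moreover have "(LINT x|m. (\<Sum>i<N. (t / 2 * exp (t / 2 * S x))\<^sup>2)) = real N * t\<^sup>2 / 4 * (LINT x|m. exp (t * S x))"
  proof -
    have "(\<Sum>i<N. (t / 2 * exp (t / 2 * S x))\<^sup>2) = real N * t\<^sup>2 / 4 * exp (t * S x)" for x
      unfolding power_mult_distrib e2 by (simp add: power_divide)
    then show ?thesis by (simp only: integral_mult_right_zero)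
  qed
  moreover have "(LINT x|m. exp (t * S x) * ln (exp (t * S x))) = (LINT x|m. t * S x * exp (t * S x))"
    by (simp only: ln_exp mult.commute[of "exp _"])
  ultimately show ?thesis by (simp only:)
qed

end

context confinement
begin

text \<open>Up to normalisation, the density of \<open>sqrt n\<close> times the Hubbard--Stratonovich field.\<close>

definition scaled :: "nat \<Rightarrow> real \<Rightarrow> real \<Rightarrow> real" where
  "scaled n T u = exp (- (T * u\<^sup>2 / 2)) * L (u / sqrt (real n)) ^ n"

lemma scaled_le:
  assumes "1 \<le> n"
  shows "scaled n T u \<le> exp (- ((T - sigma2) * u\<^sup>2 / 2))"
proof -
  have "L (u / sqrt (real n)) ^ n \<le> exp (sigma2 / 2 * (u / sqrt (real n))\<^sup>2) ^ n"
    using L_le L_pos by (intro power_mono) (auto simp: less_imp_le)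
  also have "\<dots> = exp (sigma2 / 2 * u\<^sup>2)"
    using assms by (simp add: exp_of_nat_mult[symmetric] power_divide)
  finally have "scaled n T u \<le> exp (- (T * u\<^sup>2 / 2)) * exp (sigma2 / 2 * u\<^sup>2)"
    unfolding scaled_def by (intro mult_left_mono) auto
  also have "\<dots> = exp (- ((T - sigma2) * u\<^sup>2 / 2))" by (simp add: mult_exp_exp field_simps)
  finally show ?thesis .
qed

lemma scaled_nonneg: "0 \<le> scaled n T u"
  using L_pos by (simp add: scaled_def less_imp_le)

lemma scaled_measurable[measurable]: "scaled n T \<in> borel_measurable borel"
  unfolding scaled_def by measurable

lemma scaled_tendsto: "(\<lambda>n. scaled n T u) \<longlonglongrightarrow> exp (- ((T - sigma2) * u\<^sup>2 / 2))"
proof (rule tendsto_sandwich)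
  have "(\<lambda>n. exp (- (T * u\<^sup>2 / 2)) * (1 + (sigma2 / 2 * u\<^sup>2) / real n) ^ n) \<longlonglongrightarrow> exp (- (T * u\<^sup>2 / 2)) * exp (sigma2 / 2 * u\<^sup>2)"
    by (intro tendsto_mult tendsto_const tendsto_exp_limit_sequentially)
  also have "exp (- (T * u\<^sup>2 / 2)) * exp (sigma2 / 2 * u\<^sup>2) = exp (- ((T - sigma2) * u\<^sup>2 / 2))"
    by (simp add: mult_exp_exp field_simps)
  finally show "(\<lambda>n. exp (- (T * u\<^sup>2 / 2)) * (1 + (sigma2 / 2 * u\<^sup>2) / real n) ^ n) \<longlonglongrightarrow> exp (- ((T - sigma2) * u\<^sup>2 / 2))" .
  show "\<forall>\<^sub>F n in sequentially. exp (- (T * u\<^sup>2 / 2)) * (1 + (sigma2 / 2 * u\<^sup>2) / real n) ^ n \<le> scaled n T u"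
    using eventually_ge_at_top[of 1]
  proof eventually_elim
    case (elim n)
    have "1 + (sigma2 / 2 * u\<^sup>2) / real n \<le> L (u / sqrt (real n))"
      using L_ge[of "u / sqrt (real n)"] by (simp add: power_divide)
    then show ?case unfolding scaled_def using sigma2_pos by (intro mult_left_mono power_mono) auto
  qed
  show "\<forall>\<^sub>F n in sequentially. scaled n T u \<le> exp (- ((T - sigma2) * u\<^sup>2 / 2))"
    using eventually_ge_at_top[of 1] by eventually_elim (rule scaled_le)
qed simp

lemma integral_scaled_tendsto:
  fixes g :: "real \<Rightarrow> real"
  assumes [measurable]: "g \<in> borel_measurable borel"
    and i: "integrable lborel (\<lambda>u. g u * exp (- ((T - sigma2) * u\<^sup>2 / 2)))"
  shows "(\<lambda>n. LINT u|lborel. g u * scaled n T u) \<longlonglongrightarrow> (LINT u|lborel. g u * exp (- ((T - sigma2) * u\<^sup>2 / 2)))"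
proof (rule LIMSEQ_offset[where k=1], rule integral_dominated_convergence)
  show "integrable lborel (\<lambda>u. \<bar>g u * exp (- ((T - sigma2) * u\<^sup>2 / 2))\<bar>)" using i by (rule integrable_abs)
  show "AE u in lborel. norm (g u * scaled (n + 1) T u) \<le> \<bar>g u * exp (- ((T - sigma2) * u\<^sup>2 / 2))\<bar>" for n
    using scaled_le[of "n + 1" T] scaled_nonneg[of "n + 1" T] by (auto intro!: AE_I2 mult_left_mono simp: abs_mult)
  show "AE u in lborel. (\<lambda>n. g u * scaled (n + 1) T u) \<longlonglongrightarrow> g u * exp (- ((T - sigma2) * u\<^sup>2 / 2))"
    by (intro AE_I2 tendsto_mult tendsto_const LIMSEQ_ignore_initial_segment scaled_tendsto)
qed auto

end

context high_temperature
begin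

text \<open>The inequality for \<open>exp (t S)\<close> with \<open>t = 1 / sqrt N\<close>, the scale of the fluctuations of \<open>S\<close>.\<close>

lemma log_sobolev_scaled:
  assumes ls: "log_sobolev N m \<gamma>"
  defines "I0 \<equiv> LINT u|lborel. scaled N T u" and "I1 \<equiv> LINT u|lborel. exp (T * u) * scaled N T u"
    and "J1 \<equiv> LINT u|lborel. u * exp (T * u) * scaled N T u"
  defines "a \<equiv> exp (- (T / 2)) * I1 / I0"
  shows "- T * a + T * exp (- (T / 2)) * J1 / I0 - a * ln a \<le> a / (2 * \<gamma>)"
proof -
  define q where "q = sqrt (real N)"
  have q: "0 < q" "q\<^sup>2 = real N" using N_pos by (auto simp: q_def)
  have wq: "mixing_weight (u / q) = scaled N T u" for u
    using q N by (simp add: mixing_weight_eq scaled_def q_def[symmetric] power_divide)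
  have sc: "(LINT s|lborel. f s) = (LINT u|lborel. f (u / q)) / q" for f :: "real \<Rightarrow> real"
    using lborel_integral_real_affine[of "1 / q" f 0] q by simp
  have Z: "Zn = I0 / q" unfolding Zn_def by (subst sc) (simp add: wq I0_def)
  have N1: "real N * T * (1 / q) * (u / q) = T * u" for u
    using q by (simp add: q(2)[symmetric] power2_eq_square)
  have j0: "(LINT s|lborel. exp (real N * T * (1 / q) * s) * mixing_weight s) = I1 / q"
    by (subst sc) (simp only: wq N1 I1_def)
  have j1: "(LINT s|lborel. s * (exp (real N * T * (1 / q) * s) * mixing_weight s)) = J1 / q / q"
  proof -
    have "(LINT s|lborel. s * (exp (real N * T * (1 / q) * s) * mixing_weight s)) = (LINT u|lborel. u / q * (exp (T * u) * scaled N T u)) / q"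
      by (subst sc) (simp only: wq N1)
    also have "(LINT u|lborel. u / q * (exp (T * u) * scaled N T u)) = J1 / q" by (simp add: J1_def mult.assoc)
    finally show ?thesis .
  qed
  have I0: "0 < I0" using Zn_pos q by (simp add: Z zero_less_divide_iff)
  have N2: "real N * T * (1 / q)\<^sup>2 / 2 = T / 2" using q N by (simp add: power_divide)
  have A: "(LINT x|m. exp (1 / q * S x)) = a"
    using exp_S_moment[of "1 / q"] q I0 by (simp only: has_bochner_integral_iff N2 j0 Z) (simp add: a_def)
  have "(LINT x|m. 1 / q * S x * exp (1 / q * S x)) = 1 / q * (LINT x|m. S x * exp (1 / q * S x))"
    by (simp only: mult.assoc integral_mult_right_zero)
  also have "\<dots> = - T * a + T * exp (- (T / 2)) * J1 / I0"
    unfolding S_exp_S_moment(2) A N2 j1 Z using q I0 by (simp add: q(2)[symmetric] power2_eq_square field_simps)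
  finally have B: "(LINT x|m. 1 / q * S x * exp (1 / q * S x)) = - T * a + T * exp (- (T / 2)) * J1 / I0" .
  have N3: "real N * (1 / q)\<^sup>2 / 4 = 1 / 4" using q N by (simp add: power_divide)
  have "- T * a + T * exp (- (T / 2)) * J1 / I0 - a * ln a \<le> 2 / \<gamma> * (1 / 4 * a)"
    using log_sobolev_exp_S[OF ls, of "1 / q"] unfolding A B N3 .
  then show ?thesis by simp
qed

end

context confinement
begin

text \<open>The test functions \<open>exp (S / sqrt N)\<close> are asymptotically exponentials of a Gaussian variable
  with variance \<open>T * sigma2 / (T - sigma2)\<close>.\<close>

lemma limsup_log_sobolev_constant:
  assumes T: "sigma2 < T"
  shows "limsup (\<lambda>N. log_sobolev_constant N (mean_field_measure V attraction N T))
    \<le> ereal ((T - sigma2) / (T * sigma2))"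
proof -
  have Tp: "0 < T" using T sigma2_pos by linarith
  define \<tau> where "\<tau> = T - sigma2"
  have \<tau>: "0 < \<tau>" using T by (simp add: \<tau>_def)
  define v where "v = T\<^sup>2 / \<tau> - T"
  have v: "v = T * sigma2 / \<tau>" using \<tau> by (simp add: v_def \<tau>_def power2_eq_square field_simps)
  have vp: "0 < v" using v \<tau> Tp sigma2_pos by simp
  define I0 where "I0 n = (LINT u|lborel. scaled n T u)" for n
  define I1 where "I1 n = (LINT u|lborel. exp (T * u) * scaled n T u)" for n
  define J1 where "J1 n = (LINT u|lborel. u * exp (T * u) * scaled n T u)" for n
  define a where "a n = exp (- (T / 2)) * I1 n / I0 n" for n
  define b where "b n = - T * a n + T * exp (- (T / 2)) * J1 n / I0 n" for n
  define G where "G = sqrt (2 * pi / \<tau>)"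
  have Gp: "0 < G" using \<tau> by (simp add: G_def)
  have ex: "exp (c * u) * exp (- (\<tau> * u\<^sup>2 / 2)) = exp (c * u - \<tau> * u\<^sup>2 / 2)" for c u by (simp add: mult_exp_exp)
  have i0: "integrable lborel (\<lambda>u. 1 * exp (- (\<tau> * u\<^sup>2 / 2)))" "(LINT u|lborel. 1 * exp (- (\<tau> * u\<^sup>2 / 2))) = G"
    using has_bochner_integral_gaussian[OF \<tau>, of 0] by (simp_all add: has_bochner_integral_iff G_def)
  have i1: "integrable lborel (\<lambda>u. exp (T * u) * exp (- (\<tau> * u\<^sup>2 / 2)))"
    "(LINT u|lborel. exp (T * u) * exp (- (\<tau> * u\<^sup>2 / 2))) = G * exp (T\<^sup>2 / (2 * \<tau>))"
    unfolding ex using has_bochner_integral_gaussian[OF \<tau>, of T] by (simp_all add: has_bochner_integral_iff G_def)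
  have j1: "integrable lborel (\<lambda>u. u * exp (T * u) * exp (- (\<tau> * u\<^sup>2 / 2)))"
    "(LINT u|lborel. u * exp (T * u) * exp (- (\<tau> * u\<^sup>2 / 2))) = T / \<tau> * (G * exp (T\<^sup>2 / (2 * \<tau>)))"
    unfolding mult.assoc ex using gaussian_first_moment[OF \<tau>, of T] by (simp_all add: G_def)
  have L0: "I0 \<longlonglongrightarrow> G"
    using integral_scaled_tendsto[of "\<lambda>_. 1" T, folded \<tau>_def] i0 by (simp add: I0_def[abs_def])
  have L1: "I1 \<longlonglongrightarrow> G * exp (T\<^sup>2 / (2 * \<tau>))"
    using integral_scaled_tendsto[of "\<lambda>u. exp (T * u)" T, folded \<tau>_def, OF _ i1(1)] by (simp add: I1_def[abs_def] i1(2))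
  have LJ: "J1 \<longlonglongrightarrow> T / \<tau> * (G * exp (T\<^sup>2 / (2 * \<tau>)))"
    using integral_scaled_tendsto[of "\<lambda>u. u * exp (T * u)" T, folded \<tau>_def, OF _ j1(1)] unfolding J1_def[abs_def] j1(2) by simp
  define al where "al = exp (v / 2)"
  have al: "exp (- (T / 2)) * (G * exp (T\<^sup>2 / (2 * \<tau>))) / G = al"
  proof -
    have "- (T / 2) + T\<^sup>2 / (2 * \<tau>) = v / 2" by (simp add: v_def diff_divide_distrib)
    then have "exp (- (T / 2)) * exp (T\<^sup>2 / (2 * \<tau>)) = al" by (simp only: al_def exp_add[symmetric])
    then show ?thesis using Gp by simp
  qed
  have alp: "0 < al" by (simp add: al_def)
  have La: "a \<longlonglongrightarrow> al"
    unfolding a_def[abs_def] al[symmetric] using Gp by (intro tendsto_intros L0 L1) auto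
  have Lb: "b \<longlonglongrightarrow> v * al"
  proof -
    have "b \<longlonglongrightarrow> - T * al + T * exp (- (T / 2)) * (T / \<tau> * (G * exp (T\<^sup>2 / (2 * \<tau>)))) / G"
      unfolding b_def[abs_def] using Gp by (intro tendsto_intros L0 La LJ) auto
    also have "- T * al + T * exp (- (T / 2)) * (T / \<tau> * (G * exp (T\<^sup>2 / (2 * \<tau>)))) / G = v * al"
      unfolding al[symmetric] v_def by (simp add: power2_eq_square algebra_simps)
    finally show ?thesis .
  qed
  define E where "E n = b n - a n * ln (a n)" for n
  have LE: "E \<longlonglongrightarrow> v * al - al * ln al"
    unfolding E_def[abs_def] using alp by (intro tendsto_intros La Lb) auto
  have El: "v * al - al * ln al = v / 2 * al" by (simp add: al_def field_simps)
  have Elp: "0 < v / 2 * al" using vp alp by simp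
  have Epos: "\<forall>\<^sub>F n in sequentially. 0 < E n" using order_tendstoD(1)[OF LE] Elp El by simp
  have apos: "\<forall>\<^sub>F n in sequentially. 0 < a n" using order_tendstoD(1)[OF La] alp by simp
  have bound: "\<forall>\<^sub>F n in sequentially. log_sobolev_constant n (mean_field_measure V attraction n T) \<le> ereal (a n / (2 * E n))"
    using Epos apos eventually_ge_at_top[of 1]
  proof eventually_elim
    case (elim n)
    interpret high_temperature V V' n T by unfold_locales (use elim T in auto)
    show ?case
      unfolding log_sobolev_constant_def
    proof (rule Sup_least)
      fix x assume "x \<in> {ereal \<gamma> | \<gamma>. log_sobolev n m \<gamma>}"
      then obtain \<gamma> where x: "x = ereal \<gamma>" and ls: "log_sobolev n m \<gamma>" by blast
      have \<gamma>: "0 < \<gamma>" using ls by (simp add: log_sobolev_def)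
      have "E n \<le> a n / (2 * \<gamma>)"
        using log_sobolev_scaled[OF ls] by (simp only: E_def b_def a_def I0_def I1_def J1_def)
      then have "\<gamma> \<le> a n / (2 * E n)" using \<gamma> elim(1) by (simp add: field_simps)
      then show "x \<le> ereal (a n / (2 * E n))" by (simp add: x)
    qed
  qed
  have "(\<lambda>n. a n / (2 * E n)) \<longlonglongrightarrow> al / (2 * (v * al - al * ln al))"
    using Elp El by (intro tendsto_intros La LE) auto
  also have "al / (2 * (v * al - al * ln al)) = 1 / v"
    unfolding El using alp vp by simp
  also have "1 / v = (T - sigma2) / (T * sigma2)" by (simp add: v \<tau>_def)
  finally have lim: "(\<lambda>n. ereal (a n / (2 * E n))) \<longlonglongrightarrow> ereal ((T - sigma2) / (T * sigma2))"
    by (rule tendsto_ereal)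
  have "limsup (\<lambda>N. log_sobolev_constant N (mean_field_measure V attraction N T)) \<le> limsup (\<lambda>n. ereal (a n / (2 * E n)))"
    using bound by (rule Limsup_mono)
  also have "\<dots> = ereal ((T - sigma2) / (T * sigma2))"
    by (rule lim_imp_Limsup[OF _ lim]) simp
  finally show ?thesis .
qed

end

section \<open>Quartic and GHS potentials\<close>

context even_potential
begin

lemma alpha_prob:
  assumes R: "0 < R" "0 < V' R"
  shows "0 < (LINT y|lborel. exp (- V y))" "prob_space (alpha V)"
proof -
  define a where "a = V' R / (2 * R)"
  have a: "0 < a" "2 * a * R \<le> V' R" using R by (simp_all add: a_def)
  obtain b where b: "\<And>x. a * x\<^sup>2 - b \<le> V x" using V_lower_bound_if[OF R(1) a(2)] by blast
  have i: "integrable lborel (\<lambda>x. exp (- V x))"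
  proof (rule Bochner_Integration.integrable_bound)
    show "integrable lborel (\<lambda>x. exp b * exp (0 * x - 2 * a * x\<^sup>2 / 2))"
      using has_bochner_integral_gaussian[of "2 * a" 0] a by (auto simp: has_bochner_integral_iff)
    show "AE x in lborel. norm (exp (- V x)) \<le> norm (exp b * exp (0 * x - 2 * a * x\<^sup>2 / 2))"
    proof (rule AE_I2)
      fix x
      have "- V x \<le> b + (0 * x - 2 * a * x\<^sup>2 / 2)" using b[of x] by simp
      then show "norm (exp (- V x)) \<le> norm (exp b * exp (0 * x - 2 * a * x\<^sup>2 / 2))"
        unfolding mult_exp_exp by simp
    qed
  qed simp
  then have "(LINT y|lborel. exp (- V y)) = 0 \<longleftrightarrow> (AE y in lborel. exp (- V y) = 0)"
    by (intro integral_nonneg_eq_0_iff_AE) auto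
  moreover have "\<not> (AE y in lborel. exp (- V y) = 0)" by (simp add: AE_iff_measurable[OF _ refl])
  moreover have "0 \<le> (LINT y|lborel. exp (- V y))" by simp
  ultimately show Z: "0 < (LINT y|lborel. exp (- V y))" by linarith
  show "prob_space (alpha V)"
  proof
    have "emeasure (alpha V) (space (alpha V)) = (\<integral>\<^sup>+x. ennreal (exp (- V x) / (LINT y|lborel. exp (- V y))) \<partial>lborel)"
      by (simp add: alpha_def emeasure_density)
    also have "\<dots> = ennreal (LINT x|lborel. exp (- V x) / (LINT y|lborel. exp (- V y)))"
      using i Z by (intro nn_integral_eq_integral) auto
    finally show "emeasure (alpha V) (space (alpha V)) = 1" using Z by simp
  qed
qed

text \<open>If \<open>V'\<close> had at most linear growth, then \<open>V\<close> would grow at most quadratically, and the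
  one-particle partition function would be infinite at low temperature.\<close>

lemma superlinear_if_partition_function_finite:
  assumes R: "0 < R" "0 < V' R"
    and Z: "\<And>T. 0 < T \<Longrightarrow> partition_function V attraction 1 T < \<infinity>"
  shows "confinement V V'"
proof unfold_locales
  fix a
  show "\<exists>R>0. a * R \<le> V' R"
  proof (rule ccontr)
    assume "\<not> (\<exists>R>0. a * R \<le> V' R)"
    then have lt: "V' x < a * x" if "0 < x" for x using that by force
    have a: "0 < a" using lt[OF R(1)] R by (smt (verit) mult_nonpos_nonneg)
    define Zv where "Zv = (LINT y|lborel. exp (- V y))"
    have Zv: "0 < Zv" and P: "prob_space (alpha V)" using alpha_prob[OF R] by (simp_all add: Zv_def)
    have le0: "V x \<le> V 0 + a * x\<^sup>2 / 2" if "0 \<le> x" for x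
    proof -
      have "a * 0\<^sup>2 / 2 - V 0 \<le> a * x\<^sup>2 / 2 - V x"
      proof (rule DERIV_nonneg_imp_nondecreasing[OF that])
        fix y :: real assume "0 \<le> y"
        then have "0 \<le> a * y - V' y" using lt[of y] V'_0 by (cases "y = 0") auto
        moreover have "((\<lambda>x. a * x\<^sup>2 / 2 - V x) has_real_derivative a * y - V' y) (at y)"
          by (auto intro!: derivative_eq_intros V')
        ultimately show "\<exists>D. ((\<lambda>x. a * x\<^sup>2 / 2 - V x) has_real_derivative D) (at y) \<and> 0 \<le> D" by blast
      qed
      then show ?thesis by simp
    qed
    have le: "exp (- V 0) \<le> exp (a * x\<^sup>2 / 2) * exp (- V x)" for x
      using le0[of "\<bar>x\<bar>"] by (simp add: V_abs mult_exp_exp)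
    interpret product_prob_space "\<lambda>_::nat. alpha V" "{0::nat}" by (rule product_prob_spaceI) (rule P)
    have am: "sets (alpha V) = sets borel" by (simp add: alpha_def)
    have "partition_function V attraction 1 (1 / a) = (\<integral>\<^sup>+x. ennreal (exp (a * (x 0)\<^sup>2 / 2)) \<partial>PiM {0::nat} (\<lambda>_. alpha V))"
    proof -
      have "gibbs_weight attraction 1 (1 / a) x = exp (a * (x 0)\<^sup>2 / 2)" for x
        using a by (simp add: gibbs_weight_def power2_eq_square)
      moreover have "{..<1} = {0::nat}" by auto
      ultimately show ?thesis by (simp add: partition_function_def)
    qed
    also have "\<dots> = (\<integral>\<^sup>+x. ennreal (exp (a * x\<^sup>2 / 2)) \<partial>alpha V)"
      by (rule product_nn_integral_singleton) (simp add: am cong: measurable_cong_sets)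
    also have "\<dots> = (\<integral>\<^sup>+x. ennreal (exp (- V x) / Zv) * ennreal (exp (a * x\<^sup>2 / 2)) \<partial>lborel)"
      unfolding alpha_def Zv_def[symmetric] by (subst nn_integral_density) auto
    finally have "(\<integral>\<^sup>+x. ennreal (exp (- V x) / Zv) * ennreal (exp (a * x\<^sup>2 / 2)) \<partial>lborel) < \<infinity>"
      using Z[of "1 / a"] a by simp
    moreover have "(\<integral>\<^sup>+x. ennreal (exp (- V 0) / Zv) \<partial>(lborel::real measure)) \<le>
        (\<integral>\<^sup>+x. ennreal (exp (- V x) / Zv) * ennreal (exp (a * x\<^sup>2 / 2)) \<partial>lborel)"
    proof (rule nn_integral_mono)
      fix x :: real
      have "exp (- V 0) / Zv \<le> exp (- V x) / Zv * exp (a * x\<^sup>2 / 2)"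
        using divide_right_mono[OF le[of x], of Zv] Zv by (simp add: mult.commute)
      then show "ennreal (exp (- V 0) / Zv) \<le> ennreal (exp (- V x) / Zv) * ennreal (exp (a * x\<^sup>2 / 2))"
        using Zv by (subst ennreal_mult[symmetric]) (auto intro!: ennreal_leI)
    qed
    moreover have "(\<integral>\<^sup>+x. ennreal (exp (- V 0) / Zv) \<partial>(lborel::real measure)) = \<infinity>"
      using Zv by (simp add: ennreal_mult_top)
    ultimately show False by (simp add: top_unique)
  qed
qed

end

lemma even_potential_quartic:
  fixes l :: real
  defines "V \<equiv> (\<lambda>x::real. x ^ 4 / 4 - l * (x\<^sup>2 / 2))"
  shows "even_potential V (deriv V)" "\<exists>R>0. 0 < deriv V R"
proof -
  have d: "(V has_real_derivative x ^ 3 - l * x) (at x)" for x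
    unfolding V_def by (auto intro!: derivative_eq_intros)
  then have dV: "deriv V = (\<lambda>x. x ^ 3 - l * x)" by (auto intro!: ext DERIV_imp_deriv)
  show "even_potential V (deriv V)"
  proof
    show "(V has_real_derivative deriv V x) (at x)" for x using d by (simp add: dV)
    show "V (- x) = V x" for x by (simp add: V_def)
    show "convex_on {0..} (deriv V)"
      unfolding dV
    proof (rule f''_ge0_imp_convex)
      show "((\<lambda>x. x ^ 3 - l * x) has_real_derivative 3 * x\<^sup>2 - l) (at x)" for x
        by (auto intro!: derivative_eq_intros)
      show "((\<lambda>x. 3 * x\<^sup>2 - l) has_real_derivative 6 * x) (at x)" for x
        by (auto intro!: derivative_eq_intros)
    qed auto
  qed
  have "0 < deriv V (1 + \<bar>l\<bar>)"
  proof -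
    have "1 + \<bar>l\<bar> \<le> (1 + \<bar>l\<bar>)\<^sup>2" by (simp add: power2_eq_square algebra_simps)
    then have "0 < (1 + \<bar>l\<bar>) * ((1 + \<bar>l\<bar>)\<^sup>2 - l)" by (intro mult_pos_pos) auto
    then show ?thesis by (simp add: dV power3_eq_cube power2_eq_square algebra_simps)
  qed
  then show "\<exists>R>0. 0 < deriv V R" by (intro exI[of _ "1 + \<bar>l\<bar>"]) auto
qed

text \<open>If \<open>V'\<close> were nonpositive on the positive half-line, \<open>V\<close> would be bounded above there.\<close>

lemma even_potential_ghs:
  assumes V: "ghs_class V"
  shows "even_potential V (deriv V)" "\<exists>R>0. 0 < deriv V R"
proof -
  have C2: "C2 V" and ev: "\<And>x. V (- x) = V x" and lim: "filterlim V at_top at_infinity"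
    and cv: "convex_on {0..} (deriv V)" using V by (auto simp: ghs_class_def)
  have d: "(V has_real_derivative deriv V x) (at x)" for x
    using C2 by (simp add: C2_def DERIV_deriv_iff_real_differentiable)
  show "even_potential V (deriv V)" by unfold_locales (use d ev cv in auto)
  show "\<exists>R>0. 0 < deriv V R"
  proof (rule ccontr)
    assume "\<not> (\<exists>R>0. 0 < deriv V R)"
    then have neg: "deriv V x \<le> 0" if "0 < x" for x using that by force
    have "V x \<le> V 1" if "1 \<le> x" for x
      using that by (rule DERIV_nonpos_imp_nonincreasing) (use d neg in force)
    moreover have "\<forall>\<^sub>F x in at_top. V 1 < V x"
      using filterlim_mono[OF lim order_refl at_top_le_at_infinity] by (simp add: filterlim_at_top_dense)
    then have "\<forall>\<^sub>F x in at_top. V 1 < V x \<and> 1 \<le> x"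
      using eventually_ge_at_top[of "1::real"] by eventually_elim auto
    then obtain x where "V 1 < V x" "1 \<le> x" using eventually_happens[of _ "at_top::real filter"] by auto
    ultimately show False by force
  qed
qed

theorem corollary1p4:
  fixes V :: "real \<Rightarrow> real" and W :: "real \<Rightarrow> real \<Rightarrow> real"
  assumes W: "W = (\<lambda>x y. - (x * y))"
    and V: "(\<exists>l::real. V = (\<lambda>x. x ^ 4 / 4 - l * (x\<^sup>2 / 2))) \<or> ghs_class V"
    and Z: "\<And>(N::nat) (T::real). N \<ge> 1 \<Longrightarrow> T > 0 \<Longrightarrow> partition_function V W N T < \<infinity>"
  shows "(\<forall>T > critical_temperature V W.
            \<exists>\<gamma>>0. \<forall>N\<ge>1. log_sobolev N (mean_field_measure V W N T) \<gamma>)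
       \<and> (\<exists>c1>0. \<forall>T > critical_temperature V W.
            limsup (\<lambda>N. log_sobolev_constant N (mean_field_measure V W N T))
              \<le> ereal (c1 * (T - critical_temperature V W)))
       \<and> (\<forall>T0 > critical_temperature V W. \<exists>c2>0. \<forall>T. critical_temperature V W < T \<and> T \<le> T0 \<longrightarrow>
            (\<forall>N\<ge>1. log_sobolev_constant N (mean_field_measure V W N T)
              \<ge> ereal (c2 * (T - critical_temperature V W))))"
proof -
  from V have "even_potential V (deriv V) \<and> (\<exists>R>0. 0 < deriv V R)"
  proof
    assume "\<exists>l. V = (\<lambda>x. x ^ 4 / 4 - l * (x\<^sup>2 / 2))"
    then obtain l where Vl: "V = (\<lambda>x. x ^ 4 / 4 - l * (x\<^sup>2 / 2))" ..
    show ?thesis using even_potential_quartic[of l] unfolding Vl[symmetric] by (rule conjI)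
  next
    assume "ghs_class V"
    from even_potential_ghs[OF this] show ?thesis by (rule conjI)
  qed
  then obtain R where ep: "even_potential V (deriv V)" and R: "0 < R" "0 < deriv V R" by blast
  interpret confinement V "deriv V"
    by (rule even_potential.superlinear_if_partition_function_finite[OF ep R]) (use Z W in auto)
  have Tc: "critical_temperature V W = sigma2" unfolding W by (rule critical_temperature_eq)
  obtain \<kappa> where \<kappa>: "tilt_log_sobolev \<kappa>" using log_sobolev_tilt by blast
  then have \<kappa>pos: "0 < \<kappa>" by (simp add: tilt_log_sobolev_def)
  have ls: "log_sobolev N (mean_field_measure V W N T) ((T - sigma2) / (2 * T * \<kappa>))"
    if "sigma2 < T" "1 \<le> N" for T N
  proof -
    interpret high_temperature V "deriv V" N T by unfold_locales (use that in auto)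
    show ?thesis unfolding W by (rule log_sobolev_m[OF \<kappa>])
  qed
  show ?thesis unfolding Tc
  proof (intro conjI allI impI)
    fix T assume "sigma2 < T"
    then show "\<exists>\<gamma>>0. \<forall>N\<ge>1. log_sobolev N (mean_field_measure V W N T) \<gamma>"
      using ls sigma2_pos \<kappa>pos by (intro exI[of _ "(T - sigma2) / (2 * T * \<kappa>)"]) auto
  next
    show "\<exists>c1>0. \<forall>T>sigma2. limsup (\<lambda>N. log_sobolev_constant N (mean_field_measure V W N T)) \<le> ereal (c1 * (T - sigma2))"
    proof (intro exI[of _ "1 / (sigma2 * sigma2)"] conjI allI impI)
      show "0 < 1 / (sigma2 * sigma2)" using sigma2_pos by simp
      fix T assume T: "sigma2 < T"
      have "(T - sigma2) / (T * sigma2) \<le> (T - sigma2) / (sigma2 * sigma2)"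
        using T sigma2_pos by (intro divide_left_mono mult_right_mono mult_pos_pos) auto
      then have "ereal ((T - sigma2) / (T * sigma2)) \<le> ereal (1 / (sigma2 * sigma2) * (T - sigma2))" by simp
      with limsup_log_sobolev_constant[OF T]
      show "limsup (\<lambda>N. log_sobolev_constant N (mean_field_measure V W N T)) \<le> ereal (1 / (sigma2 * sigma2) * (T - sigma2))"
        unfolding W by (rule order_trans)
    qed
  next
    fix T0 assume T0: "sigma2 < T0"
    show "\<exists>c2>0. \<forall>T. sigma2 < T \<and> T \<le> T0 \<longrightarrow>
       (\<forall>N\<ge>1. ereal (c2 * (T - sigma2)) \<le> log_sobolev_constant N (mean_field_measure V W N T))"
    proof (intro exI[of _ "1 / (2 * T0 * \<kappa>)"] conjI allI impI)
      show "0 < 1 / (2 * T0 * \<kappa>)" using T0 sigma2_pos \<kappa>pos by simp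
      fix T and N :: nat assume T: "sigma2 < T \<and> T \<le> T0" and N: "1 \<le> N"
      have "(T - sigma2) / (2 * T0 * \<kappa>) \<le> (T - sigma2) / (2 * T * \<kappa>)"
        using T sigma2_pos \<kappa>pos by (intro divide_left_mono mult_right_mono mult_pos_pos) auto
      then have "ereal (1 / (2 * T0 * \<kappa>) * (T - sigma2)) \<le> ereal ((T - sigma2) / (2 * T * \<kappa>))" by simp
      also have "\<dots> \<le> log_sobolev_constant N (mean_field_measure V W N T)"
        unfolding log_sobolev_constant_def by (rule Sup_upper) (use ls T N in auto)
      finally show "ereal (1 / (2 * T0 * \<kappa>) * (T - sigma2)) \<le> log_sobolev_constant N (mean_field_measure V W N T)" .
    qed
  qed
qed

end
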